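(* Let $\mathcal D$ be a regular set of ordered oriented virtual link diagrams and let $\mathcal{VL}_{\mathrm{flat}}$ be the free $\mathbb Z$-module generated by ordered oriented flat virtual links. The functions $S_1,S_2,S_3$ with values in $\mathcal{VL}_{\mathrm{flat}}$ defined for classical crossings $c\in C(D)$, $D\in\mathcal D$, by $$S_1(c)=[D_c],\qquad S_2(c)=[D^c],\qquad S_3(c)=[{}^{c}D]$$ (where $D_c$, $D^c$, ${}^cD$ are the diagrams obtained from $D$ by type-1, type-2 and type-3 smoothing at $c$) are even weight functions. Moreover, if a crossing $c\in C(D)$ can be reduced by an RI move, then: (a) $[D_c]$ is equivalent to either $[D]$ or $[D']$, where $D'$ is obtained from $D$ by reversing the orientation of the component containing $c$; (b) $[D^c]$ is equivalent to $[D]$ with one unknot added, where the ordering and orientation of components are those induced by the type-2 smoothing; (c) type-3 smoothing cannot be applied at $c$.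
   Context: Diagrams. A virtual link diagram is a 4-regular plane diagram of immersed oriented circles in which every vertex is marked as a classical crossing (with over/under information) or as a virtual crossing. It is ordered if its $n$ components are labelled by $1,\dots,n$. Generalized Reidemeister moves are the classical moves RI, RII, RIII, the virtual moves VRI, VRII, VRIII, and the move SV, in which a strand having two virtual crossings with the two strands of a classical crossing is moved across that crossing (all orientations; labels respected). Ordered oriented virtual links are diagrams modulo these moves; ordered oriented flat virtual links are diagrams modulo these moves and crossing changes (switching over and under at a classical crossing). $[D]$ denotes the flat virtual link represented by $D$. A set $\mathcal D$ of diagrams is regular if it is closed under generalized Reidemeister moves, crossing changes, reversing orientation and reordering of components. $C(D)$ is the set of classical crossings of $D$; $C(\mathcal D)$ is the set of all classical crossings of diagrams in $\mathcal D$. Weight functions. A function $w:C(\mathcal D)\to G$, $G$ an abelian group, is a weight function if: (C1) a crossing not involved in a generalized Reidemeister move has the same weight before and after the move; (C2) each of the three crossings involved in an RIII move has the same weight as the corresponding crossing after the move; (C3) the classical crossing involved in an SV move has the same weight before and after. It is even if the two crossings $\alpha,\beta$ involved in any RII move satisfy $w(\alpha)=w(\beta)$. A subset of $C(\mathcal D)$ is consistent if its characteristic function is an even weight function; a weight function may be defined only on a consistent subset (the conditions being required for crossings of that subset), and is then extended by $0$ to $C(\mathcal D)$. Smoothings. Let $c$ be a classical crossing of an ordered oriented $n$-component diagram $D$. If both strands at $c$ belong to the same, $i$-th, component, that component is cut at $c$ into two arcs: one leaving $c$ along the overstrand and returning along the understrand, the other leaving along the understrand and returning along the overstrand. Type-1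 smoothing (against orientation; applied at self-crossings of a component): remove $c$, join the two incoming ends at $c$ to each other and the two outgoing ends to each other, and reverse the orientation of one of the two arcs, so that the $i$-th component becomes again one oriented component, labelled $i$. Type-2 smoothing (applied at self-crossings): remove $c$ and close up each of the two arcs separately (joining incoming to outgoing ends as orientation prescribes), giving $n+1$ components; one of the two new components keeps its orientation and is labelled $i$, the other gets the reversed orientation and is labelled $n+1$. Type-3 smoothing (applied at crossings of two distinct components $i\ne j$): remove $c$, join the two incoming ends to each other and the two outgoing ends to each other, and reverse the orientation of one of the two components, so that they merge into one oriented component; the result has $n-1$ components (the merged component is labelled $\min(i,j)$ and labels larger than $\max(i,j)$ are lowered by one). In each type, which arc (or component) keeps its orientation depends only on the over/under information: it is the one leaving $c$ along the overstrand, or always the one leaving $c$ along the understrand; this choice is a convention fixed once for all crossings. $S_1,S_2$ are defined on self-crossings of components and $S_3$ on crossings between distinct components (both are consistent sets). *)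

theory Defs
  imports "HOL-Library.Poly_Mapping"
begin

section \<open>Plane diagrams\<close>

text \<open>
  A plane diagram is put in general position with respect to a height function and read from
  bottom to top.  It becomes a list of layers, each containing exactly one local minimum (cup),
  local maximum (cap) or crossing; a layer \<open>(p, g)\<close> has \<open>p\<close> vertical strands to the left of the
  generator \<open>g\<close>.  Every diagram is plane isotopic to one of this form, and two such diagrams are
  plane isotopic iff they are related by the moves of kind \<open>Isotopy\<close> below (interchange of
  distant heights, zigzag cancellation, swinging a crossing around a maximum or minimum;
  Freyd-Yetter, Turaev, Kauffman).

  A colour \<open>(l, d)\<close> of a strand at some height is the label \<open>l\<close> of its component together with
  its direction, upwards iff \<open>d\<close>.  Only cups have to be decorated, with the colour of their left
  end: the colours of all other strands follow.

  \<open>Classical b\<close> is a crossing whose overstrand is, iff \<open>b\<close>, the one running between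
  bottom left and top right.
\<close>

datatype mark = Classical bool | Virtual

datatype gen = Cup nat bool | Cap | Cross mark

type_synonym layer = "nat \<times> gen"
type_synonym diagram = "layer list"
type_synonym colour = "nat \<times> bool"

fun ins :: "gen \<Rightarrow> nat" where
  "ins (Cup l d) = 0"
| "ins Cap = 2"
| "ins (Cross m) = 2"

fun outs :: "gen \<Rightarrow> nat" where
  "outs (Cup l d) = 2"
| "outs Cap = 0"
| "outs (Cross m) = 2"

fun fits :: "layer \<Rightarrow> colour list \<Rightarrow> bool" where
  "fits (p, Cup l d) L \<longleftrightarrow> p \<le> length L"
| "fits (p, Cap) L \<longleftrightarrow> p + 1 < length L \<and> fst (L ! p) = fst (L ! (p + 1))
                                        \<and> snd (L ! p) \<noteq> snd (L ! (p + 1))"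
| "fits (p, Cross m) L \<longleftrightarrow> p + 1 < length L"

fun act :: "layer \<Rightarrow> colour list \<Rightarrow> colour list" where
  "act (p, Cup l d) L = take p L @ [(l, d), (l, \<not> d)] @ drop p L"
| "act (p, Cap) L = take p L @ drop (p + 2) L"
| "act (p, Cross m) L = L[p := L ! (p + 1), p + 1 := L ! p]"

text \<open>The colours of the strands above the first \<open>k\<close> layers.\<close>

definition level :: "diagram \<Rightarrow> nat \<Rightarrow> colour list" where
  "level D k = fold act (take k D) []"

definition closed_diagram :: "diagram \<Rightarrow> bool" where
  "closed_diagram D \<longleftrightarrow> (\<forall>k<length D. fits (D ! k) (level D k)) \<and> level D (length D) = []"

text \<open>
  A point \<open>(k, i)\<close> is the \<open>i\<close>-th strand (counted from \<open>0\<close>) above the first \<open>k\<close> layers.  \<open>link D X\<close>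
  relates points which are joined by a strand inside one layer, where the two strands of
  the crossings in the layers of \<open>X\<close> are cut.
\<close>

type_synonym point = "nat \<times> nat"

definition points :: "diagram \<Rightarrow> point set" where
  "points D = {(k, i). k \<le> length D \<and> i < length (level D k)}"

definition colour_at :: "diagram \<Rightarrow> point \<Rightarrow> colour" where
  "colour_at D x = level D (fst x) ! snd x"

inductive link :: "diagram \<Rightarrow> nat set \<Rightarrow> point \<Rightarrow> point \<Rightarrow> bool"
  for D :: diagram and X :: "nat set" where
  left: "j < length D \<Longrightarrow> D ! j = (p, g) \<Longrightarrow> i < p \<Longrightarrow> link D X (j, i) (j + 1, i)"
| right: "j < length D \<Longrightarrow> D ! j = (p, g) \<Longrightarrow> p + ins g + i < length (level D j)
    \<Longrightarrow> link D X (j, p + ins g + i) (j + 1, p + outs g + i)"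
| cup: "j < length D \<Longrightarrow> D ! j = (p, Cup l d) \<Longrightarrow> link D X (j + 1, p) (j + 1, p + 1)"
| cap: "j < length D \<Longrightarrow> D ! j = (p, Cap) \<Longrightarrow> link D X (j, p) (j, p + 1)"
| rising: "j < length D \<Longrightarrow> D ! j = (p, Cross m) \<Longrightarrow> j \<notin> X \<Longrightarrow> link D X (j, p) (j + 1, p + 1)"
| falling: "j < length D \<Longrightarrow> D ! j = (p, Cross m) \<Longrightarrow> j \<notin> X \<Longrightarrow> link D X (j, p + 1) (j + 1, p)"

definition connected_by :: "diagram \<Rightarrow> nat set \<Rightarrow> point \<Rightarrow> point \<Rightarrow> bool" where
  "connected_by D X = equivclp (link D X)"

definition labels :: "diagram \<Rightarrow> nat set" where
  "labels D = (\<lambda>x. fst (colour_at D x)) ` points D"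

definition ncomp :: "diagram \<Rightarrow> nat" where
  "ncomp D = card (labels D)"

text \<open>
  Ordered oriented virtual link diagrams.  The last condition says that every label belongs to
  a single component; that a component carries a single label and coherent directions
  is part of \<open>closed_diagram\<close>.
\<close>

definition vl_diagram :: "diagram \<Rightarrow> bool" where
  "vl_diagram D \<longleftrightarrow> closed_diagram D \<and> labels D = {1..ncomp D} \<and>
     (\<forall>x\<in>points D. \<forall>y\<in>points D.
        fst (colour_at D x) = fst (colour_at D y) \<longrightarrow> connected_by D {} x y)"

text \<open>Crossings are named by the index of their layer.\<close>

definition crossings :: "diagram \<Rightarrow> nat set" where
  "crossings D = {c. c < length D \<and> (\<exists>p b. D ! c = (p, Cross (Classical b)))}"


section \<open>Generalized Reidemeister moves\<close>

text \<open>
  \<open>elementary k t t' J\<close>: the tangle \<open>t\<close> may be replaced by \<open>t'\<close> (or conversely) in a move of kind \<open>k\<close>;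
  \<open>J\<close> relates the indices of corresponding crossings.  The tangles need not be listed in
  rotated positions, as a rotation is a composition of isotopies, nor with all orientations, as
  these come from the colours of the surrounding diagram.

  In the moves with three crossings, \<open>x\<close>, \<open>y\<close>, \<open>z\<close> describe the crossings of strands 1 and 2,
  1 and 3, 2 and 3, respectively, numbered by their bottom ends.  The premise in RIII
  excludes the two cyclic choices, where no strand is the top one.
\<close>

datatype kind = Isotopy | RI | RII | RIII | VRI | VRII | VRIII | SV

fun swap_slope :: "mark \<Rightarrow> mark" where
  "swap_slope (Classical b) = Classical (\<not> b)"
| "swap_slope Virtual = Virtual"

inductive elementary :: "kind \<Rightarrow> layer list \<Rightarrow> layer list \<Rightarrow> (nat \<times> nat) set \<Rightarrow> bool" where
  interchange: "elementary Isotopy [(i, g), (i + outs g + r, h)] [(i + ins g + r, h), (i, g)]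
    {(0, 1), (1, 0)}"
| zigzag1: "elementary Isotopy [(1, Cup l d), (0, Cap)] [] {}"
| zigzag2: "elementary Isotopy [(0, Cup l d), (1, Cap)] [] {}"
| swing_cap: "elementary Isotopy [(1, Cross m), (0, Cap)] [(0, Cross (swap_slope m)), (1, Cap)]
    {(0, 0)}"
| swing_cup: "elementary Isotopy [(0, Cup l d), (1, Cross m)]
    [(1, Cup l d), (0, Cross (swap_slope m))] {(1, 1)}"
| RI: "elementary RI [(0, Cross (Classical b)), (0, Cap)] [(0, Cap)] {}"
| VRI: "elementary VRI [(0, Cross Virtual), (0, Cap)] [(0, Cap)] {}"
| RII: "elementary RII [(0, Cross (Classical b)), (0, Cross (Classical (\<not> b)))] [] {}"
| VRII: "elementary VRII [(0, Cross Virtual), (0, Cross Virtual)] [] {}"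
| RIII: "(x = z \<longrightarrow> y = x) \<Longrightarrow> elementary RIII
    [(0, Cross (Classical x)), (1, Cross (Classical y)), (0, Cross (Classical z))]
    [(1, Cross (Classical z)), (0, Cross (Classical y)), (1, Cross (Classical x))]
    {(0, 2), (1, 1), (2, 0)}"
| VRIII: "elementary VRIII
    [(0, Cross Virtual), (1, Cross Virtual), (0, Cross Virtual)]
    [(1, Cross Virtual), (0, Cross Virtual), (1, Cross Virtual)] {}"
| SV12: "elementary SV
    [(0, Cross (Classical x)), (1, Cross Virtual), (0, Cross Virtual)]
    [(1, Cross Virtual), (0, Cross Virtual), (1, Cross (Classical x))] {(0, 2)}"
| SV13: "elementary SV
    [(0, Cross Virtual), (1, Cross (Classical y)), (0, Cross Virtual)]
    [(1, Cross Virtual), (0, Cross (Classical y)), (1, Cross Virtual)] {(1, 1)}"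
| SV23: "elementary SV
    [(0, Cross Virtual), (1, Cross Virtual), (0, Cross (Classical z))]
    [(1, Cross (Classical z)), (0, Cross Virtual), (1, Cross Virtual)] {(2, 0)}"

definition shift :: "nat \<Rightarrow> layer list \<Rightarrow> layer list" where
  "shift p t = map (\<lambda>(i, g). (p + i, g)) t"

text \<open>
  \<open>move k q U I D D'\<close>: a move of kind \<open>k\<close>, taking place from layer \<open>q\<close> on, relates \<open>D\<close> and \<open>D'\<close>.
  \<open>U\<close> is the correspondence of the crossings outside the tangle that is replaced, \<open>I\<close> that of the
  crossings inside.  A move may be performed in both directions.
\<close>

definition move ::
  "kind \<Rightarrow> nat \<Rightarrow> (nat \<times> nat) set \<Rightarrow> (nat \<times> nat) set \<Rightarrow> diagram \<Rightarrow> diagram \<Rightarrow> bool" where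
  "move k q U I D D' \<longleftrightarrow> vl_diagram D \<and> vl_diagram D' \<and>
     (\<exists>t t' J pre p post. elementary k t t' J \<and> q = length pre \<and>
        D = pre @ shift p t @ post \<and> D' = pre @ shift p t' @ post \<and>
        U = {(c, c) | c. c < q} \<union> {(q + length t + r, q + length t' + r) | r. r < length post} \<and>
        I = {(q + a, q + b) | a b. (a, b) \<in> J})"

definition moves_to :: "diagram \<Rightarrow> diagram \<Rightarrow> bool" where
  "moves_to D D' \<longleftrightarrow> (\<exists>k q U I. move k q U I D D')"

definition crossing_change :: "diagram \<Rightarrow> diagram \<Rightarrow> bool" where
  "crossing_change D D' \<longleftrightarrow> vl_diagram D \<and> vl_diagram D' \<and>
     (\<exists>c p b. c < length D \<and> D ! c = (p, Cross (Classical b)) \<and>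
        D' = D[c := (p, Cross (Classical (\<not> b)))])"


section \<open>Flat virtual links\<close>

definition flat_equiv :: "diagram \<Rightarrow> diagram \<Rightarrow> bool" where
  "flat_equiv D D' \<longleftrightarrow> vl_diagram D \<and> vl_diagram D' \<and>
     equivclp (\<lambda>E E'. moves_to E E' \<or> crossing_change E E') D D'"

lemma vl_diagram_Nil: "vl_diagram []"
  by (simp add: vl_diagram_def closed_diagram_def level_def labels_def points_def ncomp_def)

quotient_type flat_link = diagram / partial: flat_equiv
proof (rule part_equivpI)
  show "\<exists>D. flat_equiv D D"
    using vl_diagram_Nil by (auto simp: flat_equiv_def)
  show "symp flat_equiv"
    by (auto simp: symp_def flat_equiv_def intro: equivclp_sym)
  show "transp flat_equiv"
    by (auto simp: transp_def flat_equiv_def intro: equivclp_trans)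
qed

text \<open>The free abelian group generated by ordered oriented flat virtual links.\<close>

type_synonym VL_flat = "flat_link \<Rightarrow>\<^sub>0 int"

definition flat_class :: "diagram \<Rightarrow> VL_flat" where
  "flat_class D = Poly_Mapping.single (abs_flat_link D) 1"


section \<open>Change of labels and orientations\<close>

definition recolour :: "(point \<Rightarrow> colour \<Rightarrow> colour) \<Rightarrow> diagram \<Rightarrow> diagram" where
  "recolour f D = map (\<lambda>j. case D ! j of
       (p, Cup l d) \<Rightarrow> (case f (j + 1, p) (l, d) of (l', d') \<Rightarrow> (p, Cup l' d'))
     | y \<Rightarrow> y) [0..<length D]"

definition reverse_component :: "nat \<Rightarrow> diagram \<Rightarrow> diagram" where
  "reverse_component i = recolour (\<lambda>_ (l, d). (l, if l = i then \<not> d else d))"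

definition relabel :: "(nat \<Rightarrow> nat) \<Rightarrow> diagram \<Rightarrow> diagram" where
  "relabel \<pi> = recolour (\<lambda>_ (l, d). (\<pi> l, d))"

definition regular :: "diagram set \<Rightarrow> bool" where
  "regular \<D> \<longleftrightarrow> (\<forall>D\<in>\<D>. vl_diagram D) \<and>
     (\<forall>D D'. moves_to D D' \<longrightarrow> (D \<in> \<D> \<longleftrightarrow> D' \<in> \<D>)) \<and>
     (\<forall>D\<in>\<D>. \<forall>D'. crossing_change D D' \<longrightarrow> D' \<in> \<D>) \<and>
     (\<forall>D\<in>\<D>. \<forall>i\<in>labels D. reverse_component i D \<in> \<D>) \<and>
     (\<forall>D\<in>\<D>. \<forall>\<pi>. bij_betw \<pi> {1..ncomp D} {1..ncomp D} \<longrightarrow> relabel \<pi> D \<in> \<D>)"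


section \<open>Weight functions\<close>

definition all_crossings :: "diagram set \<Rightarrow> (diagram \<times> nat) set" where
  "all_crossings \<D> = {(D, c). D \<in> \<D> \<and> c \<in> crossings D}"

text \<open>
  The conditions (C1), (C2), (C3) and evenness, for crossings in \<open>A\<close> only.  In (C1) a plane
  isotopy involves no crossing, so the correspondence \<open>I\<close> counts as well.
\<close>

definition condition_C1 ::
  "diagram set \<Rightarrow> (diagram \<times> nat) set \<Rightarrow> (diagram \<Rightarrow> nat \<Rightarrow> 'g) \<Rightarrow> bool" where
  "condition_C1 \<D> A w \<longleftrightarrow> (\<forall>D\<in>\<D>. \<forall>D'\<in>\<D>. \<forall>k q U I c c'. move k q U I D D' \<longrightarrow>
     (c, c') \<in> U \<or> (k = Isotopy \<and> (c, c') \<in> I) \<longrightarrow> (D, c) \<in> A \<longrightarrow> (D', c') \<in> A \<longrightarrow>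
     w D c = w D' c')"

definition condition_C2 ::
  "diagram set \<Rightarrow> (diagram \<times> nat) set \<Rightarrow> (diagram \<Rightarrow> nat \<Rightarrow> 'g) \<Rightarrow> bool" where
  "condition_C2 \<D> A w \<longleftrightarrow> (\<forall>D\<in>\<D>. \<forall>D'\<in>\<D>. \<forall>q U I c c'. move RIII q U I D D' \<longrightarrow>
     (c, c') \<in> I \<longrightarrow> (D, c) \<in> A \<longrightarrow> (D', c') \<in> A \<longrightarrow> w D c = w D' c')"

definition condition_C3 ::
  "diagram set \<Rightarrow> (diagram \<times> nat) set \<Rightarrow> (diagram \<Rightarrow> nat \<Rightarrow> 'g) \<Rightarrow> bool" where
  "condition_C3 \<D> A w \<longleftrightarrow> (\<forall>D\<in>\<D>. \<forall>D'\<in>\<D>. \<forall>q U I c c'. move SV q U I D D' \<longrightarrow>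
     (c, c') \<in> I \<longrightarrow> (D, c) \<in> A \<longrightarrow> (D', c') \<in> A \<longrightarrow> w D c = w D' c')"

definition condition_even ::
  "diagram set \<Rightarrow> (diagram \<times> nat) set \<Rightarrow> (diagram \<Rightarrow> nat \<Rightarrow> 'g) \<Rightarrow> bool" where
  "condition_even \<D> A w \<longleftrightarrow> (\<forall>D\<in>\<D>. \<forall>D'\<in>\<D>. \<forall>q U I. move RII q U I D D' \<longrightarrow>
     (D, q) \<in> A \<longrightarrow> (D, q + 1) \<in> A \<longrightarrow> w D q = w D (q + 1))"

definition even_weight_function ::
  "diagram set \<Rightarrow> (diagram \<Rightarrow> nat \<Rightarrow> 'g::ab_group_add) \<Rightarrow> bool" where
  "even_weight_function \<D> w \<longleftrightarrow>
     condition_C1 \<D> (all_crossings \<D>) w \<and> condition_C2 \<D> (all_crossings \<D>) w \<and>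
     condition_C3 \<D> (all_crossings \<D>) w \<and> condition_even \<D> (all_crossings \<D>) w"

definition consistent :: "diagram set \<Rightarrow> (diagram \<times> nat) set \<Rightarrow> bool" where
  "consistent \<D> A \<longleftrightarrow> A \<subseteq> all_crossings \<D> \<and>
     even_weight_function \<D> (\<lambda>D c. if (D, c) \<in> A then 1 else (0::int))"

definition even_weight_function_on ::
  "diagram set \<Rightarrow> (diagram \<times> nat) set \<Rightarrow> (diagram \<Rightarrow> nat \<Rightarrow> 'g::ab_group_add) \<Rightarrow> bool" where
  "even_weight_function_on \<D> A w \<longleftrightarrow> consistent \<D> A \<and>
     condition_C1 \<D> A w \<and> condition_C2 \<D> A w \<and> condition_C3 \<D> A w \<and> condition_even \<D> A w"

definition extend_zero ::
  "(diagram \<times> nat) set \<Rightarrow> (diagram \<Rightarrow> nat \<Rightarrow> 'g::ab_group_add) \<Rightarrow> diagram \<Rightarrow> nat \<Rightarrow> 'g" where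
  "extend_zero A w D c = (if (D, c) \<in> A then w D c else 0)"


section \<open>Smoothings\<close>

text \<open>The bottom left, bottom right, top left and top right ends of a crossing.\<close>

definition BL :: "diagram \<Rightarrow> nat \<Rightarrow> point" where "BL D c = (c, fst (D ! c))"
definition BR :: "diagram \<Rightarrow> nat \<Rightarrow> point" where "BR D c = (c, fst (D ! c) + 1)"
definition TL :: "diagram \<Rightarrow> nat \<Rightarrow> point" where "TL D c = (c + 1, fst (D ! c))"
definition TR :: "diagram \<Rightarrow> nat \<Rightarrow> point" where "TR D c = (c + 1, fst (D ! c) + 1)"

text \<open>\<open>strand_label D c over\<close> and \<open>out_end D c over\<close>: component and outgoing end of the overstrand
  (\<open>over\<close>) or understrand (\<open>\<not> over\<close>) at a classical crossing.\<close>

definition rising_strand :: "diagram \<Rightarrow> nat \<Rightarrow> bool \<Rightarrow> bool" where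
  "rising_strand D c over \<longleftrightarrow> snd (D ! c) = Cross (Classical over)"

definition out_end :: "diagram \<Rightarrow> nat \<Rightarrow> bool \<Rightarrow> point" where
  "out_end D c over =
    (if rising_strand D c over
     then (if snd (colour_at D (BL D c)) then TR D c else BL D c)
     else (if snd (colour_at D (BR D c)) then TL D c else BR D c))"

definition strand_label :: "diagram \<Rightarrow> nat \<Rightarrow> bool \<Rightarrow> nat" where
  "strand_label D c over = fst (colour_at D (out_end D c over))"

definition self_crossings :: "diagram \<Rightarrow> nat set" where
  "self_crossings D = {c \<in> crossings D. strand_label D c True = strand_label D c False}"

definition mixed_crossings :: "diagram \<Rightarrow> nat set" where
  "mixed_crossings D = {c \<in> crossings D. strand_label D c True \<noteq> strand_label D c False}"

text \<open>The points on the arc (or closed component) which leaves \<open>c\<close> along the given strand.\<close>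

definition arc :: "diagram \<Rightarrow> nat \<Rightarrow> bool \<Rightarrow> point set" where
  "arc D c over = {x. connected_by D {c} (out_end D c over) x}"

text \<open>
  Recolour by \<open>f\<close> and replace the crossing \<open>c\<close> by two vertical strands, or, if \<open>turn\<close>, by a cap
  joining its bottom ends and a cup joining its top ends.
\<close>

definition smooth :: "diagram \<Rightarrow> nat \<Rightarrow> bool \<Rightarrow> (point \<Rightarrow> colour \<Rightarrow> colour) \<Rightarrow> diagram" where
  "smooth D c turn f =
    (let E = recolour f D;
         p = fst (D ! c);
         (l, d) = f (TL D c) (colour_at D (TL D c))
     in take c E @ (if turn then [(p, Cap), (p, Cup l d)] else []) @ drop (c + 1) E)"

text \<open>Do both strands at \<open>c\<close> point upwards or both downwards?\<close>

definition parallel :: "diagram \<Rightarrow> nat \<Rightarrow> bool" where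
  "parallel D c \<longleftrightarrow> snd (colour_at D (BL D c)) = snd (colour_at D (BR D c))"

text \<open>
  The parameter \<open>\<kappa>\<close> is the convention: the arc or component leaving \<open>c\<close> along the overstrand
  (\<open>\<kappa>\<close>), respectively along the understrand (\<open>\<not> \<kappa>\<close>), keeps its orientation.
\<close>

definition smooth1 :: "bool \<Rightarrow> diagram \<Rightarrow> nat \<Rightarrow> diagram" where
  "smooth1 \<kappa> D c = smooth D c (parallel D c)
    (\<lambda>x (l, d). if l = strand_label D c \<kappa> \<and> x \<notin> arc D c \<kappa> then (l, \<not> d) else (l, d))"

definition smooth2 :: "bool \<Rightarrow> diagram \<Rightarrow> nat \<Rightarrow> diagram" where
  "smooth2 \<kappa> D c = smooth D c (\<not> parallel D c)
    (\<lambda>x (l, d). if l = strand_label D c \<kappa> \<and> x \<notin> arc D c \<kappa> then (ncomp D + 1, \<not> d) else (l, d))"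

definition smooth3 :: "bool \<Rightarrow> diagram \<Rightarrow> nat \<Rightarrow> diagram" where
  "smooth3 \<kappa> D c =
    (let i = strand_label D c \<kappa>; j = strand_label D c (\<not> \<kappa>)
     in smooth D c (parallel D c)
       (\<lambda>_ (l, d). (if l = i \<or> l = j then min i j else if l > max i j then l - 1 else l,
                     if l = j then \<not> d else d)))"

definition S1 :: "bool \<Rightarrow> diagram \<Rightarrow> nat \<Rightarrow> VL_flat" where
  "S1 \<kappa> D c = flat_class (smooth1 \<kappa> D c)"

definition S2 :: "bool \<Rightarrow> diagram \<Rightarrow> nat \<Rightarrow> VL_flat" where
  "S2 \<kappa> D c = flat_class (smooth2 \<kappa> D c)"

definition S3 :: "bool \<Rightarrow> diagram \<Rightarrow> nat \<Rightarrow> VL_flat" where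
  "S3 \<kappa> D c = flat_class (smooth3 \<kappa> D c)"

definition all_self_crossings :: "diagram set \<Rightarrow> (diagram \<times> nat) set" where
  "all_self_crossings \<D> = {(D, c). D \<in> \<D> \<and> c \<in> self_crossings D}"

definition all_mixed_crossings :: "diagram set \<Rightarrow> (diagram \<times> nat) set" where
  "all_mixed_crossings \<D> = {(D, c). D \<in> \<D> \<and> c \<in> mixed_crossings D}"


section \<open>Crossings which can be reduced by RI\<close>

definition isotopy_step :: "diagram \<times> nat \<Rightarrow> diagram \<times> nat \<Rightarrow> bool" where
  "isotopy_step X Y \<longleftrightarrow>
     (\<exists>q U I. move Isotopy q U I (fst X) (fst Y) \<and> (snd X, snd Y) \<in> U \<union> I)"

text \<open>
  \<open>ri_reducible D c over\<close>: up to plane isotopy, the crossing \<open>c\<close> can be removed by an RI move, and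
  the loop which the move contracts leaves \<open>c\<close> along the overstrand (\<open>over\<close>) or the understrand
  (\<open>\<not> over\<close>).  In the elementary move RI the loop lies above the crossing.
\<close>

definition ri_reducible :: "diagram \<Rightarrow> nat \<Rightarrow> bool \<Rightarrow> bool" where
  "ri_reducible D c over \<longleftrightarrow>
     (\<exists>D1 q U I D2. equivclp isotopy_step (D, c) (D1, q) \<and> move RI q U I D1 D2 \<and>
        out_end D1 q over \<in> {TL D1 q, TR D1 q})"

text \<open>A crossingless circle beside the diagram, labelled \<open>l\<close>, with orientation determined by \<open>d\<close>.\<close>

definition add_unknot :: "diagram \<Rightarrow> nat \<Rightarrow> bool \<Rightarrow> diagram" where
  "add_unknot D l d = D @ [(0, Cup l d), (0, Cap)]"

text \<open>
  \<open>D\<close> with an unknot, ordered and oriented as in the type-2 smoothing at \<open>c\<close>: if the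
  orientation of the contracted loop is kept, the loop inherits the label \<open>i\<close> of the component
  containing \<open>c\<close>, while the rest of this component is reversed and becomes the last
  component; otherwise \<open>D\<close> does not change and the loop becomes the last component.
\<close>

definition with_unknot :: "bool \<Rightarrow> diagram \<Rightarrow> nat \<Rightarrow> bool \<Rightarrow> diagram" where
  "with_unknot loop_kept D i d =
    (if loop_kept
     then add_unknot (recolour (\<lambda>_ (l, e). if l = i then (ncomp D + 1, \<not> e) else (l, e)) D) i d
     else add_unknot D (ncomp D + 1) d)"

end

theory Submission
  imports Defs
begin

text \<open>
  A valuation assigns to every strand at every height a value that is constant along strands,
  except that a given involution is applied at minima and maxima; crossings may be cut.
  Colourings are valuations in colours, and two points are connected iff no Boolean valuation
  separates them.  So connectivity can be transported through a tangle replacement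
  relationally: related tangles admit the same values at their boundary.

  At a self-crossing the two arcs are recognized by a valuation of the cut diagram which is true at
  one outgoing end and false at the other.  It exists because the universal valuation takes
  each of its values at exactly two of the free ends, and since the strands with value true,
  counted with their direction, form a flow, it has to be true at precisely one ingoing end,
  which belongs to the other strand.  Such valuations are carried along by every move,
  the convention of keeping the arc which leaves along the overstrand being local.  Hence both
  smoothings agree outside the move, and what remains are local equivalences between smoothed
  tangles, which follow from RI, RII and isotopies once crossings may be changed.
\<close>

section \<open>Valuations of strands\<close>

text \<open>The set \<open>arc D c over\<close> consists of points named by layer and position, and
  every move renames points. Moreover a smoothing recolours cups far away from the crossing.
  Valuations name no points: they are lists, one per height, and can be cut and glued at any height.
  A separating valuation is arbitrary on components that avoid the crossing, but there the
  recolouring does not look at it, so any one found on one side of a move may be carried to the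
  other.

  The second obstacle is that \<open>flat_equiv\<close> admits only chains of valid diagrams, so
  every intermediate word of a local derivation must keep one component per label. This is why
  tangle replacement is studied for Boolean values as well as for colours.

  Evenness fits the same scheme: the two crossings of a bigon are treated as corresponding crossings
  of one and the same diagram, with left and right exchanged. A crossing swung around a maximum or
  minimum is seen turned by a quarter, which exchanges the two ways of smoothing it; this is the
  origin of the test \<open>T \<noteq> quarter \<rho>\<close>.\<close>

definition opp :: "colour \<Rightarrow> colour" where
  "opp a = (fst a, \<not> snd a)"

lemma opp_simps [simp]: "opp (l, d) = (l, \<not> d)" "opp (opp a) = a" "fst (opp a) = fst a"
  "snd (opp a) \<longleftrightarrow> \<not> snd a"
  by (auto simp: opp_def)

text \<open>The decoration of a cup is ignored here, so that one shape admits many colourings;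
  decorations enter separately through \<open>paint1\<close>. If \<open>X\<close> holds, the
  crossing is cut and its four ends carry unrelated values.\<close>

fun gen_rel :: "('a \<Rightarrow> 'a) \<Rightarrow> bool \<Rightarrow> gen \<Rightarrow> 'a list \<Rightarrow> 'a list \<Rightarrow> bool" where
  "gen_rel \<tau> X (Cup l d) U V \<longleftrightarrow> U = [] \<and> (\<exists>a. V = [a, \<tau> a])"
| "gen_rel \<tau> X Cap U V \<longleftrightarrow> V = [] \<and> (\<exists>a. U = [a, \<tau> a])"
| "gen_rel \<tau> X (Cross m) U V \<longleftrightarrow> (\<exists>a b c d. U = [a, b] \<and> V = [c, d] \<and> (X \<or> c = b \<and> d = a))"

definition layer_rel :: "('a \<Rightarrow> 'a) \<Rightarrow> bool \<Rightarrow> layer \<Rightarrow> 'a list \<Rightarrow> 'a list \<Rightarrow> bool" where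
  "layer_rel \<tau> X x L K \<longleftrightarrow> (\<exists>A U V B. length A = fst x \<and> L = A @ U @ B \<and> K = A @ V @ B \<and>
     gen_rel \<tau> X (snd x) U V)"

lemma layer_relI:
  "length A = p \<Longrightarrow> gen_rel \<tau> X g U V \<Longrightarrow> layer_rel \<tau> X (p, g) (A @ U @ B) (A @ V @ B)"
  by (auto simp: layer_rel_def)

lemma layer_relE:
  assumes "layer_rel \<tau> X (p, g) L K"
  obtains A U V B where "length A = p" "L = A @ U @ B" "K = A @ V @ B" "gen_rel \<tau> X g U V"
  using assms by (auto simp: layer_rel_def)

lemma layer_rel_Suc [simp]:
  "layer_rel \<tau> X (Suc p, g) L K \<longleftrightarrow>
     (\<exists>a L' K'. L = a # L' \<and> K = a # K' \<and> layer_rel \<tau> X (p, g) L' K')" (is "?l \<longleftrightarrow> ?r")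
proof
  assume ?l
  then obtain A U V B where *: "length A = Suc p" "L = A @ U @ B" "K = A @ V @ B" "gen_rel \<tau> X g U V"
    by (rule layer_relE)
  then obtain a A' where "A = a # A'" "length A' = p"
    by (cases A) auto
  with * show ?r
    using layer_relI[of A' p \<tau> X g U V B] by auto
next
  assume ?r
  then obtain a L' K' where "L = a # L'" "K = a # K'" "layer_rel \<tau> X (p, g) L' K'"
    by auto
  then show ?l
    by (elim layer_relE) (use layer_relI[of "a # _" "Suc p" \<tau> X g] in auto)
qed

lemma layer_rel_0 [simp]:
  "layer_rel \<tau> X (0, Cup l d) L K \<longleftrightarrow> (\<exists>a. K = a # \<tau> a # L)"
  "layer_rel \<tau> X (0, Cap) L K \<longleftrightarrow> (\<exists>a. L = a # \<tau> a # K)"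
  "layer_rel \<tau> X (0, Cross m) L K \<longleftrightarrow>
     (\<exists>a b c d R. L = a # b # R \<and> K = c # d # R \<and> (X \<or> c = b \<and> d = a))"
proof -
  have *: "layer_rel \<tau> X (0, g) L K \<longleftrightarrow> (\<exists>U V B. L = U @ B \<and> K = V @ B \<and> gen_rel \<tau> X g U V)" for g
    by (simp add: layer_rel_def)
  show "layer_rel \<tau> X (0, Cup l d) L K \<longleftrightarrow> (\<exists>a. K = a # \<tau> a # L)"
    "layer_rel \<tau> X (0, Cap) L K \<longleftrightarrow> (\<exists>a. L = a # \<tau> a # K)"
    unfolding * by auto
  show "layer_rel \<tau> X (0, Cross m) L K \<longleftrightarrow>
     (\<exists>a b c d R. L = a # b # R \<and> K = c # d # R \<and> (X \<or> c = b \<and> d = a))"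
    unfolding * gen_rel.simps by (metis append_Cons append_Nil)
qed

lemma layer_rel_shift:
  "layer_rel \<tau> X (length A + i, g) (A @ L) K \<longleftrightarrow> (\<exists>K'. K = A @ K' \<and> layer_rel \<tau> X (i, g) L K')"
  by (induction A arbitrary: K) auto

lemma layer_rel_length:
  assumes "layer_rel \<tau> X x L K"
  shows "length K + ins (snd x) = length L + outs (snd x)" "fst x + ins (snd x) \<le> length L"
    "fst x + outs (snd x) \<le> length K"
  using assms by (cases "snd x"; auto simp: layer_rel_def)+

lemma layer_rel_map:
  assumes "layer_rel \<tau> X x L K" "\<And>a. h (\<tau> a) = \<sigma> (h a)"
  shows "layer_rel \<sigma> X x (map h L) (map h K)"
proof -
  obtain A U V B where *: "length A = fst x" "L = A @ U @ B" "K = A @ V @ B"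
    and "gen_rel \<tau> X (snd x) U V"
    using assms(1) by (auto simp: layer_rel_def)
  then have "gen_rel \<sigma> X (snd x) (map h U) (map h V)"
    by (cases "snd x") (auto simp: assms(2))
  with * show ?thesis
    unfolding layer_rel_def
    by (intro exI[of _ "map h A"] exI[of _ "map h U"] exI[of _ "map h V"] exI[of _ "map h B"]) auto
qed

lemma layer_rel_zip:
  assumes "layer_rel \<tau> X x L K" "layer_rel \<sigma> X x L' K'" "length L = length L'"
  shows "layer_rel (map_prod \<tau> \<sigma>) X x (zip L L') (zip K K')"
proof -
  obtain A U V B where 1: "length A = fst x" "L = A @ U @ B" "K = A @ V @ B"
    "gen_rel \<tau> X (snd x) U V"
    using assms(1) by (auto simp: layer_rel_def)
  obtain A' U' V' B' where 2: "length A' = fst x" "L' = A' @ U' @ B'" "K' = A' @ V' @ B'"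
    "gen_rel \<sigma> X (snd x) U' V'"
    using assms(2) by (auto simp: layer_rel_def)
  have 3: "length U = length U'" "length V = length V'" "gen_rel (map_prod \<tau> \<sigma>) X (snd x) (zip U U') (zip V V')"
    using 1(4) 2(4) by (cases "snd x"; auto)+
  with 1 2 assms(3) have 4: "length B = length B'" by auto
  show ?thesis
    unfolding layer_rel_def using 1 2 3 4
    by (intro exI[of _ "zip A A'"] exI[of _ "zip U U'"] exI[of _ "zip V V'"] exI[of _ "zip B B'"]) auto
qed

lemma layer_rel_mono: "layer_rel \<tau> X x L K \<Longrightarrow> (X \<Longrightarrow> Y) \<Longrightarrow> layer_rel \<tau> Y x L K"
  unfolding layer_rel_def by (cases "snd x"; simp; blast)

section \<open>Valuations of a whole diagram\<close>

definition valuation :: "('a \<Rightarrow> 'a) \<Rightarrow> nat set \<Rightarrow> diagram \<Rightarrow> (nat \<Rightarrow> 'a list) \<Rightarrow> bool" where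
  "valuation \<tau> X D v \<longleftrightarrow> (\<forall>k<length D. layer_rel \<tau> (k \<in> X) (D ! k) (v k) (v (Suc k)))"

lemma valuation_Nil [simp]: "valuation \<tau> X [] v"
  by (simp add: valuation_def)

lemma valuation_append:
  "valuation \<tau> X (D @ E) v \<longleftrightarrow>
     valuation \<tau> X D v \<and> valuation \<tau> {k. length D + k \<in> X} E (\<lambda>k. v (length D + k))"
proof -
  have "(\<forall>k<m + n. P k) \<longleftrightarrow> (\<forall>k<m. P k) \<and> (\<forall>k<n. P (m + k))" for m n and P :: "nat \<Rightarrow> bool"
    by (metis add_less_cancel_left le_Suc_ex linorder_not_le trans_less_add1)
  from this[of "length D" "length E"] show ?thesis
    by (simp add: valuation_def nth_append)
qed

lemma valuation_cong:
  assumes "\<And>k. k \<le> length D \<Longrightarrow> v k = w k" "X \<inter> {..<length D} = Y \<inter> {..<length D}"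
  shows "valuation \<tau> X D v \<longleftrightarrow> valuation \<tau> Y D w"
proof -
  have "k \<in> X \<longleftrightarrow> k \<in> Y" if "k < length D" for k
    using assms(2) that by auto
  with assms(1) show ?thesis
    by (simp add: valuation_def)
qed

lemma valuation_Cons:
  "valuation \<tau> X (x # D) v \<longleftrightarrow>
     layer_rel \<tau> (0 \<in> X) x (v 0) (v 1) \<and> valuation \<tau> {k. Suc k \<in> X} D (\<lambda>k. v (Suc k))"
  using valuation_append[of \<tau> X "[x]" D v] by (simp add: valuation_def[of _ _ "[x]"])

lemma valuation_mono: "valuation \<tau> X D v \<Longrightarrow> X \<subseteq> Y \<Longrightarrow> valuation \<tau> Y D v"
  unfolding valuation_def by (meson layer_rel_mono subsetD)

lemma valuation_map:
  assumes "valuation \<tau> X D v" "\<And>a. h (\<tau> a) = \<sigma> (h a)"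
  shows "valuation \<sigma> X D (\<lambda>k. map h (v k))"
  using assms(1) layer_rel_map[where h = h and \<tau> = \<tau> and \<sigma> = \<sigma>] assms(2) by (auto simp: valuation_def)

text \<open>Each layer changes the number of strands by a fixed amount, whatever the involution and
  the cut crossings are. Hence all valuations starting with equally many values have the same shape
  at every height.\<close>

lemma valuation_length:
  assumes "valuation \<tau> X D v" "valuation \<sigma> Y D w" "length (v 0) = length (w 0)" "k \<le> length D"
  shows "length (v k) = length (w k)"
  using assms(4)
proof (induction k)
  case (Suc k)
  then have "layer_rel \<tau> (k \<in> X) (D ! k) (v k) (v (Suc k))" "layer_rel \<sigma> (k \<in> Y) (D ! k) (w k) (w (Suc k))"
    using assms by (auto simp: valuation_def)
  from this[THEN layer_rel_length(1)] Suc show ?case by simp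
qed (use assms in auto)

lemma valuation_zip:
  assumes "valuation \<tau> X D v" "valuation \<sigma> X D w" "length (v 0) = length (w 0)"
  shows "valuation (map_prod \<tau> \<sigma>) X D (\<lambda>k. zip (v k) (w k))"
  unfolding valuation_def
proof (intro allI impI)
  fix k assume "k < length D"
  then show "layer_rel (map_prod \<tau> \<sigma>) (k \<in> X) (D ! k) (zip (v k) (w k)) (zip (v (Suc k)) (w (Suc k)))"
    using assms valuation_length[OF assms, of k] by (intro layer_rel_zip) (auto simp: valuation_def)
qed

text \<open>At the seams \<open>m\<close> and \<open>m + n\<close> the value is taken from the upper
  piece; the lemmas on \<open>glue\<close> require that the pieces agree there.\<close>

definition glue :: "nat \<Rightarrow> nat \<Rightarrow> (nat \<Rightarrow> 'a) \<Rightarrow> (nat \<Rightarrow> 'a) \<Rightarrow> (nat \<Rightarrow> 'a) \<Rightarrow> nat \<Rightarrow> 'a" where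
  "glue m n u v w k = (if k < m then u k else if k < m + n then v (k - m) else w (k - (m + n)))"

lemma glue_simps:
  assumes "v 0 = u m" "w 0 = v n"
  shows "k \<le> m \<Longrightarrow> glue m n u v w k = u k"
    "k \<le> n \<Longrightarrow> glue m n u v w (m + k) = v k"
    "glue m n u v w (m + (n + k)) = w k"
  using assms by (auto simp: glue_def)

lemma valuation_glue:
  assumes "valuation \<tau> Y P u" "valuation \<tau> {k. length P + k \<in> Y} T v"
    "valuation \<tau> {k. length P + length T + k \<in> Y} Q w" "v 0 = u (length P)" "w 0 = v (length T)"
  shows "valuation \<tau> Y (P @ T @ Q) (glue (length P) (length T) u v w)"
proof -
  note s = glue_simps[of v u "length P" w "length T", OF assms(4,5)]
  show ?thesis
    unfolding valuation_append
    by (intro conjI) (rule valuation_cong[THEN iffD1, rotated 2, OF assms(1)]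
      valuation_cong[THEN iffD1, rotated 2, OF assms(2)]
      valuation_cong[THEN iffD1, rotated 2, OF assms(3)]; auto simp: s add.assoc)+
qed

text \<open>A tangle seen from its boundary: the relation holds iff some valuation of the uncut
  tangle has these values below and above (\<open>tangle_relI\<close>, \<open>tangle_relE\<close>).
  In this form tangles with different numbers of layers can be compared.\<close>

fun tangle_rel :: "('a \<Rightarrow> 'a) \<Rightarrow> diagram \<Rightarrow> 'a list \<Rightarrow> 'a list \<Rightarrow> bool" where
  "tangle_rel \<tau> [] L M \<longleftrightarrow> L = M"
| "tangle_rel \<tau> (x # T) L M \<longleftrightarrow> (\<exists>K. layer_rel \<tau> False x L K \<and> tangle_rel \<tau> T K M)"

lemma tangle_rel_append:
  "tangle_rel \<tau> (S @ T) L M \<longleftrightarrow> (\<exists>K. tangle_rel \<tau> S L K \<and> tangle_rel \<tau> T K M)"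
  by (induction S arbitrary: L) auto

lemma tangle_relI: "valuation \<tau> {} T w \<Longrightarrow> tangle_rel \<tau> T (w 0) (w (length T))"
  by (induction T arbitrary: w) (auto simp: valuation_Cons)

lemma tangle_relE:
  assumes "tangle_rel \<tau> T L M"
  shows "\<exists>w. valuation \<tau> {} T w \<and> w 0 = L \<and> w (length T) = M"
  using assms
proof (induction T arbitrary: L)
  case (Cons x T)
  then obtain K w where "layer_rel \<tau> False x L K" "valuation \<tau> {} T w" "w 0 = K" "w (length T) = M"
    by fastforce
  then show ?case
    by (intro exI[of _ "case_nat L w"]) (auto simp: valuation_Cons)
qed auto

section \<open>Colourings as valuations\<close>

fun paint1 :: "layer \<Rightarrow> colour list \<Rightarrow> layer" where
  "paint1 (p, Cup l d) K = (p, Cup (fst (K ! p)) (snd (K ! p)))"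
| "paint1 (p, Cap) K = (p, Cap)"
| "paint1 (p, Cross m) K = (p, Cross m)"

definition paint :: "(nat \<Rightarrow> colour list) \<Rightarrow> diagram \<Rightarrow> diagram" where
  "paint v D = map (\<lambda>j. paint1 (D ! j) (v (Suc j))) [0..<length D]"

lemma length_paint [simp]: "length (paint v D) = length D"
  by (simp add: paint_def)

lemma nth_paint [simp]: "j < length D \<Longrightarrow> paint v D ! j = paint1 (D ! j) (v (Suc j))"
  by (simp add: paint_def)

lemma paint_append: "paint v (D @ E) = paint v D @ paint (\<lambda>k. v (length D + k)) E"
  by (rule nth_equalityI) (auto simp: nth_append)

lemma paint_cong:
  assumes "\<And>k. k < length D \<Longrightarrow> v (Suc k) = w (Suc k)"
  shows "paint v D = paint w D"
  using assms by (auto simp: paint_def)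

lemma layer_rel_paint1 [simp]: "layer_rel \<tau> X (paint1 x M) L K \<longleftrightarrow> layer_rel \<tau> X x L K"
proof -
  obtain p g where "x = (p, g)" by force
  then show ?thesis by (cases g) (auto simp: layer_rel_def)
qed

lemma valuation_paint [simp]: "valuation \<tau> X (paint v D) w \<longleftrightarrow> valuation \<tau> X D w"
  by (simp add: valuation_def)

text \<open>\<open>act\<close> is a function while \<open>layer_rel\<close> is a relation. The top
  colours are determined by the bottom ones except at a cup, and there \<open>paint1 x K = x\<close>
  says that the new values are those of the decoration.\<close>

lemma fits_act_iff: "fits x L \<and> K = act x L \<longleftrightarrow> layer_rel opp False x L K \<and> paint1 x K = x"
proof
  assume *: "fits x L \<and> K = act x L"
  obtain p g where x: "x = (p, g)" by force
  show "layer_rel opp False x L K \<and> paint1 x K = x"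
  proof (cases g)
    case (Cup l d)
    with * show ?thesis
      using layer_relI[of "take p L" p opp False "Cup l d" "[]" "[(l, d), (l, \<not> d)]" "drop p L"]
      by (auto simp: x nth_append)
  next
    case Cap
    have "L = take p L @ [L ! p, L ! (p + 1)] @ drop (p + 2) L"
      using * by (simp add: x Cap Cons_nth_drop_Suc)
    moreover have "L ! (p + 1) = opp (L ! p)"
      using * by (auto simp: x Cap opp_def prod_eq_iff)
    ultimately show ?thesis
      using * layer_relI[of "take p L" p opp False Cap "[L ! p, L ! (p + 1)]" "[]" "drop (p + 2) L"]
      by (auto simp: x Cap)
  next
    case (Cross m)
    have "L = take p L @ [L ! p, L ! (p + 1)] @ drop (p + 2) L" "length (take p L) = p"
      using * by (simp_all add: x Cross Cons_nth_drop_Suc)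
    then obtain A a b B where "L = A @ [a, b] @ B" "length A = p" by blast
    with * show ?thesis
      using layer_relI[of A p opp False "Cross m" "[a, b]" "[b, a]" B]
      by (auto simp: x Cross nth_append list_update_append)
  qed
next
  assume *: "layer_rel opp False x L K \<and> paint1 x K = x"
  obtain p g where x: "x = (p, g)" by force
  obtain A U V B where "length A = p" "L = A @ U @ B" "K = A @ V @ B" "gen_rel opp False g U V"
    using * x layer_relE by metis
  with * show "fits x L \<and> K = act x L"
    by (cases g) (auto simp: x nth_append list_update_append)
qed

text \<open>A closed diagram is the case of empty boundaries. Stated for segments with prescribed
  boundary colours, the condition can be cut at every height.\<close>

fun runs :: "diagram \<Rightarrow> colour list \<Rightarrow> colour list \<Rightarrow> bool" where
  "runs [] L M \<longleftrightarrow> L = M"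
| "runs (x # T) L M \<longleftrightarrow> (\<exists>K. layer_rel opp False x L K \<and> paint1 x K = x \<and> runs T K M)"

lemma runs_append: "runs (S @ T) L M \<longleftrightarrow> (\<exists>K. runs S L K \<and> runs T K M)"
  by (induction S arbitrary: L) auto

lemma runs_paint: "valuation opp {} T w \<Longrightarrow> runs (paint w T) (w 0) (w (length T))"
proof (induction T arbitrary: w)
  case (Cons x T)
  have "paint1 (paint1 x K) K = paint1 x K" for K
    by (cases x; cases "snd x") auto
  moreover have "paint w (x # T) = paint1 x (w 1) # paint (\<lambda>k. w (Suc k)) T"
    using paint_append[of w "[x]" T] by (simp add: paint_def[of _ "[x]"])
  ultimately show ?case
    using Cons.IH[of "\<lambda>k. w (Suc k)"] Cons.prems by (auto simp: valuation_Cons)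
qed (simp add: paint_def)

lemma runs_iff: "runs T L M \<longleftrightarrow>
   (\<forall>k<length T. fits (T ! k) (fold act (take k T) L)) \<and> fold act T L = M"
proof (induction T arbitrary: L)
  case (Cons x T)
  have "runs (x # T) L M \<longleftrightarrow> (\<exists>K. (fits x L \<and> K = act x L) \<and> runs T K M)"
    by (simp add: fits_act_iff)
  also have "\<dots> \<longleftrightarrow> fits x L \<and> runs T (act x L) M" by auto
  finally show ?case
    by (simp only: Cons.IH) (auto simp: nth_Cons less_Suc_eq_0_disj)
qed auto

lemma closed_diagram_iff: "closed_diagram D \<longleftrightarrow> runs D [] []"
  by (simp add: closed_diagram_def runs_iff level_def)

lemma runs_level: "runs D [] M \<Longrightarrow> level D (length D) = M"
  by (simp add: level_def runs_iff)

lemma runs_unique: "runs D L M \<Longrightarrow> runs D L M' \<Longrightarrow> M = M'"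
  by (simp add: runs_iff)

lemma level_0 [simp]: "level D 0 = []"
  by (simp add: level_def)

lemma level_append1: "k \<le> length D \<Longrightarrow> level (D @ E) k = level D k"
  by (simp add: level_def)

lemma level_Suc: "k < length D \<Longrightarrow> level D (Suc k) = act (D ! k) (level D k)"
  by (simp add: level_def take_Suc_conv_app_nth)

lemma valuation_level:
  assumes "runs D [] M"
  shows "valuation opp {} D (level D)" "paint (level D) D = D"
proof -
  have "layer_rel opp False (D ! k) (level D k) (level D (Suc k)) \<and> paint1 (D ! k) (level D (Suc k)) = D ! k"
    if "k < length D" for k
    using assms that by (simp add: fits_act_iff[symmetric] level_Suc) (simp add: runs_iff level_def)
  then show "valuation opp {} D (level D)" "paint (level D) D = D"
    by (auto simp: valuation_def paint_def intro: nth_equalityI)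
qed

text \<open>Decorations are the only source of colours, and painting takes them from
  \<open>v\<close>; hence the colours that propagate through the painted word are those of
  \<open>v\<close>. Smoothed diagrams are described in this way.\<close>

lemma level_paint:
  assumes "valuation opp {} D v" "v 0 = []" "k \<le> length D"
  shows "level (paint v D) k = v k"
proof -
  have "D = take k D @ drop k D" by simp
  then have "valuation opp {} (take k D) v"
    using assms(1) valuation_append by (metis)
  from runs_paint[OF this] have "runs (paint v (take k D)) [] (v k)"
    using assms by simp
  then have "level (paint v (take k D)) k = v k"
    using runs_level[of "paint v (take k D)"] assms(3) by simp
  moreover have "paint v D = paint v (take k D) @ paint (\<lambda>j. v (length (take k D) + j)) (drop k D)"
    by (metis append_take_drop_id paint_append)
  ultimately show ?thesis
    using assms(3) by (simp add: level_append1)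
qed

section \<open>Components\<close>

definition val :: "(nat \<Rightarrow> 'a list) \<Rightarrow> point \<Rightarrow> 'a" where
  "val g x = g (fst x) ! snd x"

lemma val_link:
  assumes "valuation id X D g" "\<And>k. k \<le> length D \<Longrightarrow> length (g k) = length (level D k)" "link D X x y"
  shows "val g x = val g y"
proof -
  have *: "\<exists>A U V B. length A = p \<and> g j = A @ U @ B \<and> g (Suc j) = A @ V @ B \<and> gen_rel id (j \<in> X) h U V"
    if "j < length D" "D ! j = (p, h)" for j p h
  proof -
    have "layer_rel id (j \<in> X) (p, h) (g j) (g (Suc j))"
      using assms(1) that by (auto simp: valuation_def)
    then show ?thesis by (auto simp: layer_rel_def)
  qed
  have **: "length U = ins h" "length V = outs h" if "gen_rel id b h U V" for b h and U V :: "'a list"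
    using that by (cases h; auto)+
  from assms(3) show ?thesis
  proof cases
    case (right j p h i)
    then obtain A U V B where "length A = p" "g j = A @ U @ B" "g (Suc j) = A @ V @ B" "gen_rel id (j \<in> X) h U V"
      using * by blast
    with right show ?thesis by (auto simp: val_def nth_append **)
  qed (use * in \<open>fastforce simp: val_def nth_append\<close>)+
qed

lemma val_connected:
  assumes "valuation id X D g" "\<And>k. k \<le> length D \<Longrightarrow> length (g k) = length (level D k)" "connected_by D X x y"
  shows "val g x = val g y"
  using assms(3) unfolding connected_by_def
  by (induction rule: equivclp_induct) (use val_link[OF assms(1,2)] in metis)+

text \<open>The clauses of \<open>link\<close> are exactly the equations imposed by
  \<open>layer_rel id\<close>: \<open>left\<close> and \<open>right\<close> for the strands beside
  the generator, the other clauses for the generator itself.\<close>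

lemma valuation_invariant:
  assumes "runs D [] M" "\<And>x y. link D X x y \<Longrightarrow> h x = h y"
  shows "valuation id X D (\<lambda>k. map (\<lambda>i. h (k, i)) [0..<length (level D k)])"
  unfolding valuation_def
proof (intro allI impI)
  fix k assume k: "k < length D"
  obtain p g where g: "D ! k = (p, g)" by force
  have "layer_rel opp False (p, g) (level D k) (level D (Suc k))"
    using valuation_level(1)[OF assms(1)] k g by (auto simp: valuation_def)
  from layer_rel_length[OF this] obtain r where
    r: "length (level D k) = p + ins g + r" "length (level D (Suc k)) = p + outs g + r"
    by (metis add_right_cancel add.commute add.assoc le_Suc_ex snd_conv fst_conv)
  have upt: "map f [0..<p + n + r] = map f [0..<p] @ map (\<lambda>i. f (p + i)) [0..<n] @ map (\<lambda>i. f (p + n + i)) [0..<r]"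
    for f :: "nat \<Rightarrow> 'a" and n
    by (rule nth_equalityI) (auto simp: nth_append)
  have 1: "map (\<lambda>i. h (k, i)) [0..<p] = map (\<lambda>i. h (Suc k, i)) [0..<p]"
    using assms(2)[OF link.left[OF k g]] by simp
  have 2: "map (\<lambda>i. h (k, p + ins g + i)) [0..<r] = map (\<lambda>i. h (Suc k, p + outs g + i)) [0..<r]"
    using assms(2)[OF link.right[OF k g]] r by simp
  have 3: "gen_rel id (k \<in> X) g (map (\<lambda>i. h (k, p + i)) [0..<ins g]) (map (\<lambda>i. h (Suc k, p + i)) [0..<outs g])"
  proof (cases g)
    case (Cup l d)
    then show ?thesis
      using assms(2)[OF link.cup[OF k g[unfolded Cup]]] by (simp add: upt_rec)
  next
    case Cap
    then show ?thesis
      using assms(2)[OF link.cap[OF k g[unfolded Cap]]] by (simp add: upt_rec)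
  next
    case (Cross m)
    then show ?thesis
      using assms(2)[OF link.rising[OF k g[unfolded Cross]]] assms(2)[OF link.falling[OF k g[unfolded Cross]]]
      by (auto simp add: upt_rec)
  qed
  show "layer_rel id (k \<in> X) (D ! k) (map (\<lambda>i. h (k, i)) [0..<length (level D k)])
      (map (\<lambda>i. h (Suc k, i)) [0..<length (level D (Suc k))])"
    unfolding g r upt 1 2 by (rule layer_relI[OF _ 3]) simp
qed

lemma valuation_shape:
  assumes "runs D [] M" "valuation \<tau> X D g" "g 0 = []" "k \<le> length D"
  shows "length (g k) = length (level D k)"
  using valuation_length[OF assms(2) valuation_level(1)[OF assms(1)] _ assms(4)] assms(3) by simp

lemma connected_iff:
  assumes "runs D [] M" "x \<in> points D" "y \<in> points D"
  shows "connected_by D X x y \<longleftrightarrow>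
    (\<forall>g :: nat \<Rightarrow> bool list. valuation id X D g \<and> g 0 = [] \<longrightarrow> val g x = val g y)"
proof
  assume c: "connected_by D X x y"
  show "\<forall>g :: nat \<Rightarrow> bool list. valuation id X D g \<and> g 0 = [] \<longrightarrow> val g x = val g y"
  proof (intro allI impI, elim conjE)
    fix g :: "nat \<Rightarrow> bool list"
    assume g: "valuation id X D g" "g 0 = []"
    show "val g x = val g y"
      by (rule val_connected[OF g(1) valuation_shape[OF assms(1) g] c])
  qed
next
  assume *: "\<forall>g :: nat \<Rightarrow> bool list. valuation id X D g \<and> g 0 = [] \<longrightarrow> val g x = val g y"
  \<comment> \<open>The connectivity class of \<open>x\<close> is itself a Boolean valuation, and it
    separates \<open>x\<close> from all points outside the class.\<close>
  define h where "h = connected_by D X x"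
  have "valuation id X D (\<lambda>k. map (\<lambda>i. h (k, i)) [0..<length (level D k)])"
    using assms(1)
  proof (rule valuation_invariant)
    show "h y = h z" if "link D X y z" for y z
      using that unfolding h_def connected_by_def
      by (metis equivclp_sym equivclp_trans r_into_equivclp)
  qed
  with * have "val (\<lambda>k. map (\<lambda>i. h (k, i)) [0..<length (level D k)]) x = val (\<lambda>k. map (\<lambda>i. h (k, i)) [0..<length (level D k)]) y"
    by simp
  with assms(2,3) have "h x = h y"
    by (auto simp: val_def points_def)
  then show "connected_by D X x y"
    by (simp add: h_def connected_by_def)
qed

text \<open>Positions are forgotten: whether a label occupies a single component depends only on the
  set of pairs of a colour and a Boolean value, and this set is easy to compare between diagrams of
  different shape.\<close>

definition cells :: "nat \<Rightarrow> (nat \<Rightarrow> 'a list) \<Rightarrow> (nat \<Rightarrow> 'b list) \<Rightarrow> ('a \<times> 'b) set" where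
  "cells n v g = (\<Union>k\<le>n. set (zip (v k) (g k)))"

definition label_constant :: "nat \<Rightarrow> (nat \<Rightarrow> colour list) \<Rightarrow> (nat \<Rightarrow> bool list) \<Rightarrow> bool" where
  "label_constant n v g \<longleftrightarrow> (\<forall>x\<in>cells n v g. \<forall>y\<in>cells n v g. fst (fst x) = fst (fst y) \<longrightarrow> snd x = snd y)"

lemma labels_iff: "labels D = fst ` (\<Union>k\<le>length D. set (level D k))"
  by (force simp: labels_def points_def colour_at_def in_set_conv_nth image_iff)

lemma cells_points:
  assumes "\<And>k. k \<le> length D \<Longrightarrow> length (g k) = length (level D k)"
  shows "cells (length D) (level D) g = (\<lambda>x. (colour_at D x, val g x)) ` points D"
proof -
  have "set (zip (level D k) (g k)) = (\<lambda>i. (level D k ! i, g k ! i)) ` {..<length (level D k)}"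
    if "k \<le> length D" for k
    using assms[OF that] by (auto simp: set_zip)
  then have "cells (length D) (level D) g =
      (\<Union>k\<le>length D. (\<lambda>i. (level D k ! i, g k ! i)) ` {..<length (level D k)})"
    by (simp add: cells_def)
  also have "\<dots> = (\<lambda>x. (colour_at D x, val g x)) ` points D"
    by (auto simp: points_def colour_at_def val_def) force
  finally show ?thesis .
qed

text \<open>By \<open>connected_iff\<close>, a label occupies one component iff every Boolean
  valuation is constant on it; the quantifier over valuations is moved outside.\<close>

lemma vl_diagram_iff: "vl_diagram D \<longleftrightarrow> runs D [] [] \<and> labels D = {1..ncomp D} \<and>
   (\<forall>g. valuation id {} D g \<and> g 0 = [] \<longrightarrow> label_constant (length D) (level D) g)"
proof -
  have "(\<forall>x\<in>points D. \<forall>y\<in>points D. fst (colour_at D x) = fst (colour_at D y) \<longrightarrow> connected_by D {} x y) \<longleftrightarrow>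
     (\<forall>g. valuation id {} D g \<and> g 0 = [] \<longrightarrow> label_constant (length D) (level D) g)"
    if r: "runs D [] []"
  proof -
    have 0: "cells (length D) (level D) g = (\<lambda>x. (colour_at D x, val g x)) ` points D"
      if "valuation id {} D g" "g 0 = []" for g :: "nat \<Rightarrow> bool list"
      by (rule cells_points, rule valuation_shape[OF r that])
    have 1: "label_constant (length D) (level D) g \<longleftrightarrow> (\<forall>x\<in>points D. \<forall>y\<in>points D.
        fst (colour_at D x) = fst (colour_at D y) \<longrightarrow> val g x = val g y)"
      if "valuation id {} D g" "g 0 = []" for g
      unfolding label_constant_def 0[OF that] by (simp only: ball_simps fst_conv snd_conv)
    have 2: "(\<forall>x\<in>points D. \<forall>y\<in>points D. fst (colour_at D x) = fst (colour_at D y) \<longrightarrow> connected_by D {} x y) \<longleftrightarrow>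
      (\<forall>g :: nat \<Rightarrow> bool list. valuation id {} D g \<and> g 0 = [] \<longrightarrow> (\<forall>x\<in>points D. \<forall>y\<in>points D.
        fst (colour_at D x) = fst (colour_at D y) \<longrightarrow> val g x = val g y))"
      by (simp only: connected_iff[OF r] cong: ball_cong) blast
    show ?thesis
      unfolding 2 using 1 by blast
  qed
  then show ?thesis
    unfolding vl_diagram_def closed_diagram_iff by auto
qed

lemma vl_diagramI:
  assumes "valuation opp {} S v" "v 0 = []" "v (length S) = []" "D = paint v S"
    "fst ` (\<Union>k\<le>length S. set (v k)) = {1..n}"
    "\<And>g. valuation id {} S g \<Longrightarrow> g 0 = [] \<Longrightarrow> label_constant (length S) v g"
  shows "vl_diagram D" "labels D = {1..n}" "ncomp D = n"
proof -
  have v: "level D k = v k" if "k \<le> length S" for k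
    using that assms by (simp add: level_paint)
  then have l: "labels D = {1..n}"
    using assms(4,5) by (simp add: labels_iff)
  then show "labels D = {1..n}" and n: "ncomp D = n"
    by (auto simp: ncomp_def)
  have "runs D [] []"
    using runs_paint[OF assms(1)] assms by simp
  moreover have "label_constant (length D) (level D) g = label_constant (length D) v g" for g
    using v assms(4) by (simp add: label_constant_def cells_def)
  ultimately show "vl_diagram D"
    unfolding vl_diagram_iff using l n assms by simp
qed

section \<open>Arcs at a crossing\<close>

definition paired :: "nat list \<Rightarrow> bool" where
  "paired L \<longleftrightarrow> (\<forall>x. count_list L x \<in> {0, 2})"

lemma paired_count: "paired L \<Longrightarrow> x \<in> set L \<Longrightarrow> count_list L x = 2"
  unfolding paired_def using count_list_0_iff[of L x] by (metis empty_iff insert_iff)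

lemma count_list_map_update:
  assumes "x \<noteq> y"
  shows "count_list (map (\<lambda>z. if z = y then x else z) L) z =
    (if z = y then 0 else if z = x then count_list L x + count_list L y else count_list L z)"
  using assms by (induction L) auto

text \<open>
  Joining the ends \<open>x\<close> and \<open>y\<close> of two different arcs at a maximum produces one arc, so that
  identifying the two values preserves the pairing of the free ends.
\<close>
lemma universal_valuation:
  assumes "tangle_rel \<sigma> T L0 M0" "length L0 = length L" "paired (L @ Z)"
  shows "\<exists>h M. tangle_rel id T (map h L) M \<and> paired (M @ map h Z)"
  using assms
\<comment> \<open>Values name arcs, and each arc has two free ends. \<open>Z\<close> lists free ends
  already left behind below the current height, such as those at a cut crossing; identifications
  made later act on them too. The run from \<open>L0\<close> to \<open>M0\<close> guarantees that
  every layer fits.\<close>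
proof (induction T arbitrary: L0 L Z)
  case Nil
  then show ?case by (auto intro!: exI[of _ id])
next
  case (Cons x T)
  obtain p g where x: "x = (p, g)" by force
  obtain K0 where K0: "layer_rel \<sigma> False x L0 K0" "tangle_rel \<sigma> T K0 M0"
    using Cons.prems(1) by auto
  have len: "length K0 + ins g = length L + outs g" "p + ins g \<le> length L"
    using layer_rel_length[OF K0(1)] Cons.prems(2) x by auto
  \<comment> \<open>\<open>h\<close> is the identification forced by the first layer and
    \<open>h'\<close> the one forced by the remaining layers; the claim needs their
    composition.\<close>
  have step: ?case if h: "layer_rel id False x (map h L) K" "length K0 = length K" "paired (K @ map h Z)" for h K
  proof -
    obtain h' M where "tangle_rel id T (map h' K) M" "paired (M @ map h' (map h Z))"
      using Cons.IH[OF K0(2) h(2,3)] by blast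
    moreover have "layer_rel id False x (map (h' \<circ> h) L) (map h' K)"
      using layer_rel_map[OF h(1), of h' id] by simp
    ultimately have "tangle_rel id (x # T) (map (h' \<circ> h) L) M \<and> paired (M @ map (h' \<circ> h) Z)"
      by auto
    then show ?thesis by blast
  qed
  show ?case
  proof (cases g)
    case (Cup l d)
    \<comment> \<open>A minimum starts a new arc, which gets a fresh name.\<close>
    obtain z where z: "z \<notin> set (L @ Z)"
      using infinite_UNIV_nat ex_new_if_finite by blast
    obtain A B where L: "L = A @ B" "length A = p"
      using len(2) Cup by (metis ins.simps(1) add_0_right append_take_drop_id length_take min.absorb2)
    have "count_list A z = 0" "count_list B z = 0" "count_list Z z = 0"
      using z L by (auto simp: count_list_0_iff)
    then have "paired ((A @ [z, z] @ B) @ Z)"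
      using Cons.prems(3) unfolding paired_def L by (auto split: if_splits)
    then show ?thesis
      using layer_relI[OF L(2), of id False g "[]" "[z, z]" B] len(1) L Cup x
      by (intro step[of id "A @ [z, z] @ B"]) auto
  next
    case Cap
    have "L = take p L @ [L ! p, L ! (p + 1)] @ drop (p + 2) L" "length (take p L) = p"
      using len(2) Cap by (auto simp: Cons_nth_drop_Suc)
    then obtain A u v B where L: "L = A @ [u, v] @ B" "length A = p" by blast
    define h where "h z = (if z = v then u else z)" for z
    have "paired (map h (A @ B) @ map h Z)"
    \<comment> \<open>If \<open>u = v\<close>, the maximum closes a circle and the name disappears
      from the free ends. Otherwise \<open>u\<close> and \<open>v\<close> have one free end left
      each, and these become a pair.\<close>
    proof (cases "u = v")
      case True
      then have "h = id" by (auto simp: h_def)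
      then show ?thesis
        using Cons.prems(3) True unfolding paired_def L by (auto split: if_splits)
    next
      case False
      have "count_list (L @ Z) u = 2" "count_list (L @ Z) v = 2"
        by (rule paired_count[OF Cons.prems(3)], simp add: L)+
      with False have "count_list ((A @ B) @ Z) u = 1" "count_list ((A @ B) @ Z) v = 1"
        by (auto simp: L)
      moreover have "count_list ((A @ B) @ Z) z \<in> {0, 2}" if "z \<noteq> u" "z \<noteq> v" for z
        using spec[OF Cons.prems(3)[unfolded paired_def], of z] that by (simp add: L)
      ultimately have "paired (map h ((A @ B) @ Z))"
        unfolding paired_def h_def count_list_map_update[OF False] by auto
      then show ?thesis by simp
    qed
    then show ?thesis
      using layer_relI[of "map h A" p id False g "[u, u]" "[]" "map h B"] len(1) L Cap x
      by (intro step[of h "map h (A @ B)"]) (auto simp: h_def)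
  next
    case (Cross m)
    have "L = take p L @ [L ! p, L ! (p + 1)] @ drop (p + 2) L" "length (take p L) = p"
      using len(2) Cross by (auto simp: Cons_nth_drop_Suc)
    then obtain A u v B where L: "L = A @ [u, v] @ B" "length A = p" by blast
    have "count_list ((A @ [v, u] @ B) @ Z) z = count_list (L @ Z) z" for z
      by (simp add: L)
    then have "paired ((A @ [v, u] @ B) @ Z)"
      using Cons.prems(3) unfolding paired_def by metis
    then show ?thesis
      using layer_relI[OF L(2), of id False g "[u, v]" "[v, u]" B] len(1) L Cross x
      by (intro step[of id "A @ [v, u] @ B"]) auto
  qed
qed

lemma runs_tangle_rel: "runs D L M \<Longrightarrow> tangle_rel opp D L M"
  by (induction D arbitrary: L) auto

definition in_end :: "diagram \<Rightarrow> nat \<Rightarrow> bool \<Rightarrow> point" where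
  "in_end D c over =
    (if rising_strand D c over
     then (if snd (colour_at D (BL D c)) then BL D c else TR D c)
     else (if snd (colour_at D (BR D c)) then BR D c else TL D c))"

definition combine :: "diagram \<Rightarrow> (nat \<Rightarrow> bool \<Rightarrow> bool \<Rightarrow> bool) \<Rightarrow> (nat \<Rightarrow> bool list) \<Rightarrow> (nat \<Rightarrow> bool list) \<Rightarrow> nat \<Rightarrow> bool list"
  where "combine D F g h k = map (\<lambda>((l, d), a, b). F l a b) (zip (level D k) (zip (g k) (h k)))"

text \<open>Labels are constant along strands and unaffected by \<open>opp\<close>, so a combination
  of two valuations may also depend on the label. This allows a valuation to be restricted to one
  component.\<close>

lemma
  assumes "runs D [] M" "valuation id X D g" "g 0 = []" "valuation id X D h" "h 0 = []"
  shows valuation_combine: "valuation id X D (combine D F g h)"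
    and combine_0: "combine D F g h 0 = []"
    and val_combine: "x \<in> points D \<Longrightarrow> val (combine D F g h) x = F (fst (colour_at D x)) (val g x) (val h x)"
proof -
  have "valuation (map_prod opp (map_prod id id)) X D (\<lambda>k. zip (level D k) (zip (g k) (h k)))"
    using assms valuation_level(1)[OF assms(1)] by (intro valuation_zip) (auto intro: valuation_mono)
  then show "valuation id X D (combine D F g h)"
    unfolding combine_def by (rule valuation_map) auto
  show "combine D F g h 0 = []"
    by (simp add: combine_def)
  show "val (combine D F g h) x = F (fst (colour_at D x)) (val g x) (val h x)" if "x \<in> points D"
    using that valuation_shape[OF assms(1,2,3)] valuation_shape[OF assms(1,4,5)]
    by (auto simp: val_def combine_def points_def colour_at_def split: prod.split)
qed

lemma vl_runs: "vl_diagram D \<Longrightarrow> runs D [] []"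
  by (simp add: vl_diagram_iff)

lemma vl_constant:
  assumes "vl_diagram D" "valuation id {} D g" "g 0 = []" "x \<in> points D" "y \<in> points D"
    "fst (colour_at D x) = fst (colour_at D y)"
  shows "val g x = (val g y :: bool)"
  using connected_iff[OF vl_runs[OF assms(1)] assms(4,5), of "{}"] assms
  by (auto simp: vl_diagram_def)

lemma valuation_cross:
  assumes "valuation \<tau> X D g" "c < length D" "D ! c = (p, Cross m)"
  shows "\<exists>A B. length A = p \<and> g c = A @ [val g (BL D c), val g (BR D c)] @ B \<and>
    g (Suc c) = A @ [val g (TL D c), val g (TR D c)] @ B \<and>
    (c \<notin> X \<longrightarrow> val g (TL D c) = val g (BR D c) \<and> val g (TR D c) = val g (BL D c))"
proof -
  have "layer_rel \<tau> (c \<in> X) (p, Cross m) (g c) (g (Suc c))"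
    using assms by (auto simp: valuation_def)
  then obtain A U V B where "length A = p" "g c = A @ U @ B" "g (Suc c) = A @ V @ B" "gen_rel \<tau> (c \<in> X) (Cross m) U V"
    by (rule layer_relE)
  then show ?thesis
    by (intro exI[of _ A] exI[of _ B]) (auto simp: val_def BL_def BR_def TL_def TR_def assms(3) nth_append)
qed

lemma valuation_uncut:
  assumes "valuation \<tau> {c} D g" "c < length D" "D ! c = (p, Cross m)"
    "val g (TL D c) = val g (BR D c)" "val g (TR D c) = val g (BL D c)"
  shows "valuation \<tau> {} D g"
proof -
  obtain A B where "length A = p" "g c = A @ [val g (BL D c), val g (BR D c)] @ B"
    "g (Suc c) = A @ [val g (BR D c), val g (BL D c)] @ B"
    using valuation_cross[OF assms(1-3)] assms(4,5) by auto
  then have "layer_rel \<tau> False (p, Cross m) (g c) (g (Suc c))"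
    using layer_relI[of A p \<tau> False "Cross m" "[val g (BL D c), val g (BR D c)]" "[val g (BR D c), val g (BL D c)]" B] by simp
  then show ?thesis
    using assms(1,3) unfolding valuation_def by (metis empty_iff singletonD)
qed

section \<open>Flow through a cut crossing\<close>

definition flux :: "(colour \<times> bool) list \<Rightarrow> int" where
  "flux L = (\<Sum>((l, d), b)\<leftarrow>L. of_bool b * (if d then 1 else -1))"

lemma flux_simps [simp]: "flux [] = 0" "flux (x # L) = of_bool (snd x) * (if snd (fst x) then 1 else -1) + flux L"
  "flux (L @ M) = flux L + flux M"
  by (auto simp: flux_def split: prod.split)

text \<open>The two ends of a minimum or maximum have the same Boolean value and opposite
  directions, so their contributions cancel; an uncut crossing only permutes the summands.\<close>

lemma flux_layer:
  assumes "layer_rel (map_prod opp id) False x L K"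
  shows "flux L = flux K"
proof -
  obtain p g where x: "x = (p, g)" by force
  obtain A U V B where "L = A @ U @ B" "K = A @ V @ B" "gen_rel (map_prod opp id) False g U V"
    using assms unfolding x by (rule layer_relE)
  then show ?thesis by (cases g) auto
qed

lemma flux_tangle: "tangle_rel (map_prod opp id) T L M \<Longrightarrow> flux L = flux M"
  by (induction T arbitrary: L) (use flux_layer in fastforce)+

locale diagram_crossing =
  fixes D :: diagram and c p :: nat and b :: bool
  assumes vl: "vl_diagram D" and c: "c < length D" and Dc: "D ! c = (p, Cross (Classical b))"
begin

lemma D_runs: "runs D [] []"
  using vl by (rule vl_runs)

lemma D_split: "D = take c D @ [(p, Cross (Classical b))] @ drop (Suc c) D"
  using c Dc by (metis Cons_nth_drop_Suc append_Cons append_Nil append_take_drop_id)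

lemma rising: "rising_strand D c ov \<longleftrightarrow> b = ov"
  by (auto simp: rising_strand_def Dc)

lemma ends_points: "BL D c \<in> points D" "BR D c \<in> points D" "TL D c \<in> points D" "TR D c \<in> points D"
  "in_end D c ov \<in> points D" "out_end D c ov \<in> points D"
proof -
  have "layer_rel opp False (p, Cross (Classical b)) (level D c) (level D (Suc c))"
    using valuation_level(1)[OF D_runs] c Dc by (auto simp: valuation_def)
  from layer_rel_length[OF this]
  show "BL D c \<in> points D" "BR D c \<in> points D" "TL D c \<in> points D" "TR D c \<in> points D"
    using c Dc by (auto simp: points_def BL_def BR_def TL_def TR_def)
  then show "in_end D c ov \<in> points D" "out_end D c ov \<in> points D"
    by (auto simp: in_end_def out_end_def)
qed

lemma end_colours:
  "colour_at D (TL D c) = colour_at D (BR D c)" "colour_at D (TR D c) = colour_at D (BL D c)"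
  "colour_at D (in_end D c ov) = colour_at D (out_end D c ov)"
proof -
  have *: "colour_at D = val (level D)" by (auto simp: colour_at_def val_def)
  show "colour_at D (TL D c) = colour_at D (BR D c)" "colour_at D (TR D c) = colour_at D (BL D c)"
    using valuation_cross[OF valuation_level(1)[OF D_runs] c Dc] by (auto simp: *)
  then show "colour_at D (in_end D c ov) = colour_at D (out_end D c ov)"
    by (auto simp: in_end_def out_end_def)
qed

lemma strand_label_eq: "strand_label D c ov = fst (colour_at D (if b = ov then BL D c else BR D c))"
  by (auto simp: strand_label_def out_end_def rising end_colours)

lemma label_in_end: "fst (colour_at D (in_end D c ov)) = strand_label D c ov"
  by (simp add: strand_label_def end_colours)

lemma label_out_end: "fst (colour_at D (out_end D c ov)) = strand_label D c ov"
  by (simp add: strand_label_def)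

text \<open>Kirchhoff's law for the strands which carry the value \<open>True\<close>.\<close>
lemma conservation:
  assumes "valuation id {c} D g" "g 0 = []"
  shows "of_bool (val g (out_end D c ov)) + of_bool (val g (out_end D c (\<not> ov))) =
    (of_bool (val g (in_end D c ov)) + of_bool (val g (in_end D c (\<not> ov))) :: int)"
proof -
  define z where "z k = zip (level D k) (g k)" for k
  have "valuation opp {c} D (level D)"
    using valuation_level(1)[OF D_runs] by (rule valuation_mono) simp
  then have z: "valuation (map_prod opp id) {c} D z"
    unfolding z_def using assms by (intro valuation_zip) auto
  have ends: "val z x = (colour_at D x, val g x)" if "x \<in> points D" for x
    using that valuation_shape[OF D_runs assms, of "fst x"] by (auto simp: val_def z_def points_def colour_at_def)
  obtain A B where AB: "z c = A @ [val z (BL D c), val z (BR D c)] @ B"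
    "z (Suc c) = A @ [val z (TL D c), val z (TR D c)] @ B"
    using valuation_cross[OF z c Dc] by blast
  have split: "valuation (map_prod opp id) {c} (take c D) z"
    "valuation (map_prod opp id) {k. Suc c + k \<in> {c}} (drop (Suc c) D) (\<lambda>k. z (Suc c + k))"
    using z D_split c valuation_append[of "map_prod opp id" "{c}" "take c D" "drop c D" z]
      valuation_append[of "map_prod opp id" "{c}" "take (Suc c) D" "drop (Suc c) D" z]
    by (simp_all add: min_absorb2)
  \<comment> \<open>Nothing enters at the bottom of the diagram or leaves at its top, so the flux
    vanishes just below and just above the crossing. The strands beside the crossing contribute
    equally to both heights, and only its four ends remain.\<close>
  have "valuation (map_prod opp id) {} (take c D) z"
    by (rule valuation_cong[THEN iffD1, rotated 2, OF split(1)]) (use c in auto)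
  from flux_tangle[OF tangle_relI[OF this]] have "flux (z c) = 0"
    using c by (simp add: z_def min_absorb2)
  have "valuation (map_prod opp id) {} (drop (Suc c) D) (\<lambda>k. z (Suc c + k))"
    by (rule valuation_cong[THEN iffD1, rotated 2, OF split(2)]) auto
  moreover have "Suc c + length (drop (Suc c) D) = length D"
    using c by simp
  ultimately have "flux (z (Suc c)) = flux (z (length D))"
    by (metis flux_tangle tangle_relI add.right_neutral)
  then have "flux (z (Suc c)) = 0"
    using runs_level[OF D_runs] by (simp add: z_def)
  with \<open>flux (z c) = 0\<close> have "flux [val z (BL D c), val z (BR D c)] = flux [val z (TL D c), val z (TR D c)]"
    by (simp add: AB)
  then show ?thesis
    by (cases "val g (BL D c)"; cases "val g (BR D c)"; cases "val g (TL D c)"; cases "val g (TR D c)";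
        cases "b = ov"; cases "snd (colour_at D (BL D c))"; cases "snd (colour_at D (BR D c))")
      (simp_all add: ends ends_points end_colours out_end_def in_end_def rising)
qed

lemma uncut:
  assumes "valuation id {c} D g" "\<And>ov. val g (in_end D c ov) = val g (out_end D c ov)"
  shows "valuation id {} D g"
proof (rule valuation_uncut[OF assms(1) c Dc])
  show "val g (TL D c) = val g (BR D c)" "val g (TR D c) = val g (BL D c)"
    using assms(2)[of b] assms(2)[of "\<not> b"]
    by (auto simp: in_end_def out_end_def rising split: if_splits)
qed

lemma label_const:
  assumes "valuation id {} D g" "g 0 = []" "x \<in> points D" "y \<in> points D"
    "fst (colour_at D x) = fst (colour_at D y)"
  shows "val g x = (val g y :: bool)"
  using vl_constant[OF vl assms] .

text \<open>Restricted to the label of one strand, \<open>conservation\<close> speaks of that strand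
  alone: the value at its outgoing end must equal the value at its ingoing end.\<close>

lemma mixed_uncut:
  fixes g :: "nat \<Rightarrow> bool list"
  assumes "strand_label D c True \<noteq> strand_label D c False" "valuation id {c} D g" "g 0 = []"
  shows "valuation id {} D g"
proof (rule uncut[OF assms(2)])
  fix ov
  define h where "h = combine D (\<lambda>l a _. l = strand_label D c ov \<and> a) g g"
  have h: "valuation id {c} D h" "h 0 = []"
    "\<And>x. x \<in> points D \<Longrightarrow> val h x \<longleftrightarrow> fst (colour_at D x) = strand_label D c ov \<and> val g x"
    unfolding h_def using valuation_combine[OF D_runs assms(2,3,2,3)] combine_0[OF D_runs assms(2,3,2,3)]
      val_combine[OF D_runs assms(2,3,2,3)] by auto
  have "strand_label D c (\<not> ov) \<noteq> strand_label D c ov"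
    using assms(1) by (cases ov) auto
  then show "val g (in_end D c ov) = val g (out_end D c ov)"
    using conservation[OF h(1,2), of ov]
    by (auto simp: h(3) ends_points label_in_end label_out_end of_bool_def split: if_splits)
qed

text \<open>Setting all other components to \<open>False\<close> makes the four ends at the crossing
  equal, so the cut is no longer felt and the constancy known for the uncut diagram applies.\<close>

lemma other_constant:
  assumes "valuation id {c} D g" "g 0 = []" "x \<in> points D" "y \<in> points D"
    "fst (colour_at D x) = l" "fst (colour_at D y) = l" "\<And>ov. strand_label D c ov \<noteq> l"
  shows "val g x = (val g y :: bool)"
proof -
  define h where "h = combine D (\<lambda>l' a _. l' = l \<and> a) g g"
  have h: "valuation id {c} D h" "h 0 = []"
    "\<And>x. x \<in> points D \<Longrightarrow> val h x \<longleftrightarrow> fst (colour_at D x) = l \<and> val g x"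
    unfolding h_def using valuation_combine[OF D_runs assms(1,2,1,2)] combine_0[OF D_runs assms(1,2,1,2)]
      val_combine[OF D_runs assms(1,2,1,2)] by auto
  have "valuation id {} D h"
    using assms(7) by (intro uncut[OF h(1)]) (simp add: h(3) ends_points label_in_end label_out_end)
  from label_const[OF this h(2) assms(3,4)] show ?thesis
    using assms h(3) by auto
qed

text \<open>On the component of a self-crossing these conditions determine \<open>s\<close> (see
  \<open>arc_iff\<close>); on other components it is left free.\<close>

definition separates :: "bool \<Rightarrow> (nat \<Rightarrow> bool list) \<Rightarrow> bool" where
  "separates \<kappa> s \<longleftrightarrow> valuation id {c} D s \<and> s 0 = [] \<and> val s (out_end D c \<kappa>) \<and> \<not> val s (out_end D c (\<not> \<kappa>))"

lemma separates_not:
  assumes "separates \<kappa> s"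
  shows "\<exists>s'. separates (\<not> \<kappa>) s' \<and> (\<forall>x\<in>points D. val s' x \<longleftrightarrow> \<not> val s x)"
proof -
  have s: "valuation id {c} D s" "s 0 = []" using assms by (auto simp: separates_def)
  show ?thesis
    using valuation_combine[OF D_runs s s] combine_0[OF D_runs s s] val_combine[OF D_runs s s] assms
    by (intro exI[of _ "combine D (\<lambda>_ a _. \<not> a) s s"]) (auto simp: separates_def ends_points)
qed

text \<open>A valuation that is not constant on the component cannot extend across the crossing, so
  one strand changes its value there. Conservation leaves a single pattern: the arc leaving along
  \<open>\<kappa>\<close> returns along the other strand.\<close>

lemma separates_in_end:
  assumes "separates \<kappa> s" "strand_label D c True = strand_label D c False"
  shows "val s (in_end D c (\<not> \<kappa>))" "\<not> val s (in_end D c \<kappa>)"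
proof -
  have s: "valuation id {c} D s" "s 0 = []" "val s (out_end D c \<kappa>)" "\<not> val s (out_end D c (\<not> \<kappa>))"
    using assms by (auto simp: separates_def)
  have "strand_label D c \<kappa> = strand_label D c (\<not> \<kappa>)"
    using assms(2) by (cases \<kappa>) auto
  then have "\<not> valuation id {} D s"
    using label_const[of s "out_end D c \<kappa>" "out_end D c (\<not> \<kappa>)"] s by (auto simp: ends_points label_out_end)
  then obtain ov where "val s (in_end D c ov) \<noteq> val s (out_end D c ov)"
    using uncut[OF s(1)] by blast
  moreover have "ov = \<kappa> \<or> ov = (\<not> \<kappa>)" by auto
  ultimately show "val s (in_end D c (\<not> \<kappa>))" "\<not> val s (in_end D c \<kappa>)"
    using conservation[OF s(1,2), of \<kappa>] s(3,4) by (auto simp: of_bool_def split: if_splits)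
qed

lemma separates_constant:
  fixes g :: "nat \<Rightarrow> bool list"
  assumes "separates \<kappa> s" "strand_label D c True = strand_label D c False"
    "valuation id {c} D g" "g 0 = []"
  shows "val g (in_end D c (\<not> \<kappa>)) = val g (out_end D c \<kappa>)"
    and "x \<in> points D \<Longrightarrow> fst (colour_at D x) = strand_label D c \<kappa> \<Longrightarrow> val s x \<Longrightarrow> val g x = val g (out_end D c \<kappa>)"
proof -
  have s: "valuation id {c} D s" "s 0 = []" "val s (out_end D c \<kappa>)" "\<not> val s (out_end D c (\<not> \<kappa>))"
    "val s (in_end D c (\<not> \<kappa>))" "\<not> val s (in_end D c \<kappa>)"
    using assms(1) separates_in_end[OF assms(1,2)] by (auto simp: separates_def)
  note combine = valuation_combine[OF D_runs s(1,2) assms(3,4)] combine_0[OF D_runs s(1,2) assms(3,4)]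
    val_combine[OF D_runs s(1,2) assms(3,4)]
  \<comment> \<open>The conjunction of \<open>s\<close> and \<open>g\<close> vanishes at the other
    two ends, so conservation equates its values at these two, where \<open>s\<close> is
    true.\<close>
  show 1: "val g (in_end D c (\<not> \<kappa>)) = val g (out_end D c \<kappa>)"
    using conservation[OF combine(1,2)[of "\<lambda>_ a b. a \<and> b"], of \<kappa>] s
    by (auto simp: combine(3) ends_points of_bool_def split: if_splits)
  \<comment> \<open>\<open>u\<close> marks the points of the arc at which \<open>g\<close> deviates
    from its starting value. It vanishes at all four ends, hence extends across the crossing and is
    \<open>False\<close> on the whole component.\<close>
  define u where "u = combine D (\<lambda>l a b. l = strand_label D c \<kappa> \<and> a \<and> b \<noteq> val g (out_end D c \<kappa>)) s g"
  have u: "\<not> val u (out_end D c ov)" "\<not> val u (in_end D c ov)" for ov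
    using s 1 unfolding u_def by (cases "ov = \<kappa>"; simp add: combine(3) ends_points; fail)+
  then have "valuation id {} D u"
    using combine(1) by (intro uncut) (auto simp: u_def)
  from label_const[OF this _ _ ends_points(6)[of \<kappa>], of x]
  show "val g x = val g (out_end D c \<kappa>)"
    if "x \<in> points D" "fst (colour_at D x) = strand_label D c \<kappa>" "val s x"
    using that u(1)[of \<kappa>] combine(2,3) by (auto simp: u_def label_out_end)
qed

text \<open>If \<open>s\<close> is false at \<open>x\<close>, then \<open>s\<close> itself shows
  that \<open>x\<close> is not connected to the outgoing end; if it is true,
  \<open>separates_constant\<close> says that no valuation tells the two apart.\<close>

lemma arc_iff:
  assumes "separates \<kappa> s" "strand_label D c True = strand_label D c False" "x \<in> points D"
    "fst (colour_at D x) = strand_label D c \<kappa>"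
  shows "x \<in> arc D c \<kappa> \<longleftrightarrow> val s x"
proof -
  have "x \<in> arc D c \<kappa> \<longleftrightarrow> (\<forall>g :: nat \<Rightarrow> bool list. valuation id {c} D g \<and> g 0 = [] \<longrightarrow>
      val g (out_end D c \<kappa>) = val g x)"
    unfolding arc_def by (simp add: connected_iff[OF D_runs ends_points(6) assms(3)])
  then show ?thesis
    using separates_constant(2)[OF assms(1,2) _ _ assms(3,4)] assms(1) unfolding separates_def by metis
qed

lemma separates_exists:
  assumes "strand_label D c True = strand_label D c False"
  shows "\<exists>s.  separates \<kappa> s"
proof -
  obtain L K where LK: "tangle_rel opp (take c D) [] L" "layer_rel opp False (p, Cross (Classical b)) L K"
    "tangle_rel opp (drop (Suc c) D) K []"
    using runs_tangle_rel[OF D_runs] by (subst (asm) D_split) (auto simp: tangle_rel_append)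
  obtain h0 M where M: "tangle_rel id (take c D) (map h0 []) M" "paired (M @ map h0 [])"
    using universal_valuation[OF LK(1), of "[]" "[]"] by (auto simp: paired_def)
  obtain u where u: "valuation id {} (take c D) u" "u 0 = []" "u c = M"
    using tangle_relE[OF M(1)] c by (auto simp: min_absorb2)
  obtain v where v: "valuation opp {} (take c D) v" "v 0 = []" "v c = L"
    using tangle_relE[OF LK(1)] c by (auto simp: min_absorb2)
  have "length M = length L"
    using valuation_length[OF u(1) v(1), of c] u v c by simp
  moreover have "length K = length L" "p + 2 \<le> length L"
    using layer_rel_length[OF LK(2)] by auto
  ultimately have "M = take p M @ [M ! p, M ! (p + 1)] @ drop (p + 2) M" "length (take p M) = p"
    by (auto simp: Cons_nth_drop_Suc)
  then obtain A x y B where AB: "M = A @ [x, y] @ B" "length A = p" by blast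
  \<comment> \<open>The crossing is cut, so the ends above it start with two fresh names, while the
    names \<open>x\<close> and \<open>y\<close> of the ends below are kept in the list of free
    ends.\<close>
  obtain z where z: "z \<notin> set M"
    using infinite_UNIV_nat ex_new_if_finite by blast
  obtain z' where z': "z' \<notin> set (z # M)"
    using infinite_UNIV_nat ex_new_if_finite by blast
  have "paired ((A @ [z, z'] @ B) @ [x, y, z, z'])"
  proof -
    have "count_list M z = 0" "count_list M z' = 0" "z' \<noteq> z"
      using z z' by (auto simp: count_list_0_iff)
    moreover have "count_list ((A @ [z, z'] @ B) @ [x, y, z, z']) w =
        count_list M w + (if w = z then 2 else 0) + (if w = z' then 2 else 0)" for w
      by (simp add: AB)
    ultimately show ?thesis
      using M(2) unfolding paired_def by simp
  qed
  moreover have "length K = length (A @ [z, z'] @ B)"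
    using \<open>length K = length L\<close> \<open>length M = length L\<close> AB by simp
  ultimately obtain h N where h: "tangle_rel id (drop (Suc c) D) (map h (A @ [z, z'] @ B)) N"
    "paired (N @ map h [x, y, z, z'])"
    using universal_valuation[OF LK(3)] by blast
  obtain w where w: "valuation id {} (drop (Suc c) D) w" "w 0 = map h (A @ [z, z'] @ B)" "w (length (drop (Suc c) D)) = N"
    using tangle_relE[OF h(1)] by auto
  \<comment> \<open>Nothing is left at the top of a closed diagram: the four ends of the cut
    crossing are its only free ends.\<close>
  have "length N = 0"
  proof -
    obtain w' where "valuation opp {} (drop (Suc c) D) w'" "w' 0 = K" "w' (length (drop (Suc c) D)) = []"
      using tangle_relE[OF LK(3)] by auto
    then show ?thesis
      using valuation_length[OF w(1), of opp "{}" w' "length (drop (Suc c) D)"] w \<open>length K = length (A @ [z, z'] @ B)\<close> by simp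
  qed
  then have pair: "paired (map h [x, y, z, z'])"
    using h(2) by simp
  define t where "t = glue c 1 (\<lambda>k. map h (u k)) (case_nat (map h M) (\<lambda>_. map h (A @ [z, z'] @ B))) w"
  have "valuation id {c} (take c D @ [(p, Cross (Classical b))] @ drop (Suc c) D)
     (glue (length (take c D)) (length [(p, Cross (Classical b))]) (\<lambda>k. map h (u k)) (case_nat (map h M) (\<lambda>_. map h (A @ [z, z'] @ B))) w)"
  proof (rule valuation_glue)
    have "valuation id {} (take c D) (\<lambda>k. map h (u k))"
      using valuation_map[OF u(1), of h id] by simp
    then show "valuation id {c} (take c D) (\<lambda>k. map h (u k))"
      by (rule valuation_mono) simp
    show "valuation id {k. length (take c D) + k \<in> {c}} [(p, Cross (Classical b))] (case_nat (map h M) (\<lambda>_. map h (A @ [z, z'] @ B)))"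
      using layer_relI[of "map h A" p id True "Cross (Classical b)" "map h [x, y]" "map h [z, z']" "map h B"] AB c
      by (simp add: valuation_def min_absorb2)
    show "valuation id {k. length (take c D) + length [(p, Cross (Classical b))] + k \<in> {c}} (drop (Suc c) D) w"
      using w(1) by (rule valuation_mono) simp
  qed (use w u c in \<open>simp_all add: min_absorb2\<close>)
  then have t: "valuation id {c} D t"
    using c D_split by (simp add: t_def min_absorb2)
  have t0: "t 0 = []"
    using u c M by (auto simp: t_def glue_def)
  have ports: "val t (BL D c) = h x" "val t (BR D c) = h y" "val t (TL D c) = h z" "val t (TR D c) = h z'"
    using AB w by (auto simp: val_def BL_def BR_def TL_def TR_def Dc t_def glue_def nth_append)
  define s where "s k = map (\<lambda>a. a = val t (out_end D c \<kappa>)) (t k)" for k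
  have s: "valuation id {c} D s" "s 0 = []"
    unfolding s_def using valuation_map[OF t, of "\<lambda>a. a = val t (out_end D c \<kappa>)" id] t0 by auto
  have val_s: "val s e \<longleftrightarrow> val t e = val t (out_end D c \<kappa>)" if "e \<in> points D" for e
    using that valuation_shape[OF D_runs t t0] by (auto simp: s_def val_def points_def)
  define o1 o2 i1 i2 where ends: "o1 = val t (out_end D c \<kappa>)" "o2 = val t (out_end D c (\<not> \<kappa>))"
    "i1 = val t (in_end D c \<kappa>)" "i2 = val t (in_end D c (\<not> \<kappa>))"
  have "count_list [val t (BL D c), val t (BR D c), val t (TL D c), val t (TR D c)] o1 = count_list [o1, o2, i1, i2] o1"
    by (cases "b = \<kappa>") (auto simp: ends in_end_def out_end_def rising)
  then have "count_list [o1, o2, i1, i2] o1 \<in> {0, 2}"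
    using pair unfolding paired_def ports list.map by metis
  moreover have "of_bool (o1 = o1) + of_bool (o2 = o1) = (of_bool (i1 = o1) + of_bool (i2 = o1) :: int)"
    using conservation[OF s, of \<kappa>] by (simp add: val_s ends_points ends)
  ultimately have "o2 \<noteq> o1"
    by (auto split: if_splits)
  then have "separates \<kappa> s"
    using s val_s by (simp add: separates_def ends_points ends)
  then show ?thesis by blast
qed

end

section \<open>Validity after replacing a tangle\<close>

lemma valuation_const: "valuation \<tau> X D v \<Longrightarrow> valuation id X D (\<lambda>k. map (\<lambda>_. a) (v k))"
  by (rule valuation_map) auto

lemma set_zip_const: "set (zip L (map (\<lambda>_. a) L)) = (\<lambda>x. (x, a)) ` set L"
  by (induction L) auto

text \<open>
  The premise \<open>interior\<close> excludes closed components of the new tangle \<open>S\<close>; \<open>C\<close> records which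
  ends of the cut crossings \<open>X\<close> of \<open>T\<close> are joined by \<open>S\<close>.
\<close>
lemma vl_diagram_replace:
  fixes v w :: "nat \<Rightarrow> colour list" and C :: "(nat \<Rightarrow> bool list) \<Rightarrow> bool"
  assumes v: "valuation opp ((+) (length P) ` X) (P @ T @ Q) v" "v 0 = []" "v (length (P @ T @ Q)) = []"
    and w: "valuation opp {} S w" "w 0 = v (length P)" "w (length S) = v (length P + length T)"
    and X: "X \<subseteq> {..<length T}"
    and transfer: "\<And>L M. tangle_rel id S L M \<Longrightarrow> length L = length (w 0) \<Longrightarrow>
      \<exists>u. valuation id X T u \<and> u 0 = L \<and> u (length T) = M \<and> C u"
    and interior: "\<And>(g :: nat \<Rightarrow> bool list) k l d b. valuation id {} S g \<Longrightarrow> length (g 0) = length (w 0) \<Longrightarrow> k \<le> length S \<Longrightarrow>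
      ((l, d), b) \<in> set (zip (w k) (g k)) \<Longrightarrow>
      \<exists>d'. ((l, d'), b) \<in> set (zip (w 0) (g 0)) \<union> set (zip (w (length S)) (g (length S)))"
    and labels: "fst ` ((\<Union>k\<le>length P. set (v k)) \<union> (\<Union>k\<le>length Q. set (v (length P + length T + k)))) = {1..n}"
    and const: "\<And>g u. valuation id ((+) (length P) ` X) (P @ T @ Q) g \<Longrightarrow> g 0 = [] \<Longrightarrow> C u \<Longrightarrow>
      (\<And>k. k \<le> length T \<Longrightarrow> g (length P + k) = u k) \<Longrightarrow> label_constant (length (P @ T @ Q)) v g"
  shows "vl_diagram (paint v P @ paint w S @ paint (\<lambda>k. v (length P + length T + k)) Q) \<and>
    ncomp (paint v P @ paint w S @ paint (\<lambda>k. v (length P + length T + k)) Q) = n"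
proof -
  let ?vQ = "\<lambda>k. v (length P + length T + k)"
  define e where "e = glue (length P) (length S) v w ?vQ"
  have e: "k \<le> length P \<Longrightarrow> e k = v k" "k \<le> length S \<Longrightarrow> e (length P + k) = w k"
    "e (length P + (length S + k)) = ?vQ k" for k
    unfolding e_def using w by (simp_all add: glue_simps)
  have vP: "valuation opp {} P v"
    using v(1) unfolding valuation_append by (auto elim: valuation_cong[THEN iffD1, rotated 2])
  have vQ: "valuation opp {} Q ?vQ"
  proof -
    have "valuation opp {k. length T + k \<in> {k. length P + k \<in> (+) (length P) ` X}} Q
        (\<lambda>k. v (length P + (length T + k)))"
      using v(1) unfolding valuation_append by blast
    then show ?thesis
      by (rule valuation_cong[THEN iffD1, rotated 2]) (use X in \<open>auto simp: add.assoc\<close>)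
  qed
  have val_e: "valuation opp {} (P @ S @ Q) e"
    unfolding e_def by (rule valuation_glue) (use vP vQ w in simp_all)
  have paint_e: "paint v P @ paint w S @ paint ?vQ Q = paint e (P @ S @ Q)"
    unfolding paint_append
    by (intro arg_cong2[of _ _ _ _ "(@)"] paint_cong) (simp_all add: e Suc_leI flip: add_Suc_right)
  have e_levels: "(\<Union>k\<le>length (P @ S @ Q). f (e k)) =
     (\<Union>k\<le>length P. f (v k)) \<union> (\<Union>k\<le>length S. f (w k)) \<union> (\<Union>k\<le>length Q. f (?vQ k))" for f :: "_ \<Rightarrow> 'z set"
  proof -
    have "{..length (P @ S @ Q)} = {..length P} \<union> ((+) (length P) ` {..length S}) \<union> ((\<lambda>k. length P + (length S + k)) ` {..length Q})"
    proof (intro set_eqI iffI)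
      fix k assume k: "k \<in> {..length (P @ S @ Q)}"
      consider "k \<le> length P" | j where "k = length P + j" "j \<le> length S" | j where "k = length P + (length S + j)"
        by (metis le_Suc_ex nat_le_linear add.assoc)
      then show "k \<in> {..length P} \<union> ((+) (length P) ` {..length S}) \<union> ((\<lambda>k. length P + (length S + k)) ` {..length Q})"
        using k by cases auto
    qed auto
    then show ?thesis by (simp add: UN_Un image_image e del: length_append)
  qed
  have inner: "\<exists>d'. ((l, d'), b) \<in> set (zip (v (length P)) (g (length P))) \<union>
      set (zip (?vQ 0) (g (length P + length S)))"
    if "valuation id {} (P @ S @ Q) g" "g 0 = []" "k \<le> length S" "((l, d), b) \<in> set (zip (w k) (g (length P + k)))"
    for g :: "nat \<Rightarrow> bool list" and k l d b
  proof -
    have g: "valuation id {} S (\<lambda>k. g (length P + k))"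
      using that(1) by (simp add: valuation_append)
    have "length (g (length P)) = length (e (length P))"
      using valuation_length[OF that(1) val_e, of "length P"] that(2) v(2) e(1)[of 0] by simp
    then show ?thesis
      using interior[of "\<lambda>k. g (length P + k)" k l d b, OF g _ that(3)] that(4) w e(1)[of "length P"] by simp
  qed
  have 5: "fst ` (\<Union>k\<le>length (P @ S @ Q). set (e k)) = {1..n}"
  proof -
    have "\<exists>d'. (l, d') \<in> set (v (length P)) \<union> set (?vQ 0)" if "k \<le> length S" "(l, d) \<in> set (w k)" for k l d
    proof -
      have "((l, d), False) \<in> set (zip (w k) (map (\<lambda>_. False) (e (length P + k))))"
        using that by (simp add: e set_zip_const)
      from inner[OF valuation_const[OF val_e] _ that(1) this] show ?thesis
        using v(2) by (auto simp: e dest: set_zip_leftD)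
    qed
    then have "fst ` (\<Union>k\<le>length S. set (w k)) \<subseteq> fst ` (set (v (length P)) \<union> set (?vQ 0))"
      by (clarsimp simp: image_iff) (metis (no_types, lifting) Un_iff fst_conv)
    also have "\<dots> \<subseteq> {1..n}"
      unfolding labels[symmetric] by (intro image_mono Un_mono UN_upper) auto
    finally have sub: "fst ` (\<Union>k\<le>length S. set (w k)) \<subseteq> {1..n}" .
    have "fst ` (\<Union>k\<le>length (P @ S @ Q). set (e k)) =
        fst ` ((\<Union>k\<le>length P. set (v k)) \<union> (\<Union>k\<le>length Q. set (?vQ k))) \<union> fst ` (\<Union>k\<le>length S. set (w k))"
      unfolding e_levels image_Un by (simp only: Un_ac)
    then show ?thesis
      using sub unfolding labels by (simp add: Un_absorb2)
  qed
  have 6: "label_constant (length (P @ S @ Q)) e g" if g: "valuation id {} (P @ S @ Q) g" "g 0 = []" for g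
  proof -
    have len: "length (g (length P)) = length (w 0)"
      using valuation_length[OF g(1) val_e, of "length P"] g(2) v(2) e by (simp add: w)
    have gs: "valuation id {} P g" "valuation id {} S (\<lambda>k. g (length P + k))"
      "valuation id {} Q (\<lambda>k. g (length P + (length S + k)))"
      using g(1) by (auto simp: valuation_append)
    obtain u where u: "valuation id X T u" "u 0 = g (length P)" "u (length T) = g (length P + length S)" "C u"
      using transfer[OF tangle_relI[OF gs(2)]] len by auto
    \<comment> \<open>A Boolean valuation \<open>g\<close> of the new diagram is carried to the old
      one, unchanged outside the tangle. There the labels determine its values, and by
      \<open>interior\<close> each pair of label and value inside \<open>S\<close> already occurs at
      the boundary of \<open>S\<close>.\<close>
    define gD where "gD = glue (length P) (length T) g u (\<lambda>k. g (length P + (length S + k)))"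
    have gD: "k \<le> length P \<Longrightarrow> gD k = g k" "k \<le> length T \<Longrightarrow> gD (length P + k) = u k"
      "gD (length P + (length T + k)) = g (length P + (length S + k))" for k
      unfolding gD_def using u by (simp_all add: glue_simps)
    have "valuation id ((+) (length P) ` X) (P @ T @ Q) gD"
      unfolding gD_def
    proof (rule valuation_glue)
      have "{k. length P + k \<in> (+) (length P) ` X} = X" by auto
      then show "valuation id {k. length P + k \<in> (+) (length P) ` X} T u"
        using u(1) by simp
    qed (use u gs(1,3) in \<open>auto elim: valuation_mono\<close>)
    then have lc: "label_constant (length (P @ T @ Q)) v gD"
      using const[of gD u] u(4) gD g(2) by simp
    have cellI: "z \<in> cells (length (P @ T @ Q)) v gD" if "z \<in> set (zip (v k) (gD k))" "k \<le> length (P @ T @ Q)" for z k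
      using that unfolding cells_def by blast
    have "\<exists>d'. ((l, d'), b) \<in> cells (length (P @ T @ Q)) v gD" if mem: "((l, d), b) \<in> cells (length (P @ S @ Q)) e g" for l d b
    proof -
      obtain k where k: "k \<le> length (P @ S @ Q)" "((l, d), b) \<in> set (zip (e k) (g k))"
        using mem by (auto simp: cells_def)
      consider "k \<le> length P" | j where "k = length P + j" "j \<le> length S" | j where "k = length P + (length S + j)"
        by (metis le_Suc_ex nat_le_linear add.assoc)
      then show ?thesis
      proof cases
        case 1
        then show ?thesis
          using k cellI[of _ k] by (auto simp: e gD)
      next
        case 2
        then have "\<exists>d'. ((l, d'), b) \<in> set (zip (v (length P)) (gD (length P))) \<union>
            set (zip (v (length P + length T)) (gD (length P + length T)))"
          using inner[OF g, of j l d b] k gD(1)[of "length P"] gD(3)[of 0] by (simp add: e)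
        then show ?thesis
          using cellI[of _ "length P"] cellI[of _ "length P + length T"] by fastforce
      next
        case 3
        then have "((l, d), b) \<in> set (zip (v (length P + length T + j)) (gD (length P + length T + j)))"
          using k(2) gD(3)[of j] by (simp add: e add.assoc)
        then show ?thesis
          using 3 k(1) cellI[of _ "length P + length T + j"] by fastforce
      qed
    qed
    note rep = this
    have ex: "\<exists>z\<in>cells (length (P @ T @ Q)) v gD. fst (fst z) = fst (fst y) \<and> snd z = snd y"
      if "y \<in> cells (length (P @ S @ Q)) e g" for y
    proof -
      obtain l d b where y: "y = ((l, d), b)" by (metis prod.exhaust)
      with rep that obtain d' where "((l, d'), b) \<in> cells (length (P @ T @ Q)) v gD" by blast
      then show ?thesis unfolding y by (rule bexI[rotated]) simp
    qed
    show ?thesis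
      unfolding label_constant_def
    proof (intro ballI impI)
      fix y z
      assume "y \<in> cells (length (P @ S @ Q)) e g" "z \<in> cells (length (P @ S @ Q)) e g" "fst (fst y) = fst (fst z)"
      then show "snd y = snd z"
        using lc ex[of y] ex[of z] unfolding label_constant_def by metis
    qed
  qed
  have "e 0 = []" "e (length (P @ S @ Q)) = []"
    using v(2,3) e(1)[of 0] e(3)[of "length Q"] by (simp_all add: add.assoc)
  from vl_diagramI[OF val_e this paint_e 5 6]
  show ?thesis by auto
qed

section \<open>Smoothings\<close>

text \<open>In contrast to \<open>smooth\<close>, the new colours are given by a valuation of the
  diagram cut at \<open>c\<close>, and the parts below and above the crossing are painted
  separately, so that further segments can be split off.\<close>

definition smoothing :: "diagram \<Rightarrow> nat \<Rightarrow> bool \<Rightarrow> (nat \<Rightarrow> colour list) \<Rightarrow> diagram" where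
  "smoothing D c t v = (let p = fst (D ! c); (l, d) = val v (TL D c) in
     paint v (take c D) @ (if t then [(p, Cap), (p, Cup l d)] else []) @
     paint (\<lambda>k. v (Suc c + k)) (drop (Suc c) D))"

text \<open>The equations which turn a valuation of the cut diagram into one of the smoothed
  diagram: ends that get joined must match, up to \<open>\<tau>\<close> where they are joined by a
  maximum or minimum.\<close>

definition joined :: "('a \<Rightarrow> 'a) \<Rightarrow> diagram \<Rightarrow> nat \<Rightarrow> bool \<Rightarrow> (nat \<Rightarrow> 'a list) \<Rightarrow> bool" where
  "joined \<tau> D c t g \<longleftrightarrow>
     (if t then val g (BR D c) = \<tau> (val g (BL D c)) \<and> val g (TR D c) = \<tau> (val g (TL D c))
      else val g (TL D c) = val g (BL D c) \<and> val g (TR D c) = val g (BR D c))"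

definition decorate :: "diagram \<Rightarrow> (colour \<times> bool \<Rightarrow> colour) \<Rightarrow> (nat \<Rightarrow> bool list) \<Rightarrow> nat \<Rightarrow> colour list" where
  "decorate D F s k = map F (zip (level D k) (s k))"

context diagram_crossing
begin

text \<open>Only cups store colours, so it matters what \<open>f\<close> does at the left ends of
  cups and at the top left end of the crossing, where an inserted cup begins.\<close>

lemma smooth_eq_smoothing:
  assumes "\<And>x. x \<in> points D \<Longrightarrow> val v x = f x (colour_at D x)"
  shows "smooth D c t f = smoothing D c t v"
proof -
  have "recolour f D = paint v D"
  proof (rule nth_equalityI)
    fix j assume "j < length (recolour f D)"
    then have j: "j < length D" by (simp add: recolour_def)
    obtain q g where g: "D ! j = (q, g)" by force
    have "layer_rel opp False (q, g) (level D j) (level D (Suc j))"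
      using valuation_level(1)[OF D_runs] j g by (auto simp: valuation_def)
    from layer_rel_length(3)[OF this] have q: "q + outs g \<le> length (level D (Suc j))" by simp
    have pl: "paint1 (D ! j) (level D (Suc j)) = D ! j"
      using valuation_level(2)[OF D_runs] j by (metis nth_paint)
    show "recolour f D ! j = paint v D ! j"
    proof (cases g)
      case (Cup l d)
      then have "(Suc j, q) \<in> points D" "colour_at D (Suc j, q) = (l, d)"
        using q j pl g by (auto simp: points_def colour_at_def prod_eq_iff)
      then have "v (Suc j) ! q = f (Suc j, q) (l, d)"
        using assms[of "(Suc j, q)"] by (simp add: val_def)
      then show ?thesis
        using j g Cup by (simp add: recolour_def split: prod.split)
    qed (use j g in \<open>simp_all add: recolour_def\<close>)
  qed (simp add: recolour_def)
  also have "paint v D = paint v (take c D) @ paint (\<lambda>k. v (c + k)) [(p, Cross (Classical b))] @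
      paint (\<lambda>k. v (Suc c + k)) (drop (Suc c) D)"
    using c paint_append[of v "take c D" "[(p, Cross (Classical b))] @ drop (Suc c) D"]
      paint_append[of "\<lambda>k. v (c + k)" "[(p, Cross (Classical b))]" "drop (Suc c) D"] D_split
    by (simp add: min_absorb2)
  finally have "recolour f D = paint v (take c D) @ [(p, Cross (Classical b))] @
      paint (\<lambda>k. v (Suc c + k)) (drop (Suc c) D)"
    by (simp add: paint_def[of _ "[_]"])
  moreover have "length (paint v (take c D)) = c"
    using c by simp
  moreover have "f (TL D c) (colour_at D (TL D c)) = val v (TL D c)"
    using assms[OF ends_points(3)] by simp
  ultimately show ?thesis
    unfolding smooth_def smoothing_def Let_def by (simp split: prod.split)
qed

lemma cells_points':
  assumes "valuation \<tau> X D v" "v 0 = []" "valuation \<sigma> Y D g" "g 0 = []"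
  shows "cells (length D) v g = (\<lambda>x. (val v x, val g x)) ` points D"
proof -
  have "set (zip (v k) (g k)) = (\<lambda>i. (v k ! i, g k ! i)) ` {..<length (level D k)}"
    if "k \<le> length D" for k
    using valuation_shape[OF D_runs assms(1,2) that] valuation_shape[OF D_runs assms(3,4) that]
    by (auto simp: set_zip)
  then have "cells (length D) v g =
      (\<Union>k\<le>length D. (\<lambda>i. (v k ! i, g k ! i)) ` {..<length (level D k)})"
    by (simp add: cells_def)
  also have "\<dots> = (\<lambda>x. (val v x, val g x)) ` points D"
    by (auto simp: points_def val_def) force
  finally show ?thesis .
qed

lemma val_levels:
  assumes "valuation \<tau> X D v" "v 0 = []"
  shows "(\<Union>k\<le>length D. set (v k)) = val v ` points D"
proof -
  have "set (v k) = (\<lambda>i. v k ! i) ` {..<length (level D k)}" if "k \<le> length D" for k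
    using valuation_shape[OF D_runs assms that] by (auto simp: in_set_conv_nth)
  then have "(\<Union>k\<le>length D. set (v k)) = (\<Union>k\<le>length D. (\<lambda>i. v k ! i) ` {..<length (level D k)})"
    by simp
  also have "\<dots> = val v ` points D"
    by (auto simp: points_def val_def) force
  finally show ?thesis .
qed

text \<open>An application of \<open>vl_diagram_replace\<close> to the cut crossing. The valuations
  of the smoothed diagram come from the valuations of the cut diagram satisfying
  \<open>joined id\<close>, so constancy on labels has to be checked for these only.\<close>

lemma vl_smoothing:
  assumes v: "valuation opp {c} D v" "v 0 = []" "joined opp D c t v"
    and labels: "(\<lambda>x. fst (val v x)) ` points D = {1..n}"
    and const: "\<And>(g :: nat \<Rightarrow> bool list) x y. valuation id {c} D g \<Longrightarrow> g 0 = [] \<Longrightarrow> joined id D c t g \<Longrightarrow>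
      x \<in> points D \<Longrightarrow> y \<in> points D \<Longrightarrow> fst (val v x) = fst (val v y) \<Longrightarrow> val g x = val g y"
  shows "vl_diagram (smoothing D c t v)" "ncomp (smoothing D c t v) = n"
proof -
  let ?P = "take c D" and ?Q = "drop (Suc c) D" and ?x = "(p, Cross (Classical b))"
  define S where "S = (if t then [(p, Cap), (p, Cup 0 True)] else [])"
  have lP: "length ?P = c" using c by simp
  have D: "?P @ [?x] @ ?Q = D" using D_split by simp
  obtain A B where AB: "length A = p" "v c = A @ [val v (BL D c), val v (BR D c)] @ B"
    "v (Suc c) = A @ [val v (TL D c), val v (TR D c)] @ B"
    using valuation_cross[OF v(1) c Dc] by blast
  \<comment> \<open>Between the inserted cap and cup the two strands at the crossing are missing,
    which leaves \<open>A @ B\<close>.\<close>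
  define w where "w = (if t then (\<lambda>k. [v c, A @ B, v (Suc c)] ! k) else (\<lambda>_. v c))"
  have w: "valuation opp {} S w" "w 0 = v c" "w (length S) = v (Suc c)"
  proof -
    show "valuation opp {} S w"
      using layer_relI[of A p opp False Cap "[val v (BL D c), val v (BR D c)]" "[]" B]
        layer_relI[of A p opp False "Cup 0 True" "[]" "[val v (TL D c), val v (TR D c)]" B] AB v(3)
      by (auto simp: S_def w_def valuation_Cons joined_def)
    show "w 0 = v c" "w (length S) = v (Suc c)"
      using AB v(3) by (auto simp: S_def w_def joined_def)
  qed
  have vD: "v (length D) = []"
    using valuation_shape[OF D_runs v(1,2), of "length D"] runs_level[OF D_runs] by simp
  let ?E = "paint v ?P @ paint w S @ paint (\<lambda>k. v (length ?P + length [?x] + k)) ?Q"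
  \<comment> \<open>The condition \<open>joined id\<close>, written for the one-layer tangle
    consisting of the crossing.\<close>
  let ?C = "\<lambda>u :: nat \<Rightarrow> bool list. \<exists>a b d e A B. u 0 = A @ [a, b] @ B \<and> u 1 = A @ [d, e] @ B \<and> length A = p \<and>
       (if t then a = b \<and> d = e else d = a \<and> e = b)"
  have main: "vl_diagram ?E \<and> ncomp ?E = n"
  proof (rule vl_diagram_replace[where X = "{0}" and C = ?C])
    show "valuation opp ((+) (length ?P) ` {0}) (?P @ [?x] @ ?Q) v"
      using v(1) D c by simp
    show "v 0 = []" "v (length (?P @ [?x] @ ?Q)) = []"
      using v(2) vD D by simp_all
    show "valuation opp {} S w" "w 0 = v (length ?P)" "w (length S) = v (length ?P + length [?x])"
      using w c by simp_all
    show "{0} \<subseteq> {..<length [?x]}" by simp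
    show "\<exists>u. valuation id {0} [?x] u \<and> u 0 = L \<and> u (length [?x]) = M \<and> ?C u"
      if LM: "tangle_rel id S L M" "length L = length (w 0)" for L M :: "bool list"
    proof -
      obtain a1 a2 d1 d2 A' B' where *: "L = A' @ [a1, a2] @ B'" "M = A' @ [d1, d2] @ B'" "length A' = p"
        "if t then a1 = a2 \<and> d1 = d2 else d1 = a1 \<and> d2 = a2"
      proof (cases t)
        case True
        then obtain K where K: "layer_rel id False (p, Cap) L K" "layer_rel id False (p, Cup 0 True) K M"
          using LM(1) by (auto simp: S_def)
        obtain A1 a B1 where 1: "L = A1 @ [a, a] @ B1" "K = A1 @ B1" "length A1 = p"
          using K(1) by (rule layer_relE) auto
        obtain A2 d B2 where 2: "M = A2 @ [d, d] @ B2" "K = A2 @ B2" "length A2 = p"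
          using K(2) by (rule layer_relE) auto
        have "A1 = A2" "B1 = B2" using 1 2 by auto
        then show ?thesis using 1 2 True by (intro that) auto
      next
        case False
        then have "L = M" "p + 2 \<le> length L"
          using LM AB by (auto simp: S_def w)
        then have "L = take p L @ [L ! p, L ! (p + 1)] @ drop (p + 2) L"
          by (simp add: Cons_nth_drop_Suc)
        then show ?thesis using \<open>L = M\<close> \<open>p + 2 \<le> length L\<close> False
          by (intro that[of "take p L" "L ! p" "L ! (p + 1)" "drop (p + 2) L"]) auto
      qed
      then have "valuation id {0} [?x] (case_nat L (\<lambda>_. M))"
        using layer_relI[of A' p id True "Cross (Classical b)" "[a1, a2]" "[d1, d2]" B']
        by (simp add: valuation_Cons)
      moreover have "?C (case_nat L (\<lambda>_. M))"
        by (rule exI[of _ a1], rule exI[of _ a2], rule exI[of _ d1], rule exI[of _ d2], rule exI[of _ A'], rule exI[of _ B'])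
          (use * in simp)
      ultimately show ?thesis
        by (intro exI[of _ "case_nat L (\<lambda>_. M)"]) simp
    qed
    show "\<exists>d'. ((l, d'), b) \<in> set (zip (w 0) (g 0)) \<union> set (zip (w (length S)) (g (length S)))"
      if g: "valuation id {} S g" "length (g 0) = length (w 0)" "k \<le> length S"
        "((l, d), b) \<in> set (zip (w k) (g k))" for g :: "nat \<Rightarrow> bool list" and k l d b
    proof (cases "k = 1")
      case True
      then have t using g(3) by (auto simp: S_def split: if_splits)
      then have "layer_rel id False (p, Cap) (g 0) (g 1)"
        using g(1) by (simp add: S_def valuation_Cons)
      then obtain A' a B' where g': "g 0 = A' @ [a, a] @ B'" "g 1 = A' @ B'" "length A' = p"
        by (rule layer_relE) auto
      then have "set (zip (A @ B) (A' @ B')) \<subseteq> set (zip (v c) (g 0))"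
        using AB(1) g' by (simp add: AB(2)) blast
      then show ?thesis
        using g(4) True \<open>t\<close> g' by (auto simp: w_def)
    next
      case False
      then have "k = 0 \<or> k = length S" using g(3) by (auto simp: S_def split: if_splits)
      then show ?thesis using g(4) by auto
    qed
    show "fst ` ((\<Union>k\<le>length ?P. set (v k)) \<union> (\<Union>k\<le>length ?Q. set (v (length ?P + length [?x] + k)))) = {1..n}"
    proof -
      have "{..length D} = {..c} \<union> (\<lambda>k. Suc c + k) ` {..length D - Suc c}"
      proof (intro set_eqI iffI)
        fix k assume "k \<in> {..length D}"
        then show "k \<in> {..c} \<union> (\<lambda>k. Suc c + k) ` {..length D - Suc c}"
          by (cases "k \<le> c") (auto intro!: image_eqI[of _ _ "k - Suc c"])
      qed (use c in auto)
      then have "(\<Union>k\<le>length ?P. set (v k)) \<union> (\<Union>k\<le>length ?Q. set (v (length ?P + length [?x] + k))) =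
         (\<Union>k\<le>length D. set (v k))"
        using c by (simp add: min_absorb2 UN_Un image_image)
      then show ?thesis
        using labels by (simp add: val_levels[OF v(1,2)] image_image)
    qed
    show "label_constant (length (?P @ [?x] @ ?Q)) v g"
      if g: "valuation id ((+) (length ?P) ` {0}) (?P @ [?x] @ ?Q) g" "g 0 = []" "?C u"
        "\<And>k. k \<le> length [?x] \<Longrightarrow> g (length ?P + k) = u k" for g u :: "nat \<Rightarrow> bool list"
    proof -
      have g1: "valuation id {c} D g" using g(1) D lP by simp
      obtain a1 a2 d1 d2 A' B' where u: "u 0 = A' @ [a1, a2] @ B'" "u 1 = A' @ [d1, d2] @ B'" "length A' = p"
        "if t then a1 = a2 \<and> d1 = d2 else d1 = a1 \<and> d2 = a2"
        using g(3) by blast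
      have "g c = u 0" "g (Suc c) = u 1"
        using g(4)[of 0] g(4)[of 1] lP by simp_all
      then have j: "joined id D c t g"
        using u by (simp add: joined_def val_def BL_def BR_def TL_def TR_def Dc nth_append split: if_splits)
      have "label_constant (length D) v g"
        unfolding label_constant_def cells_points'[OF v(1,2) g1 g(2)] ball_simps fst_conv snd_conv
        by (intro ballI impI) (rule const[OF g1 g(2) j])
      then show ?thesis using D by simp
    qed
  qed
  moreover have "?E = smoothing D c t v"
  proof -
    have "paint w S = (if t then [(p, Cap), (p, Cup (fst (val v (TL D c))) (snd (val v (TL D c))))] else [])"
      by (auto simp: S_def w_def paint_def upt_rec AB nth_append)
    then show ?thesis
      using lP by (simp add: smoothing_def Dc case_prod_unfold Let_def)
  qed
  ultimately show "vl_diagram (smoothing D c t v)" "ncomp (smoothing D c t v) = n"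
    by simp_all
qed

text \<open>\<open>F\<close> has to commute with \<open>opp\<close>, since at a maximum or minimum
  the colour of a strand changes its direction while the Boolean value stays.\<close>

lemma
  assumes "valuation id {c} D s" "s 0 = []" "\<And>a b. F (opp a, b) = opp (F (a, b))"
  shows valuation_decorate: "valuation opp {c} D (decorate D F s)"
    and decorate_0: "decorate D F s 0 = []"
    and val_decorate: "x \<in> points D \<Longrightarrow> val (decorate D F s) x = F (colour_at D x, val s x)"
proof -
  have "valuation (map_prod opp id) {c} D (\<lambda>k. zip (level D k) (s k))"
    using assms valuation_level(1)[OF D_runs] by (intro valuation_zip) (auto intro: valuation_mono)
  then show "valuation opp {c} D (decorate D F s)"
    unfolding decorate_def by (rule valuation_map) (use assms(3) in auto)
  show "decorate D F s 0 = []"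
    by (simp add: decorate_def)
  show "val (decorate D F s) x = F (colour_at D x, val s x)" if "x \<in> points D"
    using that valuation_shape[OF D_runs assms(1,2)]
    by (auto simp: val_def decorate_def points_def colour_at_def)
qed

end

text \<open>In types 1 and 2 the Boolean argument tells whether the strand lies on the arc that
  keeps its orientation. In type 3 the labels \<open>i\<close> and \<open>j\<close> already tell the
  two parts apart.\<close>

fun colour1 :: "nat \<Rightarrow> colour \<times> bool \<Rightarrow> colour" where
  "colour1 i ((l, d), b) = (l, if l = i \<and> \<not> b then \<not> d else d)"

fun colour2 :: "nat \<Rightarrow> nat \<Rightarrow> colour \<times> bool \<Rightarrow> colour" where
  "colour2 n i ((l, d), b) = (if l = i \<and> \<not> b then (n, \<not> d) else (l, d))"

fun colour3 :: "nat \<Rightarrow> nat \<Rightarrow> colour \<times> bool \<Rightarrow> colour" where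
  "colour3 i j ((l, d), b) = (if l = i \<or> l = j then min i j else if l > max i j then l - 1 else l,
     if l = j then \<not> d else d)"

lemma colours_opp:
  "colour1 i (opp a, b) = opp (colour1 i (a, b))"
  "colour2 n i (opp a, b) = opp (colour2 n i (a, b))"
  "colour3 i j (opp a, b) = opp (colour3 i j (a, b))"
  by (cases a; simp)+

section \<open>Validity of the three smoothings\<close>

context diagram_crossing
begin

lemma smooth1_eq:
  assumes "separates \<kappa> s" "strand_label D c True = strand_label D c False"
  shows "smooth1 \<kappa> D c = smoothing D c (parallel D c) (decorate D (colour1 (strand_label D c \<kappa>)) s)"
  unfolding smooth1_def
proof (rule smooth_eq_smoothing)
  fix x assume x: "x \<in> points D"
  have s: "valuation id {c} D s" "s 0 = []"
    using assms(1) by (auto simp: separates_def)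
  obtain l d where col: "colour_at D x = (l, d)" by force
  show "val (decorate D (colour1 (strand_label D c \<kappa>)) s) x = (case colour_at D x of
      (l, d) \<Rightarrow> if l = strand_label D c \<kappa> \<and> x \<notin> arc D c \<kappa> then (l, \<not> d) else (l, d))"
    using arc_iff[OF assms x] by (simp add: val_decorate[OF s colours_opp(1) x] col)
qed

lemma smooth2_eq:
  assumes "separates \<kappa> s" "strand_label D c True = strand_label D c False"
  shows "smooth2 \<kappa> D c = smoothing D c (\<not> parallel D c) (decorate D (colour2 (ncomp D + 1) (strand_label D c \<kappa>)) s)"
  unfolding smooth2_def
proof (rule smooth_eq_smoothing)
  fix x assume x: "x \<in> points D"
  have s: "valuation id {c} D s" "s 0 = []"
    using assms(1) by (auto simp: separates_def)
  obtain l d where col: "colour_at D x = (l, d)" by force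
  show "val (decorate D (colour2 (ncomp D + 1) (strand_label D c \<kappa>)) s) x = (case colour_at D x of
      (l, d) \<Rightarrow> if l = strand_label D c \<kappa> \<and> x \<notin> arc D c \<kappa> then (ncomp D + 1, \<not> d) else (l, d))"
    using arc_iff[OF assms x] by (simp add: val_decorate[OF s colours_opp(2) x] col)
qed

lemma smooth3_eq:
  assumes "valuation id {c} D s" "s 0 = []"
  shows "smooth3 \<kappa> D c = smoothing D c (parallel D c) (decorate D (colour3 (strand_label D c \<kappa>) (strand_label D c (\<not> \<kappa>))) s)"
  unfolding smooth3_def Let_def
proof (rule smooth_eq_smoothing)
  fix x assume x: "x \<in> points D"
  obtain l d where col: "colour_at D x = (l, d)" by force
  show "val (decorate D (colour3 (strand_label D c \<kappa>) (strand_label D c (\<not> \<kappa>))) s) x = (case colour_at D x of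
      (l, d) \<Rightarrow> (if l = strand_label D c \<kappa> \<or> l = strand_label D c (\<not> \<kappa>) then min (strand_label D c \<kappa>) (strand_label D c (\<not> \<kappa>))
        else if l > max (strand_label D c \<kappa>) (strand_label D c (\<not> \<kappa>)) then l - 1 else l,
        if l = strand_label D c (\<not> \<kappa>) then \<not> d else d))"
    by (simp add: val_decorate[OF assms colours_opp(3) x] col)
qed

lemma labels_eq: "(\<lambda>x. fst (colour_at D x)) ` points D = {1..ncomp D}"
  using vl by (auto simp: vl_diagram_def labels_def)

lemma label_pos: "strand_label D c ov \<in> {1..ncomp D}"
  unfolding strand_label_def labels_eq[symmetric] using ends_points(6) by (rule imageI)

lemma self_label: "strand_label D c True = strand_label D c False \<Longrightarrow> strand_label D c ov = strand_label D c \<kappa>"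
  by (cases ov; cases \<kappa>) auto

lemma self_other_constant:
  fixes g :: "nat \<Rightarrow> bool list"
  assumes "strand_label D c True = strand_label D c False" "valuation id {c} D g" "g 0 = []"
    "x \<in> points D" "y \<in> points D" "fst (colour_at D y) = fst (colour_at D x)"
    "fst (colour_at D x) \<noteq> strand_label D c \<kappa>"
  shows "val g x = val g y"
  using assms(7) self_label[OF assms(1)]
  by (intro other_constant[OF assms(2-5) refl assms(6)]) metis

text \<open>One arc joins \<open>out_end D c \<kappa>\<close> to
  \<open>in_end D c (\<not> \<kappa>)\<close>, the other the two remaining ends. Joining ingoing
  with ingoing and outgoing with outgoing ends therefore produces a single circuit, and reversing
  one arc makes its directions coherent.\<close>

lemma vl_smooth1:
  assumes sep: "separates \<kappa> s" and self: "strand_label D c True = strand_label D c False"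
  shows "vl_diagram (smooth1 \<kappa> D c)"
    and "joined opp D c (parallel D c) (decorate D (colour1 (strand_label D c \<kappa>)) s)"
proof -
  have s: "valuation id {c} D s" "s 0 = []" using sep by (auto simp: separates_def)
  define i where "i = strand_label D c \<kappa>"
  define v where "v = decorate D (colour1 i) s"
  have v: "valuation opp {c} D v" "v 0 = []" "\<And>x. x \<in> points D \<Longrightarrow> val v x = colour1 i (colour_at D x, val s x)"
    unfolding v_def
    by (rule valuation_decorate[OF s] decorate_0[OF s] val_decorate[OF s]; (rule colours_opp | assumption))+
  have lab: "fst (val v x) = fst (colour_at D x)" if "x \<in> points D" for x
    using v(3)[OF that] by (cases "colour_at D x") simp
  have s_ends: "val s (out_end D c \<kappa>)" "\<not> val s (out_end D c (\<not> \<kappa>))" "val s (in_end D c (\<not> \<kappa>))" "\<not> val s (in_end D c \<kappa>)"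
    using sep separates_in_end[OF sep self] by (auto simp: separates_def)
  have lc: "fst (colour_at D (BL D c)) = i" "fst (colour_at D (BR D c)) = i"
    using strand_label_eq[of b] strand_label_eq[of "\<not> b"] self_label[OF self, of b \<kappa>] self_label[OF self, of "\<not> b" \<kappa>]
    by (simp_all add: i_def)
  \<comment> \<open>If the strands are parallel, the two ingoing ends are both below or both above
    the crossing, and a cap and a cup are needed; otherwise they lie on the same side and vertical
    strands join them.\<close>
  have j: "joined opp D c (parallel D c) v"
    using s_ends lc unfolding joined_def
    by (cases "colour_at D (BL D c)"; cases "colour_at D (BR D c)"; cases "b = \<kappa>"; cases "snd (colour_at D (BL D c))"; cases "snd (colour_at D (BR D c))")
      (auto simp: v(3) ends_points end_colours out_end_def in_end_def rising parallel_def opp_def)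
  have "vl_diagram (smoothing D c (parallel D c) v)"
  proof (rule vl_smoothing(1)[OF v(1,2) j])
    show "(\<lambda>x. fst (val v x)) ` points D = {1..ncomp D}"
      unfolding labels_eq[symmetric] by (rule image_cong[OF refl lab])
    fix g :: "nat \<Rightarrow> bool list" and x y
    assume g: "valuation id {c} D g" "g 0 = []" "joined id D c (parallel D c) g"
      and xy: "x \<in> points D" "y \<in> points D" "fst (val v x) = fst (val v y)"
    show "val g x = val g y"
    proof (cases "fst (colour_at D x) = i")
      case False
      then show ?thesis
        using self_other_constant[OF self g(1,2) xy(1,2)] xy lab by (simp add: i_def)
    next
      case True
      \<comment> \<open>Negating \<open>s\<close> exchanges the two arcs, so constancy becomes
        available on both.\<close>
      obtain s' where s': "separates (\<not> \<kappa>) s'" "\<forall>x\<in>points D. val s' x \<longleftrightarrow> \<not> val s x"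
        using separates_not[OF sep] by blast
      have in_out: "val g (in_end D c (\<not> ov)) = val g (out_end D c ov)" for ov
        using separates_constant(1)[OF sep self g(1,2)] separates_constant(1)[OF s'(1) self g(1,2)]
        by (cases "ov = \<kappa>") auto
      have "val g (out_end D c \<kappa>) = val g (out_end D c (\<not> \<kappa>))"
        using g(3) in_out[of \<kappa>] in_out[of "\<not> \<kappa>"]
        by (cases "b = \<kappa>"; cases "snd (colour_at D (BL D c))"; cases "snd (colour_at D (BR D c))")
          (auto simp: joined_def out_end_def in_end_def rising parallel_def)
      then have "val g z = val g (out_end D c \<kappa>)" if "z \<in> points D" "fst (colour_at D z) = i" for z
        using separates_constant(2)[OF sep self g(1,2) that(1)] that
          separates_constant(2)[OF s'(1) self g(1,2) that(1)] s'(2) self_label[OF self, of "\<not> \<kappa>" \<kappa>]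
        by (cases "val s z") (auto simp: i_def)
      then show ?thesis using True xy lab by metis
    qed
  qed
  then show "vl_diagram (smooth1 \<kappa> D c)"
    using smooth1_eq[OF sep self] by (simp add: v_def i_def)
  show "joined opp D c (parallel D c) (decorate D (colour1 (strand_label D c \<kappa>)) s)"
    using j by (simp add: v_def i_def)
qed

text \<open>Each arc is closed up on its own, so its two ends are recoloured alike and still match
  after the joining. The pair of old label and value of \<open>s\<close> identifies the new
  component.\<close>

lemma vl_smooth2:
  assumes sep: "separates \<kappa> s" and self: "strand_label D c True = strand_label D c False"
  shows "vl_diagram (smooth2 \<kappa> D c)"
    and "joined opp D c (\<not> parallel D c) (decorate D (colour2 (ncomp D + 1) (strand_label D c \<kappa>)) s)"
proof -
  have s: "valuation id {c} D s" "s 0 = []" using sep by (auto simp: separates_def)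
  define i where "i = strand_label D c \<kappa>"
  define n where "n = ncomp D + 1"
  define v where "v = decorate D (colour2 n i) s"
  have v: "valuation opp {c} D v" "v 0 = []" "\<And>x. x \<in> points D \<Longrightarrow> val v x = colour2 n i (colour_at D x, val s x)"
    unfolding v_def
    by (rule valuation_decorate[OF s] decorate_0[OF s] val_decorate[OF s]; (rule colours_opp | assumption))+
  have lab: "fst (val v x) = (if fst (colour_at D x) = i \<and> \<not> val s x then n else fst (colour_at D x))" if "x \<in> points D" for x
    using v(3)[OF that] by (cases "colour_at D x") simp
  have lt: "fst (colour_at D x) \<in> {1..ncomp D}" if "x \<in> points D" for x
    unfolding labels_eq[symmetric] using that by (rule imageI)
  have s_ends: "val s (out_end D c \<kappa>)" "\<not> val s (out_end D c (\<not> \<kappa>))" "val s (in_end D c (\<not> \<kappa>))" "\<not> val s (in_end D c \<kappa>)"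
    using sep separates_in_end[OF sep self] by (auto simp: separates_def)
  have lc: "fst (colour_at D (BL D c)) = i" "fst (colour_at D (BR D c)) = i"
    using strand_label_eq[of b] strand_label_eq[of "\<not> b"] self_label[OF self, of b \<kappa>] self_label[OF self, of "\<not> b" \<kappa>]
    by (simp_all add: i_def)
  have j: "joined opp D c (\<not> parallel D c) v"
    using s_ends lc unfolding joined_def
    by (cases "colour_at D (BL D c)"; cases "colour_at D (BR D c)"; cases "b = \<kappa>"; cases "snd (colour_at D (BL D c))"; cases "snd (colour_at D (BR D c))")
      (auto simp: v(3) ends_points end_colours out_end_def in_end_def rising parallel_def opp_def)
  have "vl_diagram (smoothing D c (\<not> parallel D c) v)"
  proof (rule vl_smoothing(1)[OF v(1,2) j])
    show "(\<lambda>x. fst (val v x)) ` points D = {1..n}"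
    proof (intro equalityI subsetI)
      fix l assume "l \<in> (\<lambda>x. fst (val v x)) ` points D"
      then show "l \<in> {1..n}" using lab lt by (fastforce simp: n_def)
    next
      fix l assume l: "l \<in> {1..n}"
      show "l \<in> (\<lambda>x. fst (val v x)) ` points D"
      proof (cases "l = n \<or> l = i")
        case True
        \<comment> \<open>Both labels occur: \<open>i\<close> at the outgoing end of the kept arc,
          \<open>n\<close> at the outgoing end of the reversed one.\<close>
        then show ?thesis
          using lab[OF ends_points(6), of \<kappa>] lab[OF ends_points(6), of "\<not> \<kappa>"] s_ends self_label[OF self, of "\<not> \<kappa>" \<kappa>]
            ends_points(6)[of \<kappa>] ends_points(6)[of "\<not> \<kappa>"] unfolding label_out_end i_def
          by (metis (mono_tags, lifting) image_eqI)
      next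
        case False
        then have "l \<in> (\<lambda>x. fst (colour_at D x)) ` points D" using l by (auto simp: labels_eq n_def)
        then show ?thesis using False lab by (auto intro!: image_eqI)
      qed
    qed
    fix g :: "nat \<Rightarrow> bool list" and x y
    assume g: "valuation id {c} D g" "g 0 = []" "joined id D c (\<not> parallel D c) g"
      and xy: "x \<in> points D" "y \<in> points D" "fst (val v x) = fst (val v y)"
    obtain s' where s': "separates (\<not> \<kappa>) s'" "\<forall>x\<in>points D. val s' x \<longleftrightarrow> \<not> val s x"
      using separates_not[OF sep] by blast
    have z: "val g z = val g (out_end D c (val s z = \<kappa>))" if "z \<in> points D" "fst (colour_at D z) = i" for z
      using separates_constant(2)[OF sep self g(1,2) that(1)] that
        separates_constant(2)[OF s'(1) self g(1,2) that(1)] s'(2) self_label[OF self, of "\<not> \<kappa>" \<kappa>]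
      by (cases "val s z"; cases \<kappa>) (auto simp: i_def)
    show "val g x = val g y"
    proof (cases "fst (colour_at D x) = i")
      case False
      then have "fst (colour_at D y) = fst (colour_at D x)"
        using lab xy lt[OF xy(1)] by (auto simp: n_def split: if_splits)
      then show ?thesis
        using self_other_constant[OF self g(1,2) xy(1,2)] False by (simp add: i_def)
    next
      case True
      then have "fst (colour_at D y) = i \<and> val s x = val s y"
        using lab xy lt[OF xy(2)] lt[OF xy(1)] by (auto simp: n_def split: if_splits)
      then show ?thesis using z[of x] z[of y] True xy(1,2) by simp
    qed
  qed
  then show "vl_diagram (smooth2 \<kappa> D c)"
    using smooth2_eq[OF sep self] by (simp add: v_def i_def n_def)
  show "joined opp D c (\<not> parallel D c) (decorate D (colour2 (ncomp D + 1) (strand_label D c \<kappa>)) s)"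
    using j by (simp add: v_def i_def n_def)
qed

text \<open>By \<open>mixed_uncut\<close> the cut has no effect on Boolean valuations, so each of
  the two components still has one value; joining the ends equates the two values.\<close>

lemma vl_smooth3:
  assumes s: "valuation id {c} D s" "s 0 = []" and mixed: "strand_label D c True \<noteq> strand_label D c False"
  shows "vl_diagram (smooth3 \<kappa> D c)"
    and "joined opp D c (parallel D c) (decorate D (colour3 (strand_label D c \<kappa>) (strand_label D c (\<not> \<kappa>))) s)"
proof -
  define i where "i = strand_label D c \<kappa>"
  define j where "j = strand_label D c (\<not> \<kappa>)"
  define lf where "lf l = (if l = i \<or> l = j then min i j else if l > max i j then l - 1 else l)" for l
  have ij: "i \<noteq> j" "i \<in> {1..ncomp D}" "j \<in> {1..ncomp D}"
    using mixed label_pos[of \<kappa>] label_pos[of "\<not> \<kappa>"] by (cases \<kappa>; auto simp: i_def j_def)+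
  define v where "v = decorate D (colour3 i j) s"
  have v: "valuation opp {c} D v" "v 0 = []" "\<And>x. x \<in> points D \<Longrightarrow> val v x = colour3 i j (colour_at D x, val s x)"
    unfolding v_def
    by (rule valuation_decorate[OF s] decorate_0[OF s] val_decorate[OF s]; (rule colours_opp | assumption))+
  have lab: "fst (val v x) = lf (fst (colour_at D x))" if "x \<in> points D" for x
    using v(3)[OF that] by (cases "colour_at D x") (simp add: lf_def)
  \<comment> \<open>Relabelling identifies nothing but \<open>i\<close> and \<open>j\<close>, since
    lowering the labels above the maximum only fills the gap left by it.\<close>
  have lf_eq: "l = l' \<or> l \<in> {i, j} \<and> l' \<in> {i, j}" if "lf l = lf l'" for l l'
    using that ij by (auto simp: lf_def min_def max_def split: if_splits)
  have lc: "fst (colour_at D (BL D c)) = (if b = \<kappa> then i else j)" "fst (colour_at D (BR D c)) = (if b = \<kappa> then j else i)"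
    using strand_label_eq[of b] strand_label_eq[of "\<not> b"]
    by (cases b; cases \<kappa>; simp add: i_def j_def)+
  have jo: "joined opp D c (parallel D c) v"
    using lc ij unfolding joined_def
    by (cases "colour_at D (BL D c)"; cases "colour_at D (BR D c)"; cases "b = \<kappa>")
      (auto simp: v(3) ends_points end_colours parallel_def opp_def min_def)
  have "vl_diagram (smoothing D c (parallel D c) v)"
  proof (rule vl_smoothing(1)[OF v(1,2) jo])
    have "(\<lambda>x. fst (val v x)) ` points D = lf ` {1..ncomp D}"
      unfolding labels_eq[symmetric] image_image by (rule image_cong[OF refl lab])
    also have "\<dots> = {1..ncomp D - 1}"
    proof (intro equalityI subsetI)
      fix l assume l: "l \<in> {1..ncomp D - 1}"
      show "l \<in> lf ` {1..ncomp D}"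
      proof (cases "l < max i j")
        case True
        then show ?thesis
          using l by (intro image_eqI[of _ _ l]) (auto simp: lf_def min_def max_def split: if_splits)
      next
        case False
        then show ?thesis
          using l ij by (intro image_eqI[of _ _ "l + 1"]) (auto simp: lf_def min_def max_def split: if_splits)
      qed
    qed (use ij in \<open>auto simp: lf_def min_def max_def split: if_splits\<close>)
    finally show "(\<lambda>x. fst (val v x)) ` points D = {1..ncomp D - 1}" .
    fix g :: "nat \<Rightarrow> bool list" and x y
    assume g: "valuation id {c} D g" "g 0 = []" "joined id D c (parallel D c) g"
      and xy: "x \<in> points D" "y \<in> points D" "fst (val v x) = fst (val v y)"
    have g': "valuation id {} D g"
      using mixed_uncut[OF mixed g(1,2)] .
    have in_out: "val g (in_end D c ov) = val g (out_end D c ov)" for ov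
      using label_const[OF g' g(2) ends_points(5,6)] by (simp add: label_in_end label_out_end)
    have "val g (out_end D c \<kappa>) = val g (out_end D c (\<not> \<kappa>))"
      using g(3) in_out[of \<kappa>] in_out[of "\<not> \<kappa>"]
      by (cases "b = \<kappa>"; cases "snd (colour_at D (BL D c))"; cases "snd (colour_at D (BR D c))")
        (auto simp: joined_def out_end_def in_end_def rising parallel_def)
    then have *: "val g z = val g (out_end D c \<kappa>)" if "z \<in> points D" "fst (colour_at D z) \<in> {i, j}" for z
      using label_const[OF g' g(2) that(1) ends_points(6)] that(2) by (auto simp: label_out_end i_def j_def)
    show "val g x = val g y"
      using lf_eq[of "fst (colour_at D x)" "fst (colour_at D y)"] lab xy *[of x] *[of y]
        label_const[OF g' g(2) xy(1,2)] by auto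
  qed
  then show "vl_diagram (smooth3 \<kappa> D c)"
    using smooth3_eq[OF s] by (simp add: v_def i_def j_def)
  show "joined opp D c (parallel D c) (decorate D (colour3 (strand_label D c \<kappa>) (strand_label D c (\<not> \<kappa>))) s)"
    using jo by (simp add: v_def i_def j_def)
qed

lemma all_False: "valuation id {c} D (\<lambda>k. map (\<lambda>_. False) (level D k))"
  by (rule valuation_const[OF valuation_mono[OF valuation_level(1)[OF D_runs]]]) simp

end

lemma crossings_locale: "vl_diagram D \<Longrightarrow> c \<in> crossings D \<Longrightarrow> \<exists>p b. diagram_crossing D c p b"
  by (auto simp: crossings_def diagram_crossing_def)

section \<open>Replacement of tangles\<close>

fun blank :: "gen \<Rightarrow> gen" where
  "blank (Cup l d) = Cup 0 True"
| "blank Cap = Cap"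
| "blank (Cross m) = Cross m"

text \<open>Smoothing recolours cups everywhere, hence also inside the tangle replaced by a move.
  The recoloured tangle agrees with the listed one only up to the decorations of its cups.\<close>

definition skeleton :: "diagram \<Rightarrow> diagram" where
  "skeleton T = map (apsnd blank) T"

lemma blank_eq [simp]:
  "blank g = Cup 0 True \<longleftrightarrow> (\<exists>l d. g = Cup l d)" "blank g = Cap \<longleftrightarrow> g = Cap" "blank g = Cross m \<longleftrightarrow> g = Cross m"
  by (cases g; auto)+

lemma skeleton_simps [simp]:
  "skeleton [] = []" "skeleton (x # T) = (fst x, blank (snd x)) # skeleton T" "skeleton (S @ T) = skeleton S @ skeleton T"
  "skeleton U = [] \<longleftrightarrow> U = []"
  by (auto simp: skeleton_def apsnd_def map_prod_def split: prod.split)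

lemma skeleton_eq_Cons [simp]:
  "skeleton U = (p, h) # T \<longleftrightarrow> (\<exists>g U'. U = (p, g) # U' \<and> blank g = h \<and> skeleton U' = T)"
  by (cases U) auto

lemma skeleton_paint [simp]: "skeleton (paint v D) = skeleton D"
proof -
  have "apsnd blank (paint1 x K) = apsnd blank x" for x K
    by (cases x; cases "snd x") auto
  then show ?thesis
    unfolding skeleton_def by (intro nth_equalityI) (simp_all del: apsnd_conv)
qed

lemma shift_simps [simp]: "shift p [] = []" "shift p (x # T) = (p + fst x, snd x) # shift p T"
  "shift p (S @ T) = shift p S @ shift p T" "length (shift p T) = length T" "shift p (shift q T) = shift (p + q) T"
  "shift 0 T = T"
  by (auto simp: shift_def split: prod.split)

lemma tangle_rel_shift:
  "tangle_rel \<tau> (shift (length A) T) (A @ L) M \<longleftrightarrow> (\<exists>M'. M = A @ M' \<and> tangle_rel \<tau> T L M')"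
proof (induction T arbitrary: L)
  case (Cons x T)
  show ?case
    using Cons.IH by (cases x) (auto simp: layer_rel_shift; blast)
qed auto

lemma paint1_shift: "paint1 (length A + i, g) (A @ K) = (length A + i, g) \<longleftrightarrow> paint1 (i, g) K = (i, g)"
  by (cases g) (auto simp: nth_append)

lemma runs_shift:
  "runs (shift (length A) T) (A @ L) M \<longleftrightarrow> (\<exists>M'. M = A @ M' \<and> runs T L M')"
proof (induction T arbitrary: L)
  case (Cons x T)
  show ?case
    using Cons.IH by (cases x) (auto simp: layer_rel_shift paint1_shift; blast)
qed auto

lemma runs_valuation:
  assumes "runs T L M"
  shows "\<exists>w. valuation opp {} T w \<and> w 0 = L \<and> w (length T) = M \<and> paint w T = T"
  using assms
proof (induction T arbitrary: L)
  case Nil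
  then show ?case by (auto simp: paint_def)
next
  case (Cons x T)
  then obtain K where K: "layer_rel opp False x L K" "paint1 x K = x" "runs T K M"
    by auto
  obtain w where "valuation opp {} T w" "w 0 = K" "w (length T) = M" "paint w T = T"
    using Cons.IH[OF K(3)] by auto
  then show ?case
    using K paint_append[of "case_nat L w" "[x]" T]
    by (intro exI[of _ "case_nat L w"]) (auto simp: valuation_Cons paint_def[of _ "[x]"])
qed

text \<open>Excludes closed circles inside the tangle. The values are pairs of a label and a Boolean
  value, so that labels and their connectivity are controlled together from the boundary.\<close>

definition interior :: "diagram \<Rightarrow> bool" where
  "interior T \<longleftrightarrow> (\<forall>k\<le>length T. \<forall>K L M. tangle_rel id (take k T) L K \<longrightarrow> tangle_rel id (drop k T) K M \<longrightarrow>
     set K \<subseteq> set L \<union> (set M :: (nat \<times> bool) set))"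

lemma shift_take: "take k (shift p T) = shift p (take k T)" "drop k (shift p T) = shift p (drop k T)"
  by (simp_all add: shift_def take_map drop_map)

lemma tangle_rel_length_shift:
  "tangle_rel \<tau> (shift p T) L M \<Longrightarrow> T \<noteq> [] \<Longrightarrow> p \<le> length L"
  by (cases T) (auto dest: layer_rel_length(2))

lemma interior_shift:
  assumes "interior T"
  shows "interior (shift p T)"
  unfolding interior_def
proof (intro allI impI)
  fix k K L M
  assume k: "k \<le> length (shift p T)" and r: "tangle_rel id (take k (shift p T)) L K" "tangle_rel id (drop k (shift p T)) K (M :: (nat \<times> bool) list)"
  show "set K \<subseteq> set L \<union> set M"
  proof (cases "p \<le> length L \<and> T \<noteq> []")
    case True
    then obtain A L' where L: "L = A @ L'" "length A = p"
      by (metis append_take_drop_id length_take min_absorb2)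
    obtain K' where K: "K = A @ K'" "tangle_rel id (take k T) L' K'"
      using r(1) L tangle_rel_shift[of id A "take k T" L' K] by (auto simp: shift_take)
    obtain M' where M: "M = A @ M'" "tangle_rel id (drop k T) K' M'"
      using r(2) L K tangle_rel_shift[of id A "drop k T" K' M] by (auto simp: shift_take)
    then show ?thesis
      using assms k K L unfolding interior_def by fastforce
  next
    case False
    moreover have "tangle_rel id (shift p T) L M"
      using r by (metis append_take_drop_id tangle_rel_append)
    ultimately have "T = []"
      using tangle_rel_length_shift by blast
    then show ?thesis using r by auto
  qed
qed

lemma interiorD:
  fixes w :: "nat \<Rightarrow> (nat \<times> bool) list"
  assumes "interior T" "valuation id {} T w" "k \<le> length T"
  shows "set (w k) \<subseteq> set (w 0) \<union> set (w (length T))"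
proof -
  have "valuation id {} (take k T) w" "valuation id {} (drop k T) (\<lambda>j. w (k + j))"
    using assms(2,3) valuation_append[of id "{}" "take k T" "drop k T" w] by (auto simp: min_absorb2)
  from this[THEN tangle_relI] show ?thesis
    using assms(1,3) unfolding interior_def by (auto simp: min_absorb2)
qed

lemma interior_cells:
  fixes w :: "nat \<Rightarrow> colour list" and g :: "nat \<Rightarrow> bool list"
  assumes "interior T" "valuation opp {} T w" "valuation id {} T g" "length (g 0) = length (w 0)" "k \<le> length T"
    "((l, d), b) \<in> set (zip (w k) (g k))"
  shows "\<exists>d'. ((l, d'), b) \<in> set (zip (w 0) (g 0)) \<union> set (zip (w (length T)) (g (length T)))"
proof -
  have "valuation (map_prod opp id) {} T (\<lambda>k. zip (w k) (g k))"
    using assms by (intro valuation_zip) auto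
  then have "valuation id {} T (\<lambda>k. map (\<lambda>(a, b). (fst a, b)) (zip (w k) (g k)))"
    by (rule valuation_map) auto
  from interiorD[OF assms(1) this assms(5)]
  have "(\<lambda>(a, b). (fst a, b)) ` set (zip (w k) (g k)) \<subseteq>
    (\<lambda>(a, b). (fst a, b)) ` (set (zip (w 0) (g 0)) \<union> set (zip (w (length T)) (g (length T))))"
    by (simp add: image_Un)
  moreover have "(l, b) \<in> (\<lambda>(a, b). (fst a, b)) ` set (zip (w k) (g k))"
    using assms(6) by (force intro: image_eqI[rotated])
  ultimately show ?thesis
    by fastforce
qed

text \<open>A Boolean valuation distinguishing two strands with one label in the new diagram would
  transfer to the old one. Since no component is contained in either tangle, the set of labels is
  the one seen outside.\<close>

lemma vl_replace:
  assumes vl: "vl_diagram (P @ T @ Q)" and r: "runs P [] L" "runs T L M" "runs T' L M"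
    and transfer: "\<And>K N :: bool list. tangle_rel id T' K N \<Longrightarrow> length K = length L \<Longrightarrow> tangle_rel id T K N"
    and int: "interior T" "interior T'"
  shows "vl_diagram (P @ T' @ Q) \<and> ncomp (P @ T' @ Q) = ncomp (P @ T @ Q)"
proof -
  let ?D = "P @ T @ Q"
  have D: "runs ?D [] []" using vl by (rule vl_runs)
  note v = valuation_level[OF D]
  obtain w where w: "valuation opp {} T' w" "w 0 = L" "w (length T') = M" "paint w T' = T'"
    using runs_valuation[OF r(3)] by blast
  have vP: "level ?D (length P) = L"
    using runs_level[OF r(1)] by (simp add: level_append1)
  have "runs (P @ T) [] M"
    using r by (auto simp: runs_append)
  from runs_level[OF this] have vT: "level ?D (length P + length T) = M"
    using level_append1[of "length (P @ T)" "P @ T" Q] by simp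
  have p: "paint (level ?D) P = P" "paint (\<lambda>k. level ?D (length P + length T + k)) Q = Q"
    using v(2) by (simp_all add: paint_append add.assoc)
  have len: "length (g k) = length (level ?D k)" if "valuation id {} ?D g" "g 0 = []" "k \<le> length ?D" for g :: "nat \<Rightarrow> bool list" and k
    using valuation_shape[OF D that] .
  \<comment> \<open>No label lives only inside \<open>T\<close>.\<close>
  have lT: "fst ` (\<Union>k\<le>length T. set (level ?D (length P + k))) \<subseteq> fst ` (set L \<union> set M)"
  proof
    fix l assume "l \<in> fst ` (\<Union>k\<le>length T. set (level ?D (length P + k)))"
    then obtain k d where k: "k \<le> length T" "(l, d) \<in> set (level ?D (length P + k))" by auto
    have val: "valuation opp {} T (\<lambda>k. level ?D (length P + k))"
      using v(1) by (simp add: valuation_append)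
    have "((l, d), False) \<in> set (zip (level ?D (length P + k)) (map (\<lambda>_. False) (level ?D (length P + k))))"
      using k by (simp add: set_zip_const)
    from interior_cells[OF int(1) val valuation_const[OF val, of False] _ k(1) this]
    show "l \<in> fst ` (set L \<union> set M)"
      using vP vT by (force simp: set_zip_const image_iff)
  qed
  have labels: "fst ` ((\<Union>k\<le>length P. set (level ?D k)) \<union> (\<Union>k\<le>length Q. set (level ?D (length P + length T + k)))) =
      {1..ncomp ?D}" (is "?outer = _")
  proof
    have "(\<Union>k\<le>length P. set (level ?D k)) \<union> (\<Union>k\<le>length Q. set (level ?D (length P + length T + k))) \<subseteq>
        (\<Union>k\<le>length ?D. set (level ?D k))"
      by (intro Un_least UN_least UN_upper[where B = "\<lambda>k. set (level ?D k)"]) auto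
    moreover have "fst ` (\<Union>k\<le>length ?D. set (level ?D k)) = {1..ncomp ?D}"
      using vl unfolding vl_diagram_iff labels_iff by blast
    ultimately show "?outer \<subseteq> {1..ncomp ?D}"
      by (metis image_mono)
    show "{1..ncomp ?D} \<subseteq> ?outer"
    proof
      fix l assume "l \<in> {1..ncomp ?D}"
      then have "l \<in> fst ` (\<Union>k\<le>length ?D. set (level ?D k))"
        using vl unfolding vl_diagram_iff labels_iff by simp
      then obtain k where k: "k \<le> length ?D" "l \<in> fst ` set (level ?D k)" by blast
      consider "k \<le> length P" | j where "k = length P + j" "j \<le> length T" | j where "k = length P + length T + j"
        by (metis le_Suc_ex nat_le_linear add.assoc)
      then show "l \<in> ?outer"
      proof cases
        case 2
        have "l \<in> (\<Union>k\<le>length T. fst ` set (level ?D (length P + k)))"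
          by (rule UN_I[of j]) (use 2 k(2) in auto)
        then have "l \<in> fst ` (set L \<union> set M)"
          using lT unfolding image_UN by (rule rev_subsetD)
        moreover have "set L \<subseteq> (\<Union>k\<le>length P. set (level ?D k))"
          unfolding vP[symmetric] by (rule UN_upper) simp
        moreover have "set M \<subseteq> (\<Union>k\<le>length Q. set (level ?D (length P + length T + k)))"
          using UN_upper[of 0 "{..length Q}" "\<lambda>k. set (level ?D (length P + length T + k))"] vT by simp
        ultimately show ?thesis
          by (meson Un_mono image_mono subsetD)
      next
        case 3
        then have "j \<le> length Q" using k(1) by simp
        then show ?thesis using 3 k(2) by blast
      qed (use k in blast)
    qed
  qed
  have "vl_diagram (paint (level ?D) P @ paint w T' @ paint (\<lambda>k. level ?D (length P + length T + k)) Q) \<and>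
    ncomp (paint (level ?D) P @ paint w T' @ paint (\<lambda>k. level ?D (length P + length T + k)) Q) = ncomp ?D"
  proof (rule vl_diagram_replace[where X = "{}" and C = "\<lambda>_. True"])
    show "\<exists>u. valuation id {} T u \<and> u 0 = K \<and> u (length T) = N \<and> True"
      if "tangle_rel id T' K N" "length K = length (w 0)" for K N :: "bool list"
      using tangle_relE[OF transfer[OF that(1)]] that(2) w(2) by auto
    show "\<exists>d'. ((l, d'), b) \<in> set (zip (w 0) (g 0)) \<union> set (zip (w (length T')) (g (length T')))"
      if "valuation id {} T' g" "length (g 0) = length (w 0)" "k \<le> length T'" "((l, d), b) \<in> set (zip (w k) (g k))"
      for g :: "nat \<Rightarrow> bool list" and k l d b
      using interior_cells[OF int(2) w(1) that] .
    show "label_constant (length ?D) (level ?D) g" if "valuation id ((+) (length P) ` {}) ?D g" "g 0 = []" for g :: "nat \<Rightarrow> bool list"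
      using vl that unfolding vl_diagram_iff by simp
  qed (use v w vP vT labels runs_level[OF D] in simp_all)
  then show ?thesis
    using p w(4) by simp
qed

lemma gen_rel_length: "gen_rel \<tau> X g U V \<Longrightarrow> length U = ins g \<and> length V = outs g"
  by (cases g) auto

section \<open>Interchange of distant generators and elementary moves\<close>

fun matches :: "gen \<Rightarrow> colour list \<Rightarrow> bool" where
  "matches (Cup l d) V \<longleftrightarrow> V ! 0 = (l, d)"
| "matches Cap V \<longleftrightarrow> True"
| "matches (Cross m) V \<longleftrightarrow> True"

lemma paint1_matches: "length A = p \<Longrightarrow> length V = outs g \<Longrightarrow> paint1 (p, g) (A @ V @ B) = (p, g) \<longleftrightarrow> matches g V"
  by (cases g) (auto simp: nth_append prod_eq_iff)

lemma matches_unique: "matches g V \<Longrightarrow> matches h V \<Longrightarrow> blank g = blank h \<Longrightarrow> g = h"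
  by (cases g; cases h) auto

lemma blank_ins_outs: "blank g = blank h \<Longrightarrow> ins g = ins h \<and> outs g = outs h"
  by (cases g; cases h) auto

text \<open>A normal form for two distant generators, \<open>g\<close> on the left and
  \<open>h\<close> on the right, separated by \<open>r\<close> strands. In
  \<open>layer_rel_above\<close>, with the heights exchanged, the same \<open>L\<close> and
  \<open>M\<close> arise and only the middle list \<open>K\<close> differs.\<close>

lemma layer_rel_below:
  "layer_rel \<tau> X (i, g) L K \<and> layer_rel \<tau> Y (i + outs g + r, h) K M \<longleftrightarrow>
    (\<exists>A U V R U' V' B. length A = i \<and> length R = r \<and> L = A @ U @ R @ U' @ B \<and> K = A @ V @ R @ U' @ B \<and>
       M = A @ V @ R @ V' @ B \<and> gen_rel \<tau> X g U V \<and> gen_rel \<tau> Y h U' V')" (is "?l \<longleftrightarrow> ?r")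
proof
  assume ?l
  then obtain A U V B A' U' V' B' where *: "length A = i" "L = A @ U @ B" "K = A @ V @ B" "gen_rel \<tau> X g U V"
    "length A' = i + outs g + r" "K = A' @ U' @ B'" "M = A' @ V' @ B'" "gen_rel \<tau> Y h U' V'"
    by (metis layer_relE)
  have V: "length V = outs g" using gen_rel_length[OF *(4)] by simp
  define R where "R = drop (i + outs g) A'"
  have "A @ V = take (i + outs g) A'"
    using arg_cong[OF *(3), of "take (i + outs g)"] *(1,5,6) V by simp
  then have A': "A' = A @ V @ R" "length R = r"
    using *(5) by (metis R_def append.assoc append_take_drop_id, simp add: R_def)
  then have B: "B = R @ U' @ B'"
    using *(3,6) by simp
  have "L = A @ U @ R @ U' @ B'" "K = A @ V @ R @ U' @ B'" "M = A @ V @ R @ V' @ B'"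
    using * A' B by simp_all
  with *(1,4,8) A'(2) show ?r by blast
next
  assume ?r
  then obtain A U V R U' V' B where *: "length A = i" "length R = r" "L = A @ U @ R @ U' @ B" "K = A @ V @ R @ U' @ B"
    "M = A @ V @ R @ V' @ B" "gen_rel \<tau> X g U V" "gen_rel \<tau> Y h U' V'"
    by blast
  then show ?l
    using layer_relI[of A i \<tau> X g U V "R @ U' @ B"] layer_relI[of "A @ V @ R" "i + outs g + r" \<tau> Y h U' V' B]
      gen_rel_length[OF *(6)] by simp
qed

lemma layer_rel_above:
  "layer_rel \<tau> Y (i + ins g + r, h) L K \<and> layer_rel \<tau> X (i, g) K M \<longleftrightarrow>
    (\<exists>A U V R U' V' B. length A = i \<and> length R = r \<and> L = A @ U @ R @ U' @ B \<and> K = A @ U @ R @ V' @ B \<and>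
       M = A @ V @ R @ V' @ B \<and> gen_rel \<tau> X g U V \<and> gen_rel \<tau> Y h U' V')" (is "?l \<longleftrightarrow> ?r")
proof
  assume ?l
  then obtain A U V B A' U' V' B' where *: "length A = i" "K = A @ U @ B" "M = A @ V @ B" "gen_rel \<tau> X g U V"
    "length A' = i + ins g + r" "L = A' @ U' @ B'" "K = A' @ V' @ B'" "gen_rel \<tau> Y h U' V'"
    by (metis layer_relE)
  have U: "length U = ins g" using gen_rel_length[OF *(4)] by simp
  define R where "R = drop (i + ins g) A'"
  have "A @ U = take (i + ins g) A'"
    using arg_cong[OF *(2), of "take (i + ins g)"] *(1,5,7) U by simp
  then have A': "A' = A @ U @ R" "length R = r"
    using *(5) by (metis R_def append.assoc append_take_drop_id, simp add: R_def)
  then have B: "B = R @ V' @ B'"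
    using *(2,7) by simp
  have "L = A @ U @ R @ U' @ B'" "K = A @ U @ R @ V' @ B'" "M = A @ V @ R @ V' @ B'"
    using * A' B by simp_all
  with *(1,4,8) A'(2) show ?r by blast
next
  assume ?r
  then obtain A U V R U' V' B where *: "length A = i" "length R = r" "L = A @ U @ R @ U' @ B" "K = A @ U @ R @ V' @ B"
    "M = A @ V @ R @ V' @ B" "gen_rel \<tau> X g U V" "gen_rel \<tau> Y h U' V'"
    by blast
  then show ?l
    using layer_relI[of A i \<tau> X g U V "R @ V' @ B"] layer_relI[of "A @ U @ R" "i + ins g + r" \<tau> Y h U' V' B]
      gen_rel_length[OF *(6)] by simp
qed

lemma runs_below:
  "runs [(i, g), (i + outs g + r, h)] L M \<longleftrightarrow>
    (\<exists>A U V R U' V' B. length A = i \<and> length R = r \<and> L = A @ U @ R @ U' @ B \<and>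
       M = A @ V @ R @ V' @ B \<and> gen_rel opp False g U V \<and> gen_rel opp False h U' V' \<and> matches g V \<and> matches h V')" (is "?l \<longleftrightarrow> ?r")
proof -
  have "?l \<longleftrightarrow> (\<exists>K. (layer_rel opp False (i, g) L K \<and> layer_rel opp False (i + outs g + r, h) K M) \<and>
      paint1 (i, g) K = (i, g) \<and> paint1 (i + outs g + r, h) M = (i + outs g + r, h))"
    by auto
  also have "\<dots> \<longleftrightarrow> ?r"
    unfolding layer_rel_below
  proof (intro iffI; elim exE conjE)
    fix K A U V R U' V' B
    assume *: "length A = i" "length R = r" "L = A @ U @ R @ U' @ B" "K = A @ V @ R @ U' @ B" "M = A @ V @ R @ V' @ B"
      "gen_rel opp False g U V" "gen_rel opp False h U' V'"
      "paint1 (i, g) K = (i, g)" "paint1 (i + outs g + r, h) M = (i + outs g + r, h)"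
    have "matches g V" "matches h V'"
      using * gen_rel_length[OF *(6)] gen_rel_length[OF *(7)] paint1_matches[of A i V g "R @ U' @ B"]
        paint1_matches[of "A @ V @ R" "i + outs g + r" V' h B] by simp_all
    with * show ?r by blast
  next
    fix A U V R U' V' B
    assume *: "length A = i" "length R = r" "L = A @ U @ R @ U' @ B" "M = A @ V @ R @ V' @ B"
      "gen_rel opp False g U V" "gen_rel opp False h U' V'" "matches g V" "matches h V'"
    have "paint1 (i, g) (A @ V @ R @ U' @ B) = (i, g)" "paint1 (i + outs g + r, h) M = (i + outs g + r, h)"
      using * gen_rel_length[OF *(5)] gen_rel_length[OF *(6)] paint1_matches[of A i V g "R @ U' @ B"]
        paint1_matches[of "A @ V @ R" "i + outs g + r" V' h B] by simp_all
    with * show "\<exists>K. (\<exists>A U V R U' V' B. length A = i \<and> length R = r \<and> L = A @ U @ R @ U' @ B \<and> K = A @ V @ R @ U' @ B \<and>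
       M = A @ V @ R @ V' @ B \<and> gen_rel opp False g U V \<and> gen_rel opp False h U' V') \<and>
      paint1 (i, g) K = (i, g) \<and> paint1 (i + outs g + r, h) M = (i + outs g + r, h)"
      by blast
  qed
  finally show ?thesis .
qed

lemma runs_above:
  "runs [(i + ins g + r, h), (i, g)] L M \<longleftrightarrow>
    (\<exists>A U V R U' V' B. length A = i \<and> length R = r \<and> L = A @ U @ R @ U' @ B \<and>
       M = A @ V @ R @ V' @ B \<and> gen_rel opp False g U V \<and> gen_rel opp False h U' V' \<and> matches g V \<and> matches h V')" (is "?l \<longleftrightarrow> ?r")
proof -
  have "?l \<longleftrightarrow> (\<exists>K. (layer_rel opp False (i + ins g + r, h) L K \<and> layer_rel opp False (i, g) K M) \<and>
      paint1 (i + ins g + r, h) K = (i + ins g + r, h) \<and> paint1 (i, g) M = (i, g))"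
    by auto
  also have "\<dots> \<longleftrightarrow> ?r"
    unfolding layer_rel_above
  proof (intro iffI; elim exE conjE)
    fix K A U V R U' V' B
    assume *: "length A = i" "length R = r" "L = A @ U @ R @ U' @ B" "K = A @ U @ R @ V' @ B" "M = A @ V @ R @ V' @ B"
      "gen_rel opp False g U V" "gen_rel opp False h U' V'"
      "paint1 (i + ins g + r, h) K = (i + ins g + r, h)" "paint1 (i, g) M = (i, g)"
    have "matches g V" "matches h V'"
      using * gen_rel_length[OF *(6)] gen_rel_length[OF *(7)] paint1_matches[of A i V g "R @ V' @ B"]
        paint1_matches[of "A @ U @ R" "i + ins g + r" V' h B] by simp_all
    with * show ?r by blast
  next
    fix A U V R U' V' B
    assume *: "length A = i" "length R = r" "L = A @ U @ R @ U' @ B" "M = A @ V @ R @ V' @ B"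
      "gen_rel opp False g U V" "gen_rel opp False h U' V'" "matches g V" "matches h V'"
    have "paint1 (i + ins g + r, h) (A @ U @ R @ V' @ B) = (i + ins g + r, h)" "paint1 (i, g) M = (i, g)"
      using * gen_rel_length[OF *(5)] gen_rel_length[OF *(6)] paint1_matches[of A i V g "R @ V' @ B"]
        paint1_matches[of "A @ U @ R" "i + ins g + r" V' h B] by simp_all
    with * show "\<exists>K. (\<exists>A U V R U' V' B. length A = i \<and> length R = r \<and> L = A @ U @ R @ U' @ B \<and> K = A @ U @ R @ V' @ B \<and>
       M = A @ V @ R @ V' @ B \<and> gen_rel opp False g U V \<and> gen_rel opp False h U' V') \<and>
      paint1 (i + ins g + r, h) K = (i + ins g + r, h) \<and> paint1 (i, g) M = (i, g)"
      by blast
  qed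
  finally show ?thesis .
qed

lemma elementary_transfer:
  assumes "elementary k t t' J" "tangle_rel id t L M"
  shows "tangle_rel id t' L M"
  using assms
proof cases
  case (interchange i g r h)
  then obtain K where "layer_rel id False (i, g) L K \<and> layer_rel id False (i + outs g + r, h) K M"
    using assms(2) by auto
  then have "\<exists>K. layer_rel id False (i + ins g + r, h) L K \<and> layer_rel id False (i, g) K M"
    unfolding layer_rel_below layer_rel_above by blast
  with interchange show ?thesis by simp
qed (use assms(2) in auto)

text \<open>In this direction enough strands must be present: the empty side of a zigzag or of RII
  relates lists of any length to themselves, the other side does not. The run from \<open>L0\<close>
  to \<open>M0\<close> supplies the required length.\<close>

lemma elementary_transfer':
  assumes "elementary k t t' J" "tangle_rel id t' L M" "tangle_rel \<tau> t L0 M0" "length L0 = length L"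
  shows "tangle_rel id t L M"
  using assms
proof cases
  case (interchange i g r h)
  then obtain K where "layer_rel id False (i + ins g + r, h) L K \<and> layer_rel id False (i, g) K M"
    using assms(2) by auto
  then have "\<exists>K. layer_rel id False (i, g) L K \<and> layer_rel id False (i + outs g + r, h) K M"
    unfolding layer_rel_below layer_rel_above by blast
  with interchange show ?thesis by simp
next
  case (zigzag1 l d)
  then obtain y ys where "L = y # ys" "M = y # ys"
    using assms(2-4) by (auto simp: Suc_length_conv)
  then have "layer_rel id False (1, Cup l d) L (y # y # y # ys)" "layer_rel id False (0, Cap) (y # y # y # ys) M"
    by simp_all
  then show ?thesis
    unfolding zigzag1 tangle_rel.simps by blast
next
  case (zigzag2 l d)
  then obtain y ys where "L = y # ys" "M = y # ys"
    using assms(2-4) by (auto simp: Suc_length_conv)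
  then have "layer_rel id False (0, Cup l d) L (y # y # y # ys)" "layer_rel id False (1, Cap) (y # y # y # ys) M"
    by simp_all
  then show ?thesis
    unfolding zigzag2 tangle_rel.simps by blast
qed (use assms(2-4) in \<open>auto simp: Suc_length_conv length_Suc_conv\<close>)

text \<open>Where both sides of a move contain a cup, its ends reach the top of the tangle, so equal
  colours there force equal decorations. A zigzag may carry any decoration.\<close>

lemma elementary_skeleton:
  assumes "elementary k t t' J" "skeleton u = skeleton t" "skeleton u' = skeleton t'" "runs u L M" "runs u' L M"
  shows "elementary k u u' J"
  using assms(1)
proof cases
  case (interchange i g r h)
  obtain g1 h1 g2 h2 where u: "u = [(i, g1), (i + outs g + r, h1)]" "u' = [(i + ins g + r, h2), (i, g2)]"
    "blank g1 = blank g" "blank g2 = blank g" "blank h1 = blank h" "blank h2 = blank h"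
    using assms(2,3) interchange by auto
  note io = blank_ins_outs[OF u(3)] blank_ins_outs[OF u(4)] blank_ins_outs[OF u(5)] blank_ins_outs[OF u(6)]
  have "runs [(i, g1), (i + outs g1 + r, h1)] L M" "runs [(i + ins g2 + r, h2), (i, g2)] L M"
    using assms(4,5) u io by auto
  then obtain A U V R U' V' B A1 U1 V1 R1 U1' V1' B1 where
    *: "length A = i" "length R = r" "L = A @ U @ R @ U' @ B" "M = A @ V @ R @ V' @ B"
      "gen_rel opp False g1 U V" "gen_rel opp False h1 U' V'" "matches g1 V" "matches h1 V'" and
    **: "length A1 = i" "length R1 = r" "L = A1 @ U1 @ R1 @ U1' @ B1" "M = A1 @ V1 @ R1 @ V1' @ B1"
      "gen_rel opp False g2 U1 V1" "gen_rel opp False h2 U1' V1'" "matches g2 V1" "matches h2 V1'"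
    unfolding runs_below runs_above by blast
  have "V = V1" "V' = V1'"
    using * ** io gen_rel_length[OF *(5)] gen_rel_length[OF *(6)] gen_rel_length[OF **(5)] gen_rel_length[OF **(6)]
    by auto
  then have "g1 = g2" "h1 = h2"
    using matches_unique[OF *(7), of g2] matches_unique[OF *(8), of h2] **(7,8) u by auto
  then show ?thesis
    using elementary.interchange[of i g1 r h1] u interchange io by simp
next
  case (zigzag1 l d)
  then show ?thesis using assms(2,3) by (auto intro: elementary.zigzag1[unfolded One_nat_def])
next
  case (zigzag2 l d)
  then show ?thesis using assms(2,3) by (auto intro: elementary.zigzag2[unfolded One_nat_def])
next
  case (swing_cup l d m)
  then obtain l1 d1 l2 d2 where u: "u = [(0, Cup l1 d1), (1, Cross m)]" "u' = [(1, Cup l2 d2), (0, Cross (swap_slope m))]"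
    using assms(2,3) by auto
  then have "(l1, d1) = (l2, d2)"
    using assms(4,5) by (auto simp: prod_eq_iff)
  then show ?thesis using swing_cup u elementary.swing_cup by simp
qed (use assms(1-3) in auto)

lemma interior_2: "interior [x, y] \<longleftrightarrow>
   (\<forall>L K M. layer_rel id False x L K \<longrightarrow> layer_rel id False y K M \<longrightarrow> set K \<subseteq> set L \<union> (set M :: (nat \<times> bool) set))" (is "?l \<longleftrightarrow> ?r")
proof
  assume ?l
  then have "tangle_rel id (take 1 [x, y]) L K \<Longrightarrow> tangle_rel id (drop 1 [x, y]) K M \<Longrightarrow> set K \<subseteq> set L \<union> set M"
    for L K and M :: "(nat \<times> bool) list"
    unfolding interior_def by (metis One_nat_def le_add1 length_Cons plus_1_eq_Suc)
  then show ?r by simp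
next
  assume r: ?r
  show ?l unfolding interior_def
  proof (intro allI impI)
    fix k and K L M :: "(nat \<times> bool) list"
    assume k: "k \<le> length [x, y]" "tangle_rel id (take k [x, y]) L K" "tangle_rel id (drop k [x, y]) K M"
    then consider "k = 0" | "k = 1" | "k = 2" by fastforce
    then show "set K \<subseteq> set L \<union> set M"
    proof cases
      case 2
      then have "layer_rel id False x L K" "layer_rel id False y K M" using k by simp_all
      with r show ?thesis by blast
    qed (use k in auto)
  qed
qed

lemma interior_3:
  assumes "\<And>L K N M. layer_rel id False x L K \<Longrightarrow> layer_rel id False y K N \<Longrightarrow> layer_rel id False z N M \<Longrightarrow>
     set K \<subseteq> set L \<union> (set M :: (nat \<times> bool) set) \<and> set N \<subseteq> set L \<union> set M"
  shows "interior [x, y, z]"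
  unfolding interior_def
proof (intro allI impI)
  fix k and K L M :: "(nat \<times> bool) list"
  assume "k \<le> length [x, y, z]" "tangle_rel id (take k [x, y, z]) L K" "tangle_rel id (drop k [x, y, z]) K M"
  moreover have "k = 0 \<or> k = 1 \<or> k = 2 \<or> k = 3" using \<open>k \<le> length [x, y, z]\<close> by auto
  ultimately show "set K \<subseteq> set L \<union> set M" using assms by (fastforce simp: numeral_eq_Suc)
qed

lemma interior_01: "interior []" "interior [x]"
  by (auto simp: interior_def le_Suc_eq)

lemma interior_elementary:
  assumes "elementary k t t' J"
  shows "interior t" "interior t'"
proof -
  have "interior t \<and> interior t'"
    using assms
  proof cases
    case (interchange i g r h)
    have "set K \<subseteq> set L \<union> set M"
      if "layer_rel id False (i, g) L K" "layer_rel id False (i + outs g + r, h) K M" for L K and M :: "(nat \<times> bool) list"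
      using conjI[OF that] unfolding layer_rel_below by auto
    moreover have "set K \<subseteq> set L \<union> set M"
      if "layer_rel id False (i + ins g + r, h) L K" "layer_rel id False (i, g) K M" for L K and M :: "(nat \<times> bool) list"
      using conjI[OF that] unfolding layer_rel_above by auto
    ultimately show ?thesis
      unfolding interchange interior_2 by blast
  qed (auto simp: interior_2 interior_01 intro!: interior_3)
  then show "interior t" "interior t'" by auto
qed

section \<open>Flat tangles\<close>

text \<open>From here on the simplifier evaluates segments by \<open>act\<close>, which computes the
  colours in concrete words; the relational equation is restored locally where it is wanted.\<close>

lemma runs_act: "runs (x # T) L M \<longleftrightarrow> fits x L \<and> runs T (act x L) M"
proof -
  have "runs (x # T) L M \<longleftrightarrow> (\<exists>K. (fits x L \<and> K = act x L) \<and> runs T K M)"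
    by (simp add: fits_act_iff)
  then show ?thesis by auto
qed

declare runs.simps(2) [simp del] runs_act [simp]

text \<open>Validity is assumed for one of the two diagrams only; that of the other is part of the
  conclusion through \<open>flat_equiv\<close>. This makes the relation transitive without further
  assumptions on the intermediate words.\<close>

definition flat_at :: "colour list \<Rightarrow> diagram \<Rightarrow> diagram \<Rightarrow> bool" where
  "flat_at L T T' \<longleftrightarrow> (\<forall>P Q. runs P [] L \<longrightarrow> vl_diagram (P @ T @ Q) \<or> vl_diagram (P @ T' @ Q) \<longrightarrow>
     flat_equiv (P @ T @ Q) (P @ T' @ Q))"

text \<open>Strands to the left are added by shifting. Those to the right belong to
  \<open>L\<close>, for which reason local equivalences are stated with a variable tail
  \<open>R\<close>.\<close>

definition flat_local :: "colour list \<Rightarrow> diagram \<Rightarrow> diagram \<Rightarrow> bool" where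
  "flat_local L T T' \<longleftrightarrow> (\<forall>A. flat_at (A @ L) (shift (length A) T) (shift (length A) T'))"

lemma flat_equiv_refl: "vl_diagram D \<Longrightarrow> flat_equiv D D"
  by (simp add: flat_equiv_def)

lemma flat_equiv_sym: "flat_equiv D D' \<Longrightarrow> flat_equiv D' D"
  by (auto simp: flat_equiv_def intro: equivclp_sym)

lemma flat_equiv_trans: "flat_equiv D D' \<Longrightarrow> flat_equiv D' D'' \<Longrightarrow> flat_equiv D D''"
  by (auto simp: flat_equiv_def intro: equivclp_trans)

lemma flat_equiv_move:
  assumes "moves_to D D'"
  shows "flat_equiv D D'"
proof -
  have "vl_diagram D \<and> vl_diagram D'"
    using assms by (auto simp: moves_to_def move_def)
  with assms show ?thesis
    unfolding flat_equiv_def by (blast intro: r_into_equivclp)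
qed

lemma flat_equiv_crossing_change:
  assumes "crossing_change D D'"
  shows "flat_equiv D D'"
proof -
  have "vl_diagram D \<and> vl_diagram D'"
    using assms by (auto simp: crossing_change_def)
  with assms show ?thesis
    unfolding flat_equiv_def by (blast intro: r_into_equivclp)
qed

lemma flat_local_refl: "flat_local L T T"
  by (auto simp: flat_local_def flat_at_def flat_equiv_refl)

lemma flat_local_sym: "flat_local L T T' \<Longrightarrow> flat_local L T' T"
  unfolding flat_local_def flat_at_def by (blast intro: flat_equiv_sym)

lemma flat_local_trans [trans]: "flat_local L T T' \<Longrightarrow> flat_local L T' T'' \<Longrightarrow> flat_local L T T''"
proof -
  have "flat_equiv D D' \<Longrightarrow> vl_diagram D \<and> vl_diagram D'" for D D'
    by (simp add: flat_equiv_def)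
  then show "flat_local L T T' \<Longrightarrow> flat_local L T' T'' \<Longrightarrow> flat_local L T T''"
    unfolding flat_local_def flat_at_def by (meson flat_equiv_trans)
qed

lemma flat_local_context:
  assumes "flat_local K T T'" "runs S L K"
  shows "flat_local L (S @ T @ R) (S @ T' @ R)"
  unfolding flat_local_def flat_at_def
proof (intro allI impI)
  fix A P Q
  assume P: "runs P [] (A @ L)" and vl: "vl_diagram (P @ shift (length A) (S @ T @ R) @ Q) \<or> vl_diagram (P @ shift (length A) (S @ T' @ R) @ Q)"
  have "runs (P @ shift (length A) S) [] (A @ K)"
    using P assms(2) by (auto simp: runs_append runs_shift)
  then show "flat_equiv (P @ shift (length A) (S @ T @ R) @ Q) (P @ shift (length A) (S @ T' @ R) @ Q)"
    using assms(1) vl unfolding flat_local_def flat_at_def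
    by (metis append.assoc shift_simps(3))
qed

lemma flat_local_offset: "flat_local L T T' \<Longrightarrow> flat_local (x # L) (shift 1 T) (shift 1 T')"
  unfolding flat_local_def
proof
  fix A
  assume "\<forall>A. flat_at (A @ L) (shift (length A) T) (shift (length A) T')"
  from spec[OF this, of "A @ [x]"]
  show "flat_at (A @ x # L) (shift (length A) (shift 1 T)) (shift (length A) (shift 1 T'))"
    by simp
qed

text \<open>By \<open>vl_replace\<close> validity passes from either side to the other, so the
  equivalence has to be shown only when both diagrams are valid.\<close>

lemma flat_local_vl:
  assumes "runs t L M" "runs t' L M" "interior t" "interior t'"
    and "\<And>K N :: bool list. tangle_rel id t' K N \<Longrightarrow> length K = length L \<Longrightarrow> tangle_rel id t K N"
    and "\<And>K N :: bool list. tangle_rel id t K N \<Longrightarrow> length K = length L \<Longrightarrow> tangle_rel id t' K N"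
    and "\<And>A P Q. runs P [] (A @ L) \<Longrightarrow> vl_diagram (P @ shift (length A) t @ Q) \<Longrightarrow> vl_diagram (P @ shift (length A) t' @ Q) \<Longrightarrow>
      flat_equiv (P @ shift (length A) t @ Q) (P @ shift (length A) t' @ Q)"
  shows "flat_local L t t'"
  unfolding flat_local_def flat_at_def
proof (intro allI impI)
  fix A P Q
  assume P: "runs P [] (A @ L)" and vl: "vl_diagram (P @ shift (length A) t @ Q) \<or> vl_diagram (P @ shift (length A) t' @ Q)"
  have tr: "tangle_rel id (shift (length A) T) K N"
    if hyp: "\<And>K N :: bool list. tangle_rel id T' K N \<Longrightarrow> length K = length L \<Longrightarrow> tangle_rel id T K N"
      and hyp': "tangle_rel id (shift (length A) T') K N" "length K = length (A @ L)" for K N :: "bool list" and T T'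
  proof -
    obtain A' K' where K: "K = A' @ K'" "length A' = length A" "length K' = length L"
      using hyp'(2) by (metis append_take_drop_id append_eq_append_conv length_append length_take min_absorb2 le_add1 add_left_cancel)
    then obtain N' where "N = A' @ N'" "tangle_rel id T' K' N'"
      using hyp'(1) tangle_rel_shift[of id A' T' K' N] by auto
    then show ?thesis
      using hyp[of K' N'] K tangle_rel_shift[of id A' T K' N] by auto
  qed
  have t1: "tangle_rel id (shift (length A) t) K N" if "tangle_rel id (shift (length A) t') K N" "length K = length (A @ L)" for K N :: "bool list"
    by (rule tr[of t' t]) (use assms(5) that in auto)
  have t2: "tangle_rel id (shift (length A) t') K N" if "tangle_rel id (shift (length A) t) K N" "length K = length (A @ L)" for K N :: "bool list"
    by (rule tr[of t t']) (use assms(6) that in auto)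
  have r: "runs (shift (length A) t) (A @ L) (A @ M)" "runs (shift (length A) t') (A @ L) (A @ M)"
    using assms(1,2) by (auto simp: runs_shift)
  have "vl_diagram (P @ shift (length A) t @ Q) \<and> vl_diagram (P @ shift (length A) t' @ Q)"
    using vl
  proof
    assume v: "vl_diagram (P @ shift (length A) t @ Q)"
    show ?thesis
      using vl_replace[OF v P r t1 interior_shift[OF assms(3)] interior_shift[OF assms(4)]] v by blast
  next
    assume v: "vl_diagram (P @ shift (length A) t' @ Q)"
    show ?thesis
      using vl_replace[OF v P r(2,1) t2 interior_shift[OF assms(4)] interior_shift[OF assms(3)]] v by auto
  qed
  with P assms(7) show "flat_equiv (P @ shift (length A) t @ Q) (P @ shift (length A) t' @ Q)"
    by blast
qed

lemma flat_local_elementary: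
  assumes "elementary k t t' J" "runs t L M" "runs t' L M"
  shows "flat_local L t t'"
proof (rule flat_local_vl[OF assms(2,3) interior_elementary[OF assms(1)]])
  show "tangle_rel id t K N" if "tangle_rel id t' K N" "length K = length L" for K N :: "bool list"
    using elementary_transfer'[OF assms(1) that(1) runs_tangle_rel[OF assms(2)]] that(2) by simp
  show "tangle_rel id t' K N" if "tangle_rel id t K N" "length K = length L" for K N :: "bool list"
    using elementary_transfer[OF assms(1) that(1)] .
  fix A P Q
  assume "vl_diagram (P @ shift (length A) t @ Q)" "vl_diagram (P @ shift (length A) t' @ Q)"
  then have "moves_to (P @ shift (length A) t @ Q) (P @ shift (length A) t' @ Q)"
    unfolding moves_to_def move_def using assms(1) by blast
  then show "flat_equiv (P @ shift (length A) t @ Q) (P @ shift (length A) t' @ Q)"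
    by (rule flat_equiv_move)
qed

section \<open>Local equivalences up to crossing changes\<close>

definition same_kind :: "mark \<Rightarrow> mark \<Rightarrow> bool" where
  "same_kind m m' \<longleftrightarrow> (m = Virtual \<longleftrightarrow> m' = Virtual)"

lemma same_kind_simps [simp]: "same_kind m m" "same_kind m (swap_slope m') \<longleftrightarrow> same_kind m m'"
  "same_kind (swap_slope m) m' \<longleftrightarrow> same_kind m m'" "same_kind (Classical b) (Classical b')" "same_kind m m' \<Longrightarrow> same_kind m' m"
  by (cases m; cases m'; simp add: same_kind_def)+

lemma swap_slope_swap_slope [simp]: "swap_slope (swap_slope m) = m"
  by (cases m) auto

lemma cross_layer: "layer_rel \<tau> X (i, Cross m) L K \<longleftrightarrow> layer_rel \<tau> X (i, Cross m') L K"
  by (simp add: layer_rel_def)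

lemma flat_local_change:
  assumes "same_kind m m'"
  shows "flat_local L [(i, Cross m)] [(i, Cross m')]"
proof (cases "\<exists>M. runs [(i, Cross m)] L M")
  case True
  then obtain M where M: "runs [(i, Cross m)] L M" "runs [(i, Cross m')] L M"
    by auto
  show ?thesis
  proof (rule flat_local_vl[OF M interior_01(2) interior_01(2)])
    fix A P Q
    assume vl: "vl_diagram (P @ shift (length A) [(i, Cross m)] @ Q)" "vl_diagram (P @ shift (length A) [(i, Cross m')] @ Q)"
    show "flat_equiv (P @ shift (length A) [(i, Cross m)] @ Q) (P @ shift (length A) [(i, Cross m')] @ Q)"
    proof (cases "m = m'")
      case False
      then obtain b where "m = Classical b" "m' = Classical (\<not> b)"
        using assms by (cases m; cases m') (auto simp: same_kind_def)
      then have "crossing_change (P @ shift (length A) [(i, Cross m)] @ Q) (P @ shift (length A) [(i, Cross m')] @ Q)"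
        unfolding crossing_change_def using vl
        by (intro conjI exI[of _ "length P"] exI[of _ "length A + i"] exI[of _ b]) (auto simp: list_update_append)
      then show ?thesis by (rule flat_equiv_crossing_change)
    qed (use vl in \<open>simp add: flat_equiv_refl\<close>)
  qed (simp_all add: cross_layer[of id False i m _ _ m'])
next
  case False
  \<comment> \<open>If the crossing does not fit on \<open>L\<close>, no valid diagram contains it
    in this place and the claim is vacuous.\<close>
  have "\<not> vl_diagram (P @ shift (length A) [(i, Cross m'')] @ Q)" if "runs P [] (A @ L)" for A P Q m''
  proof
    assume "vl_diagram (P @ shift (length A) [(i, Cross m'')] @ Q)"
    from vl_runs[OF this] obtain K M where "runs P [] K" "runs (shift (length A) [(i, Cross m'')]) K M"
      unfolding runs_append by blast
    then have "runs (shift (length A) [(i, Cross m'')]) (A @ L) M"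
      using runs_unique[OF that] by blast
    then obtain M' where "runs [(i, Cross m'')] L M'"
      unfolding runs_shift by blast
    then have "runs [(i, Cross m)] L M'"
      by simp
    with False show False by blast
  qed
  then show ?thesis
    unfolding flat_local_def flat_at_def by blast
qed

lemma flat_swing_cap:
  "flat_local (x # y # opp x # R) [(1, Cross m), (0, Cap)] [(0, Cross (swap_slope m)), (1, Cap)]"
  by (rule flat_local_elementary[OF elementary.swing_cap, of _ _ "y # R"]) auto

lemma flat_swing_cup:
  "flat_local (x # R) [(0, Cup l d), (1, Cross m)] [(1, Cup l d), (0, Cross (swap_slope m))]"
  by (rule flat_local_elementary[OF elementary.swing_cup, of _ _ _ _ "(l, d) # x # (l, \<not> d) # R"]) auto

lemma flat_zigzag1: "flat_local ((l, \<not> d) # R) [(1, Cup l d), (0, Cap)] []"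
  by (rule flat_local_elementary[OF elementary.zigzag1, of _ _ _ "(l, \<not> d) # R"]) auto

lemma flat_zigzag2: "flat_local ((l, d) # R) [(0, Cup l d), (1, Cap)] []"
  by (rule flat_local_elementary[OF elementary.zigzag2, of _ _ _ "(l, d) # R"]) auto

text \<open>A crossing change first gives the upper crossing the mark that RII demands; for virtual
  crossings the move is VRII.\<close>

lemma flat_RII:
  assumes "same_kind m m'"
  shows "flat_local (x # y # R) [(0, Cross m), (0, Cross m')] []"
proof -
  have "flat_local (x # y # R) [(0, Cross m), (0, Cross m')] [(0, Cross m), (0, Cross (swap_slope m))]"
    using flat_local_context[OF flat_local_change[of m' "swap_slope m" "y # x # R" 0], of "[(0, Cross m)]" "x # y # R" "[]"] assms
    by simp
  also have "flat_local (x # y # R) [(0, Cross m), (0, Cross (swap_slope m))] []"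
    by (cases m) (auto intro!: flat_local_elementary[OF elementary.RII, of _ _ "x # y # R"]
      flat_local_elementary[OF elementary.VRII, of _ "x # y # R"])
  finally show ?thesis .
qed

lemma flat_RII_offset: "same_kind m m' \<Longrightarrow> flat_local (z # x # y # R) [(1, Cross m), (1, Cross m')] []"
  using flat_local_offset[OF flat_RII, of m m' z x y R] by simp

lemma flat_RI: "flat_local (x # opp x # R) [(0, Cross (Classical b)), (0, Cap)] [(0, Cap)]"
  by (rule flat_local_elementary[OF elementary.RI, of _ _ R]) auto

text \<open>A strand crossing both legs of a maximum is pulled over it: swinging one of the
  crossings around the maximum creates a bigon, which RII removes. The next three lemmas are the
  mirror images of this one.\<close>

lemma flat_cap_slide1:
  assumes "same_kind m m'"
  shows "flat_local (x # opp x # y # R) [(1, Cross m'), (0, Cross m), (1, Cap)] [(0, Cap)]"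
proof -
  have "flat_local (x # opp x # y # R) [(1, Cross m'), (0, Cross m), (1, Cap)] [(1, Cross m'), (1, Cross (swap_slope m)), (0, Cap)]"
    using flat_local_context[OF flat_local_sym[OF flat_swing_cap[of x y R "swap_slope m"]], of "[(1, Cross m')]" "x # opp x # y # R" "[]"]
    by simp
  also have "flat_local (x # opp x # y # R) [(1, Cross m'), (1, Cross (swap_slope m)), (0, Cap)] [(0, Cap)]"
    using flat_local_context[OF flat_RII_offset[of m' "swap_slope m" x "opp x" y R], of "[]" _ "[(0, Cap)]"] assms
    by simp
  finally show ?thesis .
qed

lemma flat_cap_slide2:
  assumes "same_kind m m'"
  shows "flat_local (y # x # opp x # R) [(0, Cross m), (1, Cross m'), (0, Cap)] [(1, Cap)]"
proof -
  have "flat_local (y # x # opp x # R) [(0, Cross m), (1, Cross m'), (0, Cap)] [(0, Cross m), (0, Cross (swap_slope m')), (1, Cap)]"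
    using flat_local_context[OF flat_swing_cap[of x y R m'], of "[(0, Cross m)]" "y # x # opp x # R" "[]"]
    by simp
  also have "flat_local (y # x # opp x # R) [(0, Cross m), (0, Cross (swap_slope m')), (1, Cap)] [(1, Cap)]"
    using flat_local_context[OF flat_RII[of m "swap_slope m'" y x "opp x # R"], of "[]" _ "[(1, Cap)]"] assms
    by simp
  finally show ?thesis .
qed

lemma flat_cup_slide1:
  assumes "same_kind m m'"
  shows "flat_local (y # R) [(0, Cup l d), (1, Cross m), (0, Cross m')] [(1, Cup l d)]"
proof -
  have "flat_local (y # R) [(0, Cup l d), (1, Cross m), (0, Cross m')] [(1, Cup l d), (0, Cross (swap_slope m)), (0, Cross m')]"
    using flat_local_context[OF flat_swing_cup[of y R l d m], of "[]" _ "[(0, Cross m')]"] by simp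
  also have "flat_local (y # R) [(1, Cup l d), (0, Cross (swap_slope m)), (0, Cross m')] [(1, Cup l d)]"
    using flat_local_context[OF flat_RII[of "swap_slope m" m' y "(l, d)" "(l, \<not> d) # R"], of "[(1, Cup l d)]" "y # R" "[]"] assms
    by simp
  finally show ?thesis .
qed

lemma flat_cup_slide2:
  assumes "same_kind m m'"
  shows "flat_local (y # R) [(1, Cup l d), (0, Cross m), (1, Cross m')] [(0, Cup l d)]"
proof -
  have "flat_local (y # R) [(1, Cup l d), (0, Cross m), (1, Cross m')] [(0, Cup l d), (1, Cross (swap_slope m)), (1, Cross m')]"
    using flat_local_context[OF flat_local_sym[OF flat_swing_cup[of y R l d "swap_slope m"]], of "[]" _ "[(1, Cross m')]"] by simp
  also have "flat_local (y # R) [(0, Cup l d), (1, Cross (swap_slope m)), (1, Cross m')] [(0, Cup l d)]"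
    using flat_local_context[OF flat_RII_offset[of "swap_slope m" m' "(l, d)" "(l, \<not> d)" y R], of "[(0, Cup l d)]" "y # R" "[]"] assms
    by simp
  finally show ?thesis .
qed

lemma flat_interchange:
  assumes "runs [(i, g), (i + outs g + r, h)] L M" "runs [(i + ins g + r, h), (i, g)] L M"
  shows "flat_local L [(i, g), (i + outs g + r, h)] [(i + ins g + r, h), (i, g)]"
  using flat_local_elementary[OF elementary.interchange assms] .

text \<open>The mirror image of the move RI, obtained by turning the loop around with two zigzags.\<close>
lemma flat_RI_cup: "flat_local R [(0, Cup l d), (0, Cross (Classical b))] [(0, Cup l (\<not> d))]"
proof -
  let ?X = "Cross (Classical b)" and ?Y = "Cross (Classical (\<not> b))"
  \<comment> \<open>Above the crossing the left strand has the colour \<open>(l, \<not> d)\<close>,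
    which is the colour of the cup in the inserted zigzag.\<close>
  have "flat_local R [(0, Cup l d), (0, ?X)] [(0, Cup l d), (0, ?X), (0, Cup l (\<not> d)), (1, Cap)]"
    using flat_local_context[OF flat_local_sym[OF flat_zigzag2[of l "\<not> d" "(l, d) # R"]], of "[(0, Cup l d), (0, ?X)]" R "[]"]
    by simp
  also have "flat_local R \<dots> [(0, Cup l d), (0, Cup l (\<not> d)), (2, ?X), (1, Cap)]"
    using flat_local_context[OF flat_local_sym[OF flat_interchange[of 0 "Cup l (\<not> d)" 0 ?X "(l, d) # (l, \<not> d) # R"
      "(l, \<not> d) # (l, d) # (l, \<not> d) # (l, d) # R"]], of "[(0, Cup l d)]" R "[(1, Cap)]"]
    by (simp add: numeral_2_eq_2)
  also have "flat_local R \<dots> [(0, Cup l d), (0, Cup l (\<not> d)), (1, ?Y), (2, Cap)]"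
    using flat_local_context[OF flat_local_offset[OF flat_swing_cap[of "(l, d)" "(l, d)" R "Classical b"], of "(l, \<not> d)"],
      of "[(0, Cup l d), (0, Cup l (\<not> d))]" R "[]"]
    by (simp add: numeral_2_eq_2)
  also have "flat_local R \<dots> [(0, Cup l (\<not> d)), (2, Cup l d), (1, ?Y), (2, Cap)]"
    using flat_local_context[OF flat_local_sym[OF flat_interchange[of 0 "Cup l (\<not> d)" 0 "Cup l d" R
      "(l, \<not> d) # (l, d) # (l, d) # (l, \<not> d) # R"]], of "[]" R "[(1, ?Y), (2, Cap)]"]
    by (simp add: numeral_2_eq_2)
  also have "flat_local R \<dots> [(0, Cup l (\<not> d)), (1, Cup l d), (2, ?X), (2, Cap)]"
    using flat_local_context[OF flat_local_offset[OF flat_local_sym[OF flat_swing_cup[of "(l, d)" R l d "Classical b"]], of "(l, \<not> d)"],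
      of "[(0, Cup l (\<not> d))]" R "[(2, Cap)]"]
    by (simp add: numeral_2_eq_2)
  \<comment> \<open>The crossing now lies directly below a maximum, as in the elementary move
    RI.\<close>
  also have "flat_local R \<dots> [(0, Cup l (\<not> d)), (1, Cup l d), (2, Cap)]"
    using flat_local_context[OF flat_local_offset[OF flat_local_offset[OF flat_RI[of "(l, \<not> d)" R b], of "(l, d)"], of "(l, \<not> d)"],
      of "[(0, Cup l (\<not> d)), (1, Cup l d)]" R "[]"]
    by (simp add: numeral_2_eq_2)
  also have "flat_local R \<dots> [(0, Cup l (\<not> d))]"
    using flat_local_context[OF flat_local_offset[OF flat_zigzag2[of l d R], of "(l, \<not> d)"], of "[(0, Cup l (\<not> d))]" R "[]"]
    by (simp add: numeral_2_eq_2)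
  finally show ?thesis .
qed

section \<open>Corresponding crossings of two tangles\<close>

definition ports :: "nat \<Rightarrow> 'a list \<Rightarrow> 'a list \<Rightarrow> 'a \<times> 'a \<times> 'a \<times> 'a \<Rightarrow> bool" where
  "ports p K K' Z \<longleftrightarrow> (case Z of (bl, br, ul, ur) \<Rightarrow>
     \<exists>A B. length A = p \<and> K = A @ [bl, br] @ B \<and> K' = A @ [ul, ur] @ B)"

lemma portsI: "length A = p \<Longrightarrow> ports p (A @ [bl, br] @ B) (A @ [ul, ur] @ B) (bl, br, ul, ur)"
  by (auto simp: ports_def)

lemma ports_simps [simp]:
  "ports 0 K K' (bl, br, ul, ur) \<longleftrightarrow> (\<exists>B. K = bl # br # B \<and> K' = ul # ur # B)"
  "ports (Suc p) K K' Z \<longleftrightarrow> (\<exists>a L L'. K = a # L \<and> K' = a # L' \<and> ports p L L' Z)"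
proof -
  show "ports 0 K K' (bl, br, ul, ur) \<longleftrightarrow> (\<exists>B. K = bl # br # B \<and> K' = ul # ur # B)"
    by (auto simp: ports_def)
  obtain bl br ul ur where Z: "Z = (bl, br, ul, ur)" by (metis prod.exhaust)
  show "ports (Suc p) K K' Z \<longleftrightarrow> (\<exists>a L L'. K = a # L \<and> K' = a # L' \<and> ports p L L' Z)"
  proof
    assume "ports (Suc p) K K' Z"
    then obtain A B where *: "length A = Suc p" "K = A @ [bl, br] @ B" "K' = A @ [ul, ur] @ B"
      by (auto simp: ports_def Z)
    then obtain a A' where "A = a # A'" by (cases A) auto
    with * show "\<exists>a L L'. K = a # L \<and> K' = a # L' \<and> ports p L L' Z"
      by (auto simp: ports_def Z)
  next
    assume "\<exists>a L L'. K = a # L \<and> K' = a # L' \<and> ports p L L' Z"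
    then obtain a A B where "length A = p" "K = (a # A) @ [bl, br] @ B" "K' = (a # A) @ [ul, ur] @ B"
      by (auto simp: ports_def Z)
    then show "ports (Suc p) K K' Z"
      using portsI[of "a # A" "Suc p" bl br B ul ur] by (simp add: Z)
  qed
qed

lemma ports_shift: "ports (length A + p) (A @ K) K' Z \<longleftrightarrow> (\<exists>L. K' = A @ L \<and> ports p K L Z)"
  by (induction A arbitrary: K') auto

lemma ports_nth: "ports p K K' (bl, br, ul, ur) \<Longrightarrow> bl = K ! p \<and> br = K ! Suc p \<and> ul = K' ! p \<and> ur = K' ! Suc p"
  by (auto simp: ports_def nth_append)

text \<open>The tangle relation with one crossing cut: the ends of this crossing form a third part
  of the boundary, whose values are \<open>Z\<close>, in the order bottom left, bottom right, top
  left, top right.\<close>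

definition cut_rel :: "('a \<Rightarrow> 'a) \<Rightarrow> diagram \<Rightarrow> nat \<Rightarrow> 'a list \<Rightarrow> 'a \<times> 'a \<times> 'a \<times> 'a \<Rightarrow> 'a list \<Rightarrow> bool" where
  "cut_rel \<tau> t a L Z M \<longleftrightarrow> (\<exists>K K'. tangle_rel \<tau> (take a t) L K \<and> ports (fst (t ! a)) K K' Z \<and>
     tangle_rel \<tau> (drop (Suc a) t) K' M)"

lemma cut_rel_shift:
  assumes "a < length t"
  shows "cut_rel \<tau> (shift (length A) t) a (A @ L) Z M \<longleftrightarrow> (\<exists>M'. M = A @ M' \<and> cut_rel \<tau> t a L Z M')"
proof -
  have E: "fst (shift (length A) t ! a) = length A + fst (t ! a)"
    using assms by (simp add: shift_def split: prod.split)
  have "cut_rel \<tau> (shift (length A) t) a (A @ L) Z M \<longleftrightarrow>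
      (\<exists>K1 K'. tangle_rel \<tau> (take a t) L K1 \<and> ports (length A + fst (t ! a)) (A @ K1) K' Z \<and>
        tangle_rel \<tau> (shift (length A) (drop (Suc a) t)) K' M)"
    unfolding cut_rel_def shift_take tangle_rel_shift E by blast
  also have "\<dots> \<longleftrightarrow> (\<exists>K1 K2. tangle_rel \<tau> (take a t) L K1 \<and> ports (fst (t ! a)) K1 K2 Z \<and>
        tangle_rel \<tau> (shift (length A) (drop (Suc a) t)) (A @ K2) M)"
    unfolding ports_shift by blast
  also have "\<dots> \<longleftrightarrow> (\<exists>M'. M = A @ M' \<and> cut_rel \<tau> t a L Z M')"
    unfolding tangle_rel_shift cut_rel_def by blast
  finally show ?thesis .
qed

datatype turn = Straight | Mirrored | Leftward | Rightward

text \<open>\<open>Leftward\<close> is a quarter turn counterclockwise and \<open>Rightward\<close>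
  one clockwise. Two of the four ends then change between bottom and top, and \<open>\<tau>\<close>
  accounts for the maximum or minimum passed on the way.\<close>

fun turn_ends :: "('a \<Rightarrow> 'a) \<Rightarrow> turn \<Rightarrow> 'a \<times> 'a \<times> 'a \<times> 'a \<Rightarrow> 'a \<times> 'a \<times> 'a \<times> 'a" where
  "turn_ends \<tau> Straight (bl, br, ul, ur) = (bl, br, ul, ur)"
| "turn_ends \<tau> Mirrored (bl, br, ul, ur) = (br, bl, ur, ul)"
| "turn_ends \<tau> Leftward (bl, br, ul, ur) = (\<tau> ul, bl, ur, \<tau> br)"
| "turn_ends \<tau> Rightward (bl, br, ul, ur) = (br, \<tau> ur, \<tau> bl, ul)"

text \<open>A quarter turn or a reflection exchanges rising and falling strands, so the same strand
  stays over exactly if the slope of the mark is swapped.\<close>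

fun turn_mark :: "turn \<Rightarrow> mark \<Rightarrow> mark" where
  "turn_mark Straight m = m"
| "turn_mark _ m = swap_slope m"

definition quarter :: "turn \<Rightarrow> bool" where
  "quarter \<rho> \<longleftrightarrow> \<rho> = Leftward \<or> \<rho> = Rightward"

text \<open>
  The crossing \<open>a\<close> of \<open>t\<close> corresponds to the crossing \<open>a'\<close> of \<open>t'\<close>, and \<open>turn_ends \<tau> \<rho>\<close> maps the
  values at the ends of \<open>a\<close> to those at the ends of \<open>a'\<close>.
\<close>
inductive inner :: "diagram \<Rightarrow> nat \<Rightarrow> diagram \<Rightarrow> nat \<Rightarrow> turn \<Rightarrow> bool" where
  lower: "inner [(i, Cross m), (i + 2 + r, h)] 0 [(i + 2 + r, h), (i, Cross m)] 1 Straight"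
| upper: "inner [(i, g), (i + outs g + r, Cross m)] 1 [(i + ins g + r, Cross m), (i, g)] 0 Straight"
| swing_cap: "inner [(1, Cross m), (0, Cap)] 0 [(0, Cross (swap_slope m)), (1, Cap)] 0 Leftward"
| swing_cup: "inner [(0, Cup l d), (1, Cross m)] 1 [(1, Cup l d), (0, Cross (swap_slope m))] 1 Rightward"
| triangle12: "same_kind m2 m3 \<Longrightarrow> inner [(0, Cross m1), (1, Cross m2), (0, Cross m3)] 0
    [(1, Cross m3), (0, Cross m2), (1, Cross m1)] 2 Straight"
| triangle13: "same_kind m1 m3 \<Longrightarrow> inner [(0, Cross m1), (1, Cross m2), (0, Cross m3)] 1
    [(1, Cross m3), (0, Cross m2), (1, Cross m1)] 1 Straight"
| triangle23: "same_kind m1 m2 \<Longrightarrow> inner [(0, Cross m1), (1, Cross m2), (0, Cross m3)] 2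
    [(1, Cross m3), (0, Cross m2), (1, Cross m1)] 0 Straight"
| bigon: "inner [(0, Cross m), (0, Cross (swap_slope m))] 0 [(0, Cross m), (0, Cross (swap_slope m))] 1 Mirrored"

text \<open>The side conditions on the other two crossings of a triangle hold in RIII because all
  crossings are classical, and in SV because these two are virtual.\<close>

lemma inner_elementary:
  assumes "elementary k t t' J" "(a, a') \<in> J" "t ! a = (p, Cross m)"
  shows "\<exists>\<rho>. inner t a t' a' \<rho>"
  using assms(1)
proof cases
  case (interchange i g r h)
  then show ?thesis
    using assms(2,3) inner.lower[of i m r h] inner.upper[of i g r m] by auto
next
  case (swing_cap m')
  then show ?thesis using assms(2) inner.swing_cap by auto
next
  case (swing_cup l d m')
  then show ?thesis using assms(2) inner.swing_cup by auto
next
  case (RIII x z y)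
  then show ?thesis
    using assms(2) inner.triangle12[of "Classical y" "Classical z" "Classical x"]
      inner.triangle13[of "Classical x" "Classical z" "Classical y"] inner.triangle23[of "Classical x" "Classical y" "Classical z"]
    by auto
next
  case (SV12 x)
  then show ?thesis using assms(2) inner.triangle12[of Virtual Virtual "Classical x"] by auto
next
  case (SV13 x)
  then show ?thesis using assms(2) inner.triangle13[of Virtual Virtual "Classical x"] by auto
next
  case (SV23 x)
  then show ?thesis using assms(2) inner.triangle23[of Virtual Virtual "Classical x"] by auto
qed (use assms(2) in auto)

lemma inner_crossings:
  assumes "inner t a t' a' \<rho>"
  shows "a < length t" "a' < length t'"
    "\<exists>p p' m. t ! a = (p, Cross m) \<and> t' ! a' = (p', Cross (turn_mark \<rho> m))"
  using assms by (cases; simp)+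

lemma inner_transfer:
  assumes "inner t a t' a' \<rho>" "cut_rel id t a L Z M"
  shows "cut_rel id t' a' L (turn_ends id \<rho> Z) M"
  using assms(1)
proof cases
  case (lower i m r h)
  obtain bl br ul ur where Z: "Z = (bl, br, ul, ur)" by (metis prod.exhaust)
  obtain K where K: "ports i L K Z" "layer_rel id False (i + 2 + r, h) K M"
    using assms(2) lower by (auto simp: cut_rel_def)
  then obtain A B where AB: "length A = i" "L = A @ [bl, br] @ B" "K = A @ [ul, ur] @ B"
    by (auto simp: ports_def Z)
  then obtain B' where B': "M = (A @ [ul, ur]) @ B'" "layer_rel id False (r, h) B B'"
    using K(2) layer_rel_shift[of id False "A @ [ul, ur]" r h B M] by (auto simp: add.assoc)
  then have "layer_rel id False (i + 2 + r, h) L ((A @ [bl, br]) @ B')"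
    using layer_rel_shift[of id False "A @ [bl, br]" r h B "(A @ [bl, br]) @ B'"] AB by (auto simp: add.assoc)
  moreover have "ports i ((A @ [bl, br]) @ B') M Z"
    using B' AB portsI[OF AB(1), of bl br B' ul ur] by (simp add: Z)
  ultimately show ?thesis
    unfolding cut_rel_def lower
    by (intro exI[of _ "(A @ [bl, br]) @ B'"] exI[of _ M]) (simp add: Z del: add_2_eq_Suc add_2_eq_Suc')
next
  case (upper i g r m)
  obtain bl br ul ur where Z: "Z = (bl, br, ul, ur)" by (metis prod.exhaust)
  obtain K where K: "layer_rel id False (i, g) L K" "ports (i + outs g + r) K M Z"
    using assms(2) upper by (auto simp: cut_rel_def)
  obtain A U V B where AB: "length A = i" "L = A @ U @ B" "K = A @ V @ B" "gen_rel id False g U V"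
    using K(1) by (rule layer_relE)
  note len = gen_rel_length[OF AB(4)]
  obtain B' where B': "M = (A @ V) @ B'" "ports r B B' Z"
    using K(2) ports_shift[of "A @ V" r B M Z] AB len by (auto simp: add.assoc)
  have "ports (i + ins g + r) L ((A @ U) @ B') Z"
    using B' ports_shift[of "A @ U" r B "(A @ U) @ B'" Z] AB len by (auto simp: add.assoc)
  moreover have "layer_rel id False (i, g) ((A @ U) @ B') M"
    using layer_relI[OF AB(1,4), of B'] B' by simp
  ultimately show ?thesis
    using upper by (auto simp: cut_rel_def Z)
qed (use assms(2) in \<open>cases Z; auto simp: cut_rel_def numeral_2_eq_2\<close>)+

text \<open>The colours on the two sides are given independently, but with the same boundary lists
  \<open>L\<close> and \<open>M\<close>. At an uncut crossing they have the shape
  \<open>(x, y, y, x)\<close>, and the boundary determines \<open>x\<close> and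
  \<open>y\<close>.\<close>

lemma inner_colours:
  assumes "inner t a t' a' \<rho>" "cut_rel opp t a L (x, y, y, x) M" "cut_rel opp t' a' L (x', y', y', x') M"
  shows "(x', y', y', x') = turn_ends opp \<rho> (x, y, y, x)"
  using assms(1)
proof cases
  case (lower i m r h)
  obtain K where K: "ports i L K (x, y, y, x)" "layer_rel opp False (i + 2 + r, h) K M"
    using assms(2) lower by (auto simp: cut_rel_def)
  obtain K' where K': "ports i K' M (x', y', y', x')"
    using assms(3) lower by (auto simp: cut_rel_def)
  obtain A B where AB: "length A = i" "K = A @ [y, x] @ B"
    using K(1) by (auto simp: ports_def)
  then obtain B' where "M = (A @ [y, x]) @ B'"
    using K(2) layer_rel_shift[of opp False "A @ [y, x]" r h B M] by (auto simp: add.assoc)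
  then have "M ! i = y" "M ! Suc i = x"
    using AB(1) by (simp_all add: nth_append)
  then have "y' = y" "x' = x"
    using ports_nth[OF K'] by metis+
  then show ?thesis using lower by simp
next
  case (upper i g r m)
  obtain K where K: "layer_rel opp False (i, g) L K" "ports (i + outs g + r) K M (x, y, y, x)"
    using assms(2) upper by (auto simp: cut_rel_def)
  obtain K' where K': "ports (i + ins g + r) L K' (x', y', y', x')"
    using assms(3) upper by (auto simp: cut_rel_def)
  obtain A U V B where AB: "length A = i" "L = A @ U @ B" "K = A @ V @ B" "gen_rel opp False g U V"
    using K(1) by (rule layer_relE)
  note len = gen_rel_length[OF AB(4)]
  obtain B' where "ports r B B' (x, y, y, x)"
    using K(2) ports_shift[of "A @ V" r B M] AB len by (auto simp: add.assoc)
  moreover obtain B'' where "ports r B B'' (x', y', y', x')"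
    using K' ports_shift[of "A @ U" r B K'] AB len by (auto simp: add.assoc)
  ultimately have "x' = x" "y' = y"
    using ports_nth by metis+
  then show ?thesis
    using upper by simp
next
  case (swing_cap m)
  show ?thesis using assms(2,3) unfolding swing_cap by (auto simp: cut_rel_def numeral_2_eq_2)
next
  case (swing_cup m)
  show ?thesis using assms(2,3) unfolding swing_cup by (auto simp: cut_rel_def numeral_2_eq_2)
next
  case (triangle12)
  show ?thesis using assms(2,3) unfolding triangle12 by (auto simp: cut_rel_def numeral_2_eq_2)
next
  case (triangle13)
  show ?thesis using assms(2,3) unfolding triangle13 by (auto simp: cut_rel_def numeral_2_eq_2)
next
  case (triangle23)
  show ?thesis using assms(2,3) unfolding triangle23 by (auto simp: cut_rel_def numeral_2_eq_2)
next
  case (bigon)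
  show ?thesis using assms(2,3) unfolding bigon by (auto simp: cut_rel_def numeral_2_eq_2)
qed


section \<open>Local equivalence of smoothed tangles\<close>

lemma runs_interchange: "runs [(i, g), (i + outs g + r, h)] L M \<longleftrightarrow> runs [(i + ins g + r, h), (i, g)] L M"
  unfolding runs_below runs_above ..

lemma runs_paint1: "runs [x] L M \<Longrightarrow> paint1 x M = x"
  by (simp add: runs.simps(2) del: runs_act)

lemma paint1_blank: "fst x = fst y \<Longrightarrow> blank (snd x) = blank (snd y) \<Longrightarrow> paint1 x M = paint1 y M"
  by (cases x; cases y; cases "snd x"; cases "snd y") auto

lemma flat_unique:
  assumes "blank g = blank h" "runs [(i, g)] L M" "runs [(i, h)] L M"
  shows "flat_local L [(i, g)] [(i, h)]"
proof -
  have "(i, g) = (i, h)"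
    using runs_paint1[OF assms(2)] runs_paint1[OF assms(3)] paint1_blank[of "(i, g)" "(i, h)" M] assms(1)
    by (metis fst_conv snd_conv)
  then show ?thesis by (simp add: flat_local_refl)
qed

lemma runs_step: "runs (x # T) L M \<Longrightarrow> runs T (act x L) M"
  by (simp only: runs_act)

text \<open>\<open>Cup 0 True\<close> is the blank decoration: the word serves to describe the shape
  of a smoothed tangle.\<close>

definition smoothed :: "diagram \<Rightarrow> nat \<Rightarrow> bool \<Rightarrow> diagram" where
  "smoothed t a T = take a t @ (if T then [(fst (t ! a), Cap), (fst (t ! a), Cup 0 True)] else []) @ drop (Suc a) t"

text \<open>The generator \<open>h\<close> is interchanged with the inserted cup and then with the
  inserted cap. The decorations on both sides agree because the boundary colours do.\<close>

lemma flat_lower: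
  assumes "runs [(i, Cap), (i, Cup l d), (i + 2 + r, h)] L M" "runs [(i + 2 + r, h'), (i, Cap), (i, Cup l' d')] L M"
    "blank h = blank h'"
  shows "flat_local L [(i, Cap), (i, Cup l d), (i + 2 + r, h)] [(i + 2 + r, h'), (i, Cap), (i, Cup l' d')]"
proof -
  let ?K = "act (i, Cap) L"
  have cap: "runs [(i, Cap)] L ?K" using assms(1) by (simp only: runs_act runs.simps(1))
  have X: "runs [(i, Cup l d), (i + 2 + r, h)] ?K M" using runs_step[OF assms(1)] .
  obtain N where N: "runs [(i + 2 + r, h'), (i, Cap)] L N" "runs [(i, Cup l' d')] N M"
    using assms(2) runs_append[of "[(i + 2 + r, h'), (i, Cap)]" "[(i, Cup l' d')]" L M] by (auto simp del: runs_act)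
  then have N1: "runs [(i, Cap), (i + outs Cap + r, h')] L N"
    unfolding runs_interchange by simp
  then have "runs ([(i, Cap), (i + 0 + r, h')] @ [(i, Cup l' d')]) L M"
    using N(2) unfolding runs_append by auto
  then have X': "runs [(i + 0 + r, h'), (i, Cup l' d')] ?K M"
    unfolding append_Cons append_Nil by (rule runs_step)
  then have "elementary Isotopy [(i, Cup l d), (i + 2 + r, h)] [(i + 0 + r, h'), (i, Cup l' d')] {(0, 1), (1, 0)}"
    using elementary_skeleton[OF elementary.interchange[of i "Cup l d" r h], of "[(i, Cup l d), (i + 2 + r, h)]"
      "[(i + 0 + r, h'), (i, Cup l' d')]" ?K M] X assms(3) by (simp del: runs_act add_2_eq_Suc add_2_eq_Suc')
  from flat_local_context[OF flat_local_elementary[OF this X X'] cap, of "[]"]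
  have "flat_local L [(i, Cap), (i, Cup l d), (i + 2 + r, h)] [(i, Cap), (i + r, h'), (i, Cup l' d')]"
    by (simp del: add_2_eq_Suc add_2_eq_Suc')
  also have "flat_local L \<dots> [(i + 2 + r, h'), (i, Cap), (i, Cup l' d')]"
    using flat_local_context[OF flat_interchange[of i Cap r h' L N], of "[]" L "[(i, Cup l' d')]"] N N1
    by (simp del: runs_act add_2_eq_Suc add_2_eq_Suc')
  finally show ?thesis .
qed

lemma flat_upper:
  assumes "runs [(i, g), (i + outs g + r, Cap), (i + outs g + r, Cup l d)] L M"
    "runs [(i + ins g + r, Cap), (i + ins g + r, Cup l' d'), (i, g')] L M" "blank g = blank g'"
  shows "flat_local L [(i, g), (i + outs g + r, Cap), (i + outs g + r, Cup l d)]
    [(i + ins g + r, Cap), (i + ins g + r, Cup l' d'), (i, g')]"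
proof -
  let ?K = "act (i + ins g + r, Cap) L"
  have io: "ins g' = ins g" "outs g' = outs g" using blank_ins_outs[OF assms(3)] by auto
  have cap: "runs [(i + ins g + r, Cap)] L ?K" using assms(2) by (simp only: runs_act runs.simps(1))
  have X: "runs [(i + ins g + r, Cup l' d'), (i, g')] ?K M" using runs_step[OF assms(2)] .
  obtain N where N: "runs [(i, g), (i + outs g + r, Cap)] L N" "runs [(i + outs g + r, Cup l d)] N M"
    using assms(1) runs_append[of "[(i, g), (i + outs g + r, Cap)]" "[(i + outs g + r, Cup l d)]" L M] by (auto simp del: runs_act)
  have N1: "runs [(i + ins g + r, Cap), (i, g)] L N"
    using N(1) unfolding runs_interchange .
  then have "runs ([(i + ins g + r, Cap), (i, g)] @ [(i + outs g + r, Cup l d)]) L M"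
    using N(2) unfolding runs_append by auto
  then have X': "runs [(i, g), (i + outs g + r, Cup l d)] ?K M"
    unfolding append_Cons append_Nil by (rule runs_step)
  then have "elementary Isotopy [(i, g), (i + outs g + r, Cup l d)] [(i + ins g + r, Cup l' d'), (i, g')] {(0, 1), (1, 0)}"
    using elementary_skeleton[OF elementary.interchange[of i g r "Cup l d"], of "[(i, g), (i + outs g + r, Cup l d)]"
      "[(i + ins g + r, Cup l' d'), (i, g')]" ?K M] X assms(3) by (simp del: runs_act)
  note * = flat_local_context[OF flat_local_elementary[OF this X' X] cap, of "[]"]
  have "flat_local L [(i, g), (i + outs g + r, Cap), (i + outs g + r, Cup l d)]
      [(i + ins g + r, Cap), (i, g), (i + outs g + r, Cup l d)]"
    using flat_local_context[OF flat_interchange[of i g r Cap L N], of "[]" L "[(i + outs g + r, Cup l d)]"] N N1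
    by (simp del: runs_act)
  also have "flat_local L \<dots> [(i + ins g + r, Cap), (i + ins g + r, Cup l' d'), (i, g')]"
    using * by (simp del: runs_act)
  finally show ?thesis .
qed

lemma length_ge_2: "2 \<le> length L \<Longrightarrow> \<exists>x y R. L = x # y # R"
  by (auto simp: Suc_le_length_iff numeral_eq_Suc)

lemma length_ge_3: "3 \<le> length L \<Longrightarrow> \<exists>x y z R. L = x # y # z # R"
  by (auto simp: Suc_le_length_iff numeral_eq_Suc)

lemma opp_eq: "y = opp x \<longleftrightarrow> fst y = fst x \<and> snd y \<noteq> snd x"
  by (auto simp: opp_def prod_eq_iff)

text \<open>The smoothing leaves a maximum below a minimum. The third strand is pulled off the
  minimum into the gap between them, and from there across the maximum.\<close>

lemma flat_triangle12:
  assumes "same_kind m2 m3" "runs [(0, Cap), (0, Cup l d), (1, Cross m2), (0, Cross m3)] L M"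
    "runs [(1, Cross m3), (0, Cross m2), (1, Cap), (1, Cup l' d')] L M"
  shows "flat_local L [(0, Cap), (0, Cup l d), (1, Cross m2), (0, Cross m3)] [(1, Cross m3), (0, Cross m2), (1, Cap), (1, Cup l' d')]"
proof -
  have "3 \<le> length L" using assms(3) by simp
  then obtain x y z R where L: "L = x # y # z # R" using length_ge_3 by blast
  have y: "y = opp x" and ld: "l' = l" "d' = d"
    using assms(2,3) by (auto simp: L opp_eq)
  have "flat_local L [(0, Cap), (0, Cup l d), (1, Cross m2), (0, Cross m3)] [(0, Cap), (1, Cup l d)]"
    using flat_local_context[OF flat_cup_slide1[OF assms(1), of z R l d], of "[(0, Cap)]" L "[]"] by (simp add: L y)
  also have "flat_local L \<dots> [(1, Cross m3), (0, Cross m2), (1, Cap), (1, Cup l d)]"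
    using flat_local_context[OF flat_local_sym[OF flat_cap_slide1[OF assms(1), of x z R]], of "[]" L "[(1, Cup l d)]"] by (simp add: L y)
  finally show ?thesis by (simp add: ld)
qed

lemma flat_triangle23:
  assumes "same_kind m1 m2" "runs [(0, Cross m1), (1, Cross m2), (0, Cap), (0, Cup l d)] L M"
    "runs [(1, Cap), (1, Cup l' d'), (0, Cross m2), (1, Cross m1)] L M"
  shows "flat_local L [(0, Cross m1), (1, Cross m2), (0, Cap), (0, Cup l d)] [(1, Cap), (1, Cup l' d'), (0, Cross m2), (1, Cross m1)]"
proof -
  have "3 \<le> length L" using assms(2) by simp
  then obtain x y z R where L: "L = x # y # z # R" using length_ge_3 by blast
  have z: "z = opp y" and ld: "l' = l" "d' = d"
    using assms(2,3) by (auto simp: L opp_eq)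
  have "flat_local L [(0, Cross m1), (1, Cross m2), (0, Cap), (0, Cup l d)] [(1, Cap), (0, Cup l d)]"
    using flat_local_context[OF flat_cap_slide2[OF assms(1), of x y R], of "[]" L "[(0, Cup l d)]"] by (simp add: L z)
  also have "flat_local L \<dots> [(1, Cap), (1, Cup l d), (0, Cross m2), (1, Cross m1)]"
    using flat_local_context[OF flat_local_sym[OF flat_cup_slide2[of m2 m1 x R l d]], of "[(1, Cap)]" L "[]"] assms(1)
    by (simp add: L z)
  finally show ?thesis by (simp add: ld)
qed

text \<open>The middle strand runs between the maximum and the minimum, crossing one leg of each.
  Both crossings are swung to the opposite legs, and crossing changes correct the marks.\<close>

lemma flat_triangle13:
  assumes "same_kind m1 m3" "runs [(0, Cross m1), (1, Cap), (1, Cup l d), (0, Cross m3)] L M"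
    "runs [(1, Cross m3), (0, Cap), (0, Cup l' d'), (1, Cross m1)] L M"
  shows "flat_local L [(0, Cross m1), (1, Cap), (1, Cup l d), (0, Cross m3)] [(1, Cross m3), (0, Cap), (0, Cup l' d'), (1, Cross m1)]"
proof -
  have "3 \<le> length L" using assms(2) by simp
  then obtain x y z R where L: "L = x # y # z # R" using length_ge_3 by blast
  have z: "z = opp x" and ld: "l' = l" "d' = d"
    using assms(2,3) by (auto simp: L opp_eq)
  have "flat_local L [(0, Cross m1), (1, Cap), (1, Cup l d), (0, Cross m3)] [(1, Cross (swap_slope m1)), (0, Cap), (1, Cup l d), (0, Cross m3)]"
    using flat_local_context[OF flat_local_sym[OF flat_swing_cap[of x y R "swap_slope m1"]], of "[]" L "[(1, Cup l d), (0, Cross m3)]"]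
    by (simp add: L z)
  also have "flat_local L \<dots> [(1, Cross m3), (0, Cap), (1, Cup l d), (0, Cross m3)]"
    using flat_local_context[OF flat_local_change[of "swap_slope m1" m3 L 1], of "[]" L "[(0, Cap), (1, Cup l d), (0, Cross m3)]"] assms(1)
    by simp
  also have "flat_local L \<dots> [(1, Cross m3), (0, Cap), (0, Cup l d), (1, Cross (swap_slope m3))]"
    using flat_local_context[OF flat_local_sym[OF flat_swing_cup[of y R l d "swap_slope m3"]], of "[(1, Cross m3), (0, Cap)]" L "[]"]
    by (simp add: L z)
  also have "flat_local L \<dots> [(1, Cross m3), (0, Cap), (0, Cup l d), (1, Cross m1)]"
    using flat_local_context[OF flat_local_change[of "swap_slope m3" m1 "(l, d) # (l, \<not> d) # y # R" 1],
      of "[(1, Cross m3), (0, Cap), (0, Cup l d)]" L "[]"] assms(1)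
    by (simp add: L z)
  finally show ?thesis by (simp add: ld)
qed

text \<open>The other crossing of the bigon becomes a curl, on the minimum or on the maximum, and RI
  removes it in both cases. The decorations of the cups are opposite because the crossing above a
  cup exchanges its ends.\<close>

lemma flat_bigon:
  assumes "runs [(0, Cap), (0, Cup l d), (0, Cross (Classical b))] L M" "runs [(0, Cross (Classical b')), (0, Cap), (0, Cup l' d')] L M"
  shows "flat_local L [(0, Cap), (0, Cup l d), (0, Cross (Classical b))] [(0, Cross (Classical b')), (0, Cap), (0, Cup l' d')]"
proof -
  have "2 \<le> length L" using assms(2) by simp
  then obtain x y R where L: "L = x # y # R" using length_ge_2 by blast
  have y: "y = opp x" and ld: "l' = l" "d' = (\<not> d)"
    using assms by (auto simp: L opp_eq)
  have "flat_local L [(0, Cap), (0, Cup l d), (0, Cross (Classical b))] [(0, Cap), (0, Cup l (\<not> d))]"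
    using flat_local_context[OF flat_RI_cup[of R l d b], of "[(0, Cap)]" L "[]"] by (simp add: L y)
  also have "flat_local L \<dots> [(0, Cross (Classical b')), (0, Cap), (0, Cup l (\<not> d))]"
    using flat_local_context[OF flat_local_sym[OF flat_RI[of x R b']], of "[]" L "[(0, Cup l (\<not> d))]"] by (simp add: L y)
  finally show ?thesis by (simp add: ld)
qed

lemma skeleton_shift_smoothed: "a < length t \<Longrightarrow> skeleton (smoothed (shift p t) a T) = shift p (skeleton (smoothed t a T))"
  by (auto simp: smoothed_def shift_def skeleton_def take_map drop_map case_prod_unfold apsnd_def map_prod_def)

lemma skeleton_shift: "skeleton (shift p t) = shift p (skeleton t)"
  by (auto simp: shift_def skeleton_def case_prod_unfold apsnd_def map_prod_def)

lemma skeleton_unshift: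
  assumes "skeleton u = shift p (skeleton t)"
  shows "\<exists>u'. u = shift p u' \<and> skeleton u' = skeleton t"
  using assms
proof (induction t arbitrary: u)
  case Nil
  then show ?case by (intro exI[of _ "[]"]) simp
next
  case (Cons x t)
  then obtain g U where u: "u = (p + fst x, g) # U" "blank g = blank (snd x)" "skeleton U = shift p (skeleton t)"
    by auto
  then obtain U' where "U = shift p U'" "skeleton U' = skeleton t"
    using Cons.IH by blast
  then show ?case
    using u by (intro exI[of _ "(fst x, g) # U'"]) simp
qed

text \<open>\<open>T\<close> tells whether a cap and a cup are inserted. Turning the crossing by a
  quarter exchanges this with the smoothing into vertical strands, hence the flag on the primed
  side.\<close>

lemma inner_flat:
  assumes "inner t a t' a' \<rho>" "t ! a = (p, Cross (Classical b))"
    "skeleton u = skeleton (smoothed t a T)" "skeleton u' = skeleton (smoothed t' a' (T \<noteq> quarter \<rho>))"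
    "runs u L M" "runs u' L M"
  shows "flat_local L u u'"
  using assms(1)
proof cases
  case (lower i m r h)
  show ?thesis
  proof (cases T)
    case True
    then obtain l d h1 l' d' h2 where u: "u = [(i, Cap), (i, Cup l d), (i + 2 + r, h1)]"
      "u' = [(i + 2 + r, h2), (i, Cap), (i, Cup l' d')]" "blank h1 = blank h2"
      using assms(3,4) lower by (auto simp: smoothed_def quarter_def)
    show ?thesis
      using flat_lower[of i l d r h1 L M h2 l' d'] assms(5,6) unfolding u by (simp only: u(3))
  next
    case False
    then obtain h1 h2 where u: "u = [(i + 2 + r, h1)]" "u' = [(i + 2 + r, h2)]" "blank h1 = blank h2"
      using assms(3,4) lower by (auto simp: smoothed_def quarter_def)
    show ?thesis
      using flat_unique[OF u(3)] assms(5,6) unfolding u by blast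
  qed
next
  case (upper i g r m)
  show ?thesis
  proof (cases T)
    case True
    then obtain l d g1 l' d' g2 where u: "u = [(i, g1), (i + outs g + r, Cap), (i + outs g + r, Cup l d)]"
      "u' = [(i + ins g + r, Cap), (i + ins g + r, Cup l' d'), (i, g2)]" "blank g1 = blank g2" "blank g1 = blank g"
      using assms(3,4) upper by (auto simp: smoothed_def quarter_def)
    show ?thesis
      using flat_upper[of i g1 r l d L M l' d' g2] assms(5,6) blank_ins_outs[OF u(4)] unfolding u(1,2) by (simp only: u(3))
  next
    case False
    then obtain h1 h2 where u: "u = [(i, h1)]" "u' = [(i, h2)]" "blank h1 = blank h2"
      using assms(3,4) upper by (auto simp: smoothed_def quarter_def)
    show ?thesis
      using flat_unique[OF u(3)] assms(5,6) unfolding u by blast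
  qed
next
  case (swing_cap m)
  \<comment> \<open>For a swung crossing the two smoothed words differ by a zigzag.\<close>
  show ?thesis
  proof (cases T)
    case True
    then obtain l d where u: "u = [(1, Cap), (1, Cup l d), (0, Cap)]" "u' = [(1, Cap)]"
      using assms(3,4) swing_cap by (auto simp: smoothed_def quarter_def)
    have "3 \<le> length L" using assms(6) u by simp
    then obtain x y z R where L: "L = x # y # z # R" using length_ge_3 by blast
    have x: "x = (l, \<not> d)" using assms(5) u by (auto simp: L prod_eq_iff)
    show ?thesis
      using flat_local_context[OF flat_zigzag1[of l d R], of "[(1, Cap)]" L "[]"] assms(6) by (simp add: u L x)
  next
    case False
    then obtain l d where u: "u = [(0, Cap)]" "u' = [(0, Cap), (0, Cup l d), (1, Cap)]"
      using assms(3,4) swing_cap by (auto simp: smoothed_def quarter_def)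
    have "3 \<le> length L" using assms(6) u by simp
    then obtain x y z R where L: "L = x # y # z # R" using length_ge_3 by blast
    have z: "z = (l, d)" using assms(6) u by (auto simp: L prod_eq_iff)
    show ?thesis
      using flat_local_context[OF flat_local_sym[OF flat_zigzag2[of l d R]], of "[(0, Cap)]" L "[]"] assms(5) by (simp add: u L z)
  qed
next
  case (swing_cup l d m)
  show ?thesis
  proof (cases T)
    case True
    then obtain l1 d1 l2 d2 l3 d3 where u: "u = [(0, Cup l1 d1), (1, Cap), (1, Cup l2 d2)]" "u' = [(1, Cup l3 d3)]"
      using assms(3,4) swing_cup by (auto simp: smoothed_def quarter_def)
    have "1 \<le> length L" using assms(6) u by simp
    then obtain x R where L: "L = x # R" by (cases L) auto
    have x: "x = (l1, d1)" "l3 = l2" "d3 = d2" using assms(5,6) u by (auto simp: L prod_eq_iff)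
    show ?thesis
      using flat_local_context[OF flat_zigzag2[of l1 d1 R], of "[]" L "[(1, Cup l2 d2)]"] by (simp add: u L x)
  next
    case False
    then obtain l1 d1 l2 d2 l3 d3 where u: "u = [(0, Cup l1 d1)]" "u' = [(1, Cup l2 d2), (0, Cap), (0, Cup l3 d3)]"
      using assms(3,4) swing_cup by (auto simp: smoothed_def quarter_def)
    have "1 \<le> length L" using assms(6) u by simp
    then obtain x R where L: "L = x # R" by (cases L) auto
    have x: "x = (l2, \<not> d2)" "l3 = l1" "d3 = d1" using assms(5,6) u by (auto simp: L prod_eq_iff)
    show ?thesis
      using flat_local_context[OF flat_local_sym[OF flat_zigzag1[of l2 d2 R]], of "[]" L "[(0, Cup l1 d1)]"] by (simp add: u L x)
  qed
next
  case (triangle12 m2 m3 m1)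
  show ?thesis
  proof (cases T)
    case True
    then obtain l d l' d' where u: "u = [(0, Cap), (0, Cup l d), (1, Cross m2), (0, Cross m3)]"
      "u' = [(1, Cross m3), (0, Cross m2), (1, Cap), (1, Cup l' d')]"
      using assms(3,4) triangle12 by (auto simp: smoothed_def quarter_def numeral_2_eq_2)
    show ?thesis
      using flat_triangle12[OF triangle12(6), of l d L M l' d'] assms(5,6) by (simp only: u)
  next
    case False
    \<comment> \<open>With vertical strands the remaining two crossings sit in the same places on
      both sides, with exchanged marks.\<close>
    then have u: "u = [(1, Cross m2), (0, Cross m3)]" "u' = [(1, Cross m3), (0, Cross m2)]"
      using assms(3,4) triangle12 by (auto simp: smoothed_def quarter_def numeral_2_eq_2)
    have "flat_local L [(1, Cross m2), (0, Cross m3)] [(1, Cross m3), (0, Cross m3)]"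
      using flat_local_context[OF flat_local_change[OF triangle12(6)], of "[]" L L 1 "[(0, Cross m3)]"] by simp
    also have "runs [(1, Cross m3)] L (act (1, Cross m3) L)"
      using assms(6) by (simp add: u)
    then have "flat_local L [(1, Cross m3), (0, Cross m3)] [(1, Cross m3), (0, Cross m2)]"
      using flat_local_context[OF flat_local_sym[OF flat_local_change[OF triangle12(6)]], of "[(1, Cross m3)]" L _ 0 "[]"] by simp
    finally show ?thesis by (simp only: u)
  qed
next
  case (triangle13 m1 m3 m2)
  show ?thesis
  proof (cases T)
    case True
    then obtain l d l' d' where u: "u = [(0, Cross m1), (1, Cap), (1, Cup l d), (0, Cross m3)]"
      "u' = [(1, Cross m3), (0, Cap), (0, Cup l' d'), (1, Cross m1)]"
      using assms(3,4) triangle13 by (auto simp: smoothed_def quarter_def numeral_2_eq_2)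
    show ?thesis
      using flat_triangle13[OF triangle13(6), of l d L M l' d'] assms(5,6) by (simp only: u)
  next
    case False
    \<comment> \<open>Here a bigon remains on each side, to the left or to the right of the free
      strand; RII removes both.\<close>
    then have u: "u = [(0, Cross m1), (0, Cross m3)]" "u' = [(1, Cross m3), (1, Cross m1)]"
      using assms(3,4) triangle13 by (auto simp: smoothed_def quarter_def numeral_2_eq_2)
    have "3 \<le> length L" using assms(6) u by simp
    then obtain x y z R where L: "L = x # y # z # R" using length_ge_3 by blast
    show ?thesis
      unfolding u L using flat_local_trans[OF flat_RII[OF triangle13(6)] flat_local_sym[OF flat_RII_offset[of m3 m1]]] triangle13(6)
      by simp
  qed
next
  case (triangle23 m1 m2 m3)
  show ?thesis
  proof (cases T)
    case True
    then obtain l d l' d' where u: "u = [(0, Cross m1), (1, Cross m2), (0, Cap), (0, Cup l d)]"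
      "u' = [(1, Cap), (1, Cup l' d'), (0, Cross m2), (1, Cross m1)]"
      using assms(3,4) triangle23 by (auto simp: smoothed_def quarter_def numeral_2_eq_2)
    show ?thesis
      using flat_triangle23[OF triangle23(6), of l d L M l' d'] assms(5,6) by (simp only: u)
  next
    case False
    then have u: "u = [(0, Cross m1), (1, Cross m2)]" "u' = [(0, Cross m2), (1, Cross m1)]"
      using assms(3,4) triangle23 by (auto simp: smoothed_def quarter_def numeral_2_eq_2)
    have "flat_local L [(0, Cross m1), (1, Cross m2)] [(0, Cross m2), (1, Cross m2)]"
      using flat_local_context[OF flat_local_change[OF triangle23(6)], of "[]" L L 0 "[(1, Cross m2)]"] by simp
    also have "runs [(0, Cross m2)] L (act (0, Cross m2) L)"
      using assms(6) by (simp add: u)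
    then have "flat_local L [(0, Cross m2), (1, Cross m2)] [(0, Cross m2), (1, Cross m1)]"
      using flat_local_context[OF flat_local_sym[OF flat_local_change[OF triangle23(6)]], of "[(0, Cross m2)]" L _ 1 "[]"] by simp
    finally show ?thesis by (simp only: u)
  qed
next
  case (bigon m)
  then have m: "m = Classical b" using assms(2) by simp
  show ?thesis
  proof (cases T)
    case True
    then obtain l d l' d' where u: "u = [(0, Cap), (0, Cup l d), (0, Cross (Classical (\<not> b)))]"
      "u' = [(0, Cross (Classical b)), (0, Cap), (0, Cup l' d')]"
      using assms(3,4) bigon m by (auto simp: smoothed_def quarter_def)
    show ?thesis
      using flat_bigon[of l d "\<not> b" L M b l' d'] assms(5,6) by (simp only: u)
  next
    case False
    then have u: "u = [(0, Cross (Classical (\<not> b)))]" "u' = [(0, Cross (Classical b))]"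
      using assms(3,4) bigon m by (auto simp: smoothed_def quarter_def)
    show ?thesis
      unfolding u by (rule flat_local_change) simp
  qed
qed

lemma elementary_runs:
  assumes "elementary k t t' J" "runs t L M" "runs t' L M'"
  shows "M' = M"
  using assms(1)
proof cases
  case (interchange i g r h)
  then show ?thesis
    using assms(2,3) runs_interchange runs_unique by metis
qed (use assms(2,3) in \<open>auto simp: runs.simps(2) simp del: runs_act\<close>)

lemma skeleton_smoothing:
  assumes "a < length X"
  shows "skeleton (smoothing X a T v) = skeleton (smoothed X a T)"
  using assms by (auto simp: smoothing_def smoothed_def skeleton_def[of "take _ _"] skeleton_def[of "drop _ _"] Let_def split: prod.split)

lemma ends_append:
  assumes "a < length X"
  shows "val (\<lambda>k. v (length P + k)) (BL X a) = val v (BL (P @ X @ Q) (length P + a))"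
    "val (\<lambda>k. v (length P + k)) (BR X a) = val v (BR (P @ X @ Q) (length P + a))"
    "val (\<lambda>k. v (length P + k)) (TL X a) = val v (TL (P @ X @ Q) (length P + a))"
    "val (\<lambda>k. v (length P + k)) (TR X a) = val v (TR (P @ X @ Q) (length P + a))"
  using assms by (simp_all add: val_def BL_def BR_def TL_def TR_def nth_append)

lemma joined_append:
  assumes "a < length X"
  shows "joined \<tau> (P @ X @ Q) (length P + a) T v \<longleftrightarrow> joined \<tau> X a T (\<lambda>k. v (length P + k))"
  unfolding joined_def ends_append[OF assms, where Q = Q] ..

lemma smoothing_append:
  assumes "a < length X"
  shows "smoothing (P @ X @ Q) (length P + a) T v =
    paint v P @ smoothing X a T (\<lambda>k. v (length P + k)) @ paint (\<lambda>k. v (length P + length X + k)) Q"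
proof -
  have 1: "take (length P + a) (P @ X @ Q) = P @ take a X" "drop (Suc (length P + a)) (P @ X @ Q) = drop (Suc a) X @ Q"
    using assms by simp_all
  have 2: "fst ((P @ X @ Q) ! (length P + a)) = fst (X ! a)"
    using assms by (simp add: nth_append)
  have 3: "(\<lambda>k. v (Suc (length P + a) + (length (drop (Suc a) X) + k))) = (\<lambda>k. v (length P + length X + k))"
    using assms by (intro ext arg_cong[of _ _ v]) simp
  have 4: "(\<lambda>k. v (Suc (length P + a) + k)) = (\<lambda>k. v (length P + (Suc a + k)))"
    by (intro ext arg_cong[of _ _ v]) simp
  show ?thesis
    unfolding smoothing_def Let_def 1 2 ends_append(3)[OF assms, of v P Q, symmetric] paint_append 3
    unfolding 4 by (simp only: append.assoc case_prod_unfold)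
qed

text \<open>Away from the crossing the colours are those of \<open>w\<close>; \<open>joined\<close>
  is what allows the inserted cap and cup, or the vertical strands, to connect the levels below and
  above it.\<close>

lemma runs_smoothing:
  assumes "valuation opp {a} X w" "a < length X" "X ! a = (p, Cross m)" "joined opp X a T w"
  shows "runs (smoothing X a T w) (w 0) (w (length X))"
proof -
  have l: "length (take a X) = a" using assms(2) by simp
  have v: "valuation opp {a} (take a X) w" "valuation opp {k. Suc a + k \<in> {a}} (drop (Suc a) X) (\<lambda>k. w (Suc a + k))"
    using assms(1,2) valuation_append[of opp "{a}" "take a X" "drop a X" w]
      valuation_append[of opp "{a}" "take (Suc a) X" "drop (Suc a) X" w]
    by (simp_all add: min_absorb2)
  have "valuation opp {} (take a X) w"
    by (rule valuation_cong[THEN iffD1, rotated 2, OF v(1)]) (use l in auto)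
  from runs_paint[OF this] have 1: "runs (paint w (take a X)) (w 0) (w a)"
    using l by simp
  have "valuation opp {} (drop (Suc a) X) (\<lambda>k. w (Suc a + k))"
    by (rule valuation_cong[THEN iffD1, rotated 2, OF v(2)]) auto
  moreover have "Suc a + length (drop (Suc a) X) = length X"
    using assms(2) by simp
  ultimately have 2: "runs (paint (\<lambda>k. w (Suc a + k)) (drop (Suc a) X)) (w (Suc a)) (w (length X))"
    by (metis runs_paint add_0_right)
  obtain A B where AB: "length A = p" "w a = A @ [val w (BL X a), val w (BR X a)] @ B"
    "w (Suc a) = A @ [val w (TL X a), val w (TR X a)] @ B"
    using valuation_cross[OF assms(1-3)] by blast
  obtain l d where TL: "val w (TL X a) = (l, d)" by force
  have 3: "runs (if T then [(p, Cap), (p, Cup l d)] else []) (w a) (w (Suc a))"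
  proof (cases T)
    case True
    then have "w a = A @ val w (BL X a) # opp (val w (BL X a)) # B" "w (Suc a) = A @ (l, d) # (l, \<not> d) # B"
      using AB assms(4) TL by (auto simp: joined_def)
    then show ?thesis
      using True AB(1) by (auto simp: nth_append)
  next
    case False
    then show ?thesis using AB assms(4) by (simp add: joined_def)
  qed
  have "smoothing X a T w = paint w (take a X) @ (if T then [(p, Cap), (p, Cup l d)] else []) @
      paint (\<lambda>k. w (Suc a + k)) (drop (Suc a) X)"
    by (simp add: smoothing_def TL assms(3))
  then show ?thesis
    by (simp only: runs_append) (intro exI[of _ "w a"] exI[of _ "w (Suc a)"] conjI 1 2 3)
qed

section \<open>Crossings with equivalent smoothings\<close>

definition ends :: "diagram \<Rightarrow> nat \<Rightarrow> (nat \<Rightarrow> 'a list) \<Rightarrow> 'a \<times> 'a \<times> 'a \<times> 'a" where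
  "ends D c g = (val g (BL D c), val g (BR D c), val g (TL D c), val g (TR D c))"

text \<open>\<open>out_end\<close> as a choice among the values at the four ends: \<open>r\<close>
  says whether the strand in question rises from the bottom left, \<open>x\<close> and
  \<open>y\<close> whether the colours at the bottom left and bottom right point upwards.\<close>

fun pick :: "bool \<Rightarrow> bool \<Rightarrow> bool \<Rightarrow> 'a \<times> 'a \<times> 'a \<times> 'a \<Rightarrow> 'a" where
  "pick r x y (bl, br, ul, ur) = (if r then (if x then ur else bl) else (if y then ul else br))"

lemma (in diagram_crossing) val_out_end:
  "val g (out_end D c ov) = pick (b = ov) (snd (colour_at D (BL D c))) (snd (colour_at D (BR D c))) (ends D c g)"
  by (simp add: out_end_def rising ends_def)

text \<open>The mark and the directions turn together with the crossing, so the overstrand leaves at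
  the corresponding end. This is the local form of the convention on orientations.\<close>

lemma pick_turn:
  assumes "Classical b' = turn_mark \<rho> (Classical b)" "(x', y', y', x') = turn_ends opp \<rho> (x, y, y, x)"
  shows "pick (b' = ov) (snd x') (snd y') (turn_ends id \<rho> Z) = pick (b = ov) (snd x) (snd y) Z"
  using assms by (cases \<rho>; cases Z; cases b; cases b'; cases ov) auto

text \<open>
  The crossing \<open>c\<close> of \<open>D\<close>, turned by \<open>\<rho>\<close>, corresponds to the crossing \<open>c'\<close> of \<open>D'\<close>, and all
  smoothings at \<open>c\<close> and \<open>c'\<close> are equivalent.
\<close>
definition similar :: "diagram \<Rightarrow> nat \<Rightarrow> diagram \<Rightarrow> nat \<Rightarrow> turn \<Rightarrow> bool" where
  "similar D c D' c' \<rho> \<longleftrightarrow> ncomp D' = ncomp D \<and>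
     (\<exists>p b p' b'. diagram_crossing D c p b \<and> diagram_crossing D' c' p' b' \<and> Classical b' = turn_mark \<rho> (Classical b)) \<and>
     ends D' c' (level D') = turn_ends opp \<rho> (ends D c (level D)) \<and>
     (\<forall>s. valuation id {c} D s \<longrightarrow> s 0 = [] \<longrightarrow> (\<exists>s'. valuation id {c'} D' s' \<and> s' 0 = [] \<and>
        ends D' c' s' = turn_ends id \<rho> (ends D c s) \<and>
        (\<forall>F T. (\<forall>a b. F (opp a, b) = opp (F (a, b))) \<longrightarrow> joined opp D c T (decorate D F s) \<longrightarrow>
           joined opp D' c' (T \<noteq> quarter \<rho>) (decorate D' F s') \<longrightarrow>
           vl_diagram (smoothing D c T (decorate D F s)) \<longrightarrow>
           flat_equiv (smoothing D c T (decorate D F s)) (smoothing D' c' (T \<noteq> quarter \<rho>) (decorate D' F s')))))"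

lemma flat_class_cong: "flat_equiv D D' \<Longrightarrow> flat_class D = flat_class D'"
  unfolding flat_class_def using Quotient3_flat_link by (metis Quotient3_rel)

lemma similar_weights:
  assumes "similar D c D' c' \<rho>"
  shows "c \<in> crossings D" "c' \<in> crossings D'" "strand_label D' c' ov = strand_label D c ov"
    "c \<in> self_crossings D \<Longrightarrow> S1 \<kappa> D' c' = S1 \<kappa> D c"
    "c \<in> self_crossings D \<Longrightarrow> S2 \<kappa> D' c' = S2 \<kappa> D c"
    "c \<in> mixed_crossings D \<Longrightarrow> S3 \<kappa> D' c' = S3 \<kappa> D c"
proof -
  obtain p b p' b' where X: "diagram_crossing D c p b" and X': "diagram_crossing D' c' p' b'"
    and m: "Classical b' = turn_mark \<rho> (Classical b)"
    using assms unfolding similar_def by blast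
  interpret X: diagram_crossing D c p b by (rule X)
  interpret X': diagram_crossing D' c' p' b' by (rule X')
  define x y x' y' where xy: "x = colour_at D (BL D c)" "y = colour_at D (BR D c)"
    "x' = colour_at D' (BL D' c')" "y' = colour_at D' (BR D' c')"
  have "val (level E) = colour_at E" for E by (auto simp: val_def colour_at_def)
  then have col: "(x', y', y', x') = turn_ends opp \<rho> (x, y, y, x)"
    using assms X.end_colours X'.end_colours unfolding similar_def ends_def xy by simp
  have n: "ncomp D' = ncomp D" using assms unfolding similar_def by blast
  show c: "c \<in> crossings D" "c' \<in> crossings D'"
    using X.c X.Dc X'.c X'.Dc by (auto simp: crossings_def)
  have lab: "strand_label D' c' ov = strand_label D c ov" for ov
    using m col by (cases \<rho>) (auto simp: X.strand_label_eq X'.strand_label_eq simp flip: xy)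
  show "strand_label D' c' ov = strand_label D c ov" by (rule lab)
  \<comment> \<open>After a quarter turn parallel strands are antiparallel; this compensates the
    exchange of the two ways of smoothing.\<close>
  have par: "parallel D' c' \<longleftrightarrow> (parallel D c \<noteq> quarter \<rho>)"
    using col by (cases \<rho>) (auto simp: parallel_def quarter_def simp flip: xy)
  have par2: "\<not> parallel D' c' \<longleftrightarrow> (\<not> parallel D c) \<noteq> quarter \<rho>"
    using par by auto
  have transfer: "\<exists>s'. valuation id {c'} D' s' \<and> s' 0 = [] \<and>
        (\<forall>ov. val s' (out_end D' c' ov) = val s (out_end D c ov)) \<and>
        (\<forall>F T. (\<forall>a b. F (opp a, b) = opp (F (a, b))) \<longrightarrow> joined opp D c T (decorate D F s) \<longrightarrow>
           joined opp D' c' (T \<noteq> quarter \<rho>) (decorate D' F s') \<longrightarrow>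
           vl_diagram (smoothing D c T (decorate D F s)) \<longrightarrow>
           flat_equiv (smoothing D c T (decorate D F s)) (smoothing D' c' (T \<noteq> quarter \<rho>) (decorate D' F s')))"
    if s: "valuation id {c} D s" "s 0 = []" for s
  proof -
    obtain s' where s': "valuation id {c'} D' s'" "s' 0 = []" "ends D' c' s' = turn_ends id \<rho> (ends D c s)"
        "\<forall>F T. (\<forall>a b. F (opp a, b) = opp (F (a, b))) \<longrightarrow> joined opp D c T (decorate D F s) \<longrightarrow>
           joined opp D' c' (T \<noteq> quarter \<rho>) (decorate D' F s') \<longrightarrow>
           vl_diagram (smoothing D c T (decorate D F s)) \<longrightarrow>
           flat_equiv (smoothing D c T (decorate D F s)) (smoothing D' c' (T \<noteq> quarter \<rho>) (decorate D' F s'))"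
      using assms s unfolding similar_def by blast
    have "val s' (out_end D' c' ov) = val s (out_end D c ov)" for ov
      unfolding X.val_out_end X'.val_out_end s'(3) using pick_turn[OF m col, of ov "ends D c s"] by (simp add: xy)
    with s' show ?thesis by blast
  qed
  show "S1 \<kappa> D' c' = S1 \<kappa> D c" if "c \<in> self_crossings D"
  proof -
    have self: "strand_label D c True = strand_label D c False" "strand_label D' c' True = strand_label D' c' False"
      using that lab by (auto simp: self_crossings_def)
    obtain s where s: "X.separates \<kappa> s" using X.separates_exists[OF self(1)] by blast
    obtain s' where s': "valuation id {c'} D' s'" "s' 0 = []" "\<forall>ov. val s' (out_end D' c' ov) = val s (out_end D c ov)"
      and flat: "\<forall>F T. (\<forall>a b. F (opp a, b) = opp (F (a, b))) \<longrightarrow> joined opp D c T (decorate D F s) \<longrightarrow>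
           joined opp D' c' (T \<noteq> quarter \<rho>) (decorate D' F s') \<longrightarrow>
           vl_diagram (smoothing D c T (decorate D F s)) \<longrightarrow>
           flat_equiv (smoothing D c T (decorate D F s)) (smoothing D' c' (T \<noteq> quarter \<rho>) (decorate D' F s'))"
      using transfer[of s] s unfolding X.separates_def by blast
    have sep': "X'.separates \<kappa> s'"
      using s s' by (simp add: X.separates_def X'.separates_def)
    have "flat_equiv (smooth1 \<kappa> D c) (smooth1 \<kappa> D' c')"
      using flat[rule_format, of "colour1 (strand_label D c \<kappa>)" "parallel D c"] X.vl_smooth1[OF s self(1)] X'.vl_smooth1[OF sep' self(2)]
      unfolding X.smooth1_eq[OF s self(1)] X'.smooth1_eq[OF sep' self(2)] par lab by (simp add: colours_opp)
    then show ?thesis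
      by (simp add: S1_def flat_class_cong)
  qed
  show "S2 \<kappa> D' c' = S2 \<kappa> D c" if "c \<in> self_crossings D"
  proof -
    have self: "strand_label D c True = strand_label D c False" "strand_label D' c' True = strand_label D' c' False"
      using that lab by (auto simp: self_crossings_def)
    obtain s where s: "X.separates \<kappa> s" using X.separates_exists[OF self(1)] by blast
    obtain s' where s': "valuation id {c'} D' s'" "s' 0 = []" "\<forall>ov. val s' (out_end D' c' ov) = val s (out_end D c ov)"
      and flat: "\<forall>F T. (\<forall>a b. F (opp a, b) = opp (F (a, b))) \<longrightarrow> joined opp D c T (decorate D F s) \<longrightarrow>
           joined opp D' c' (T \<noteq> quarter \<rho>) (decorate D' F s') \<longrightarrow>
           vl_diagram (smoothing D c T (decorate D F s)) \<longrightarrow>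
           flat_equiv (smoothing D c T (decorate D F s)) (smoothing D' c' (T \<noteq> quarter \<rho>) (decorate D' F s'))"
      using transfer[of s] s unfolding X.separates_def by blast
    have sep': "X'.separates \<kappa> s'"
      using s s' by (simp add: X.separates_def X'.separates_def)
    have "flat_equiv (smooth2 \<kappa> D c) (smooth2 \<kappa> D' c')"
      using flat[rule_format, of "colour2 (ncomp D + 1) (strand_label D c \<kappa>)" "\<not> parallel D c"]
        X.vl_smooth2[OF s self(1)] X'.vl_smooth2[OF sep' self(2)]
      unfolding X.smooth2_eq[OF s self(1)] X'.smooth2_eq[OF sep' self(2)] par2 lab n by (simp add: colours_opp)
    then show ?thesis
      by (simp add: S2_def flat_class_cong)
  qed
  show "S3 \<kappa> D' c' = S3 \<kappa> D c" if "c \<in> mixed_crossings D"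
  proof -
    have mixed: "strand_label D c True \<noteq> strand_label D c False" "strand_label D' c' True \<noteq> strand_label D' c' False"
      using that lab by (auto simp: mixed_crossings_def)
    define s where "s = (\<lambda>k. map (\<lambda>_. False) (level D k))"
    have s: "valuation id {c} D s" "s 0 = []"
      using X.all_False by (simp_all add: s_def)
    obtain s' where s': "valuation id {c'} D' s'" "s' 0 = []"
      and flat: "\<forall>F T. (\<forall>a b. F (opp a, b) = opp (F (a, b))) \<longrightarrow> joined opp D c T (decorate D F s) \<longrightarrow>
           joined opp D' c' (T \<noteq> quarter \<rho>) (decorate D' F s') \<longrightarrow>
           vl_diagram (smoothing D c T (decorate D F s)) \<longrightarrow>
           flat_equiv (smoothing D c T (decorate D F s)) (smoothing D' c' (T \<noteq> quarter \<rho>) (decorate D' F s'))"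
      using transfer[OF s] by blast
    have "flat_equiv (smooth3 \<kappa> D c) (smooth3 \<kappa> D' c')"
      using flat[rule_format, of "colour3 (strand_label D c \<kappa>) (strand_label D c (\<not> \<kappa>))" "parallel D c"]
        X.vl_smooth3[OF s mixed(1)] X'.vl_smooth3[OF s' mixed(2)]
      unfolding X.smooth3_eq[OF s] X'.smooth3_eq[OF s'] par lab by (simp add: colours_opp)
    then show ?thesis
      by (simp add: S3_def flat_class_cong)
  qed
qed

section \<open>Transport of valuations through a move\<close>

lemma cut_split:
  assumes "a < length T" "T ! a = (p, Cross m)" "valuation \<tau> {a} T w"
  shows "cut_rel \<tau> T a (w 0) (ends T a w) (w (length T))"
proof -
  have v: "valuation \<tau> {a} (take a T) w" "valuation \<tau> {k. Suc a + k \<in> {a}} (drop (Suc a) T) (\<lambda>k. w (Suc a + k))"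
    using assms(1,3) valuation_append[of \<tau> "{a}" "take a T" "drop a T" w]
      valuation_append[of \<tau> "{a}" "take (Suc a) T" "drop (Suc a) T" w]
    by (simp_all add: min_absorb2)
  have "valuation \<tau> {} (take a T) w"
    by (rule valuation_cong[THEN iffD1, rotated 2, OF v(1)]) (use assms(1) in auto)
  from tangle_relI[OF this] have 1: "tangle_rel \<tau> (take a T) (w 0) (w a)"
    using assms(1) by (simp add: min_absorb2)
  have "valuation \<tau> {} (drop (Suc a) T) (\<lambda>k. w (Suc a + k))"
    by (rule valuation_cong[THEN iffD1, rotated 2, OF v(2)]) auto
  moreover have "Suc a + length (drop (Suc a) T) = length T"
    using assms(1) by simp
  ultimately have 2: "tangle_rel \<tau> (drop (Suc a) T) (w (Suc a)) (w (length T))"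
    by (metis tangle_relI add_0_right)
  obtain A B where "length A = p" "w a = A @ [val w (BL T a), val w (BR T a)] @ B"
    "w (Suc a) = A @ [val w (TL T a), val w (TR T a)] @ B"
    using valuation_cross[OF assms(3,1,2)] by blast
  then have "ports p (w a) (w (Suc a)) (ends T a w)"
    unfolding ends_def using portsI by metis
  with 1 2 show ?thesis
    unfolding cut_rel_def assms(2) by auto
qed

text \<open>The converse of \<open>cut_split\<close>. Between the two lemmas the values may be
  rearranged by \<open>turn_ends\<close>, which is done on relations and not on valuations.\<close>

lemma cut_join:
  assumes "a < length T" "T ! a = (p, Cross m)" "cut_rel \<tau> T a L Z M"
  shows "\<exists>w. valuation \<tau> {a} T w \<and> w 0 = L \<and> w (length T) = M \<and> ends T a w = Z"
proof -
  obtain bl br ul ur where Z: "Z = (bl, br, ul, ur)" by (metis prod.exhaust)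
  obtain K K' where K: "tangle_rel \<tau> (take a T) L K" "ports p K K' Z" "tangle_rel \<tau> (drop (Suc a) T) K' M"
    using assms by (auto simp: cut_rel_def)
  obtain u where u: "valuation \<tau> {} (take a T) u" "u 0 = L" "u a = K"
    using tangle_relE[OF K(1)] assms(1) by (auto simp: min_absorb2)
  obtain w where w: "valuation \<tau> {} (drop (Suc a) T) w" "w 0 = K'" "w (length T - Suc a) = M"
    using tangle_relE[OF K(3)] by auto
  obtain A B where AB: "length A = p" "K = A @ [bl, br] @ B" "K' = A @ [ul, ur] @ B"
    using K(2) by (auto simp: ports_def Z)
  have T: "take a T @ [(p, Cross m)] @ drop (Suc a) T = T"
    using assms(1,2) by (metis Cons_nth_drop_Suc append_Cons append_Nil append_take_drop_id)
  define g where "g = glue a 1 u (case_nat K (\<lambda>_. K')) w"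
  have l: "length (take a T) = a" using assms(1) by simp
  have "valuation \<tau> {a} (take a T @ [(p, Cross m)] @ drop (Suc a) T)
     (glue (length (take a T)) (length [(p, Cross m)]) u (case_nat K (\<lambda>_. K')) w)"
  proof (rule valuation_glue)
    show "valuation \<tau> {a} (take a T) u" "valuation \<tau> {k. length (take a T) + length [(p, Cross m)] + k \<in> {a}} (drop (Suc a) T) w"
      using u(1) w(1) by (auto elim: valuation_mono)
    show "valuation \<tau> {k. length (take a T) + k \<in> {a}} [(p, Cross m)] (case_nat K (\<lambda>_. K'))"
      using layer_relI[of A p \<tau> True "Cross m" "[bl, br]" "[ul, ur]" B] AB l by (simp add: valuation_Cons)
  qed (use u w l in simp_all)
  then have g: "valuation \<tau> {a} T g"
    using T l by (simp add: g_def)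
  have "g a = K" "g (Suc a) = K'" "g 0 = L" "g (length T) = M"
    using u w assms(1) by (auto simp: g_def glue_def)
  moreover have "ends T a g = Z"
    using \<open>g a = K\<close> \<open>g (Suc a) = K'\<close> AB by (simp add: ends_def val_def BL_def BR_def TL_def TR_def assms(2) Z nth_append)
  ultimately show ?thesis
    using g by blast
qed

lemma ends_append_eq: "a < length X \<Longrightarrow> ends (P @ X @ Q) (length P + a) v = ends X a (\<lambda>k. v (length P + k))"
  unfolding ends_def by (simp only: ends_append[where Q = Q])

lemma level_replace:
  assumes "runs P [] L" "runs T L M" "runs T' L M"
  shows "k \<le> length P \<Longrightarrow> level (P @ T' @ Q) k = level (P @ T @ Q) k"
    "level (P @ T' @ Q) (length P + length T' + k) = level (P @ T @ Q) (length P + length T + k)"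
    "level (P @ T @ Q) (length P) = L" "level (P @ T @ Q) (length P + length T) = M"
  using assms by (simp_all add: level_def runs_iff)

lemma elementary_replace:
  assumes el: "elementary k t t' J" and vl: "vl_diagram (P @ shift p t @ Q)" "vl_diagram (P @ shift p t' @ Q)"
  shows "\<exists>A L M. length A = p \<and> runs P [] (A @ L) \<and> runs t L M \<and> runs t' L M"
    and "ncomp (P @ shift p t' @ Q) = ncomp (P @ shift p t @ Q)"
proof -
  have "t \<noteq> []" using el by cases auto
  obtain K M1 where K: "runs P [] K" "runs (shift p t) K M1"
    using vl_runs[OF vl(1)] unfolding runs_append by blast
  obtain K' M2 where K': "runs P [] K'" "runs (shift p t') K' M2"
    using vl_runs[OF vl(2)] unfolding runs_append by blast
  have "K' = K" using runs_unique[OF K'(1) K(1)] .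
  have "p \<le> length K"
    using tangle_rel_length_shift[OF runs_tangle_rel[OF K(2)] \<open>t \<noteq> []\<close>] .
  then obtain A L where AL: "K = A @ L" "length A = p"
    by (metis append_take_drop_id length_take min_absorb2)
  obtain M M' where M: "runs t L M" "runs t' L M'"
    using K(2) K'(2) AL runs_shift[of A t L M1] runs_shift[of A t' L M2] by (auto simp: \<open>K' = K\<close>)
  have "M' = M" using elementary_runs[OF el M] .
  then show "\<exists>A L M. length A = p \<and> runs P [] (A @ L) \<and> runs t L M \<and> runs t' L M"
    using AL K M by blast
  show "ncomp (P @ shift p t' @ Q) = ncomp (P @ shift p t @ Q)"
  proof -
    have r: "runs P [] (A @ L)" "runs (shift p t) (A @ L) (A @ M)" "runs (shift p t') (A @ L) (A @ M)"
      using K AL M \<open>M' = M\<close> by (auto simp: runs_shift)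
    have "tangle_rel id (shift p t) N N'" if hyp: "tangle_rel id (shift p t') N N'" "length N = length (A @ L)" for N N' :: "bool list"
    proof -
      have "p \<le> length N" using hyp(2) AL by simp
      then obtain B L' where BL: "N = B @ L'" "length B = p"
        by (metis append_take_drop_id length_take min_absorb2)
      then have "length L' = length L" using hyp(2) AL by simp
      obtain N1 where "N' = B @ N1" "tangle_rel id t' L' N1"
        using hyp(1) BL tangle_rel_shift[of id B t' L' N'] by auto
      then show ?thesis
        using elementary_transfer'[OF el _ runs_tangle_rel[OF M(1)], of L' N1] BL \<open>length L' = length L\<close>
          tangle_rel_shift[of id B t L' N'] by auto
    qed
    then show ?thesis
      using vl_replace[OF vl(1) r _ interior_shift interior_shift] interior_elementary[OF el] by blast
  qed
qed

lemma paint_agree: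
  assumes "\<And>k. k \<le> length Q \<Longrightarrow> v k = w k"
  shows "paint v Q = paint w Q"
  by (rule paint_cong) (use assms in auto)

lemma flat_localD:
  assumes "flat_local L u u'" "length A = p" "runs P [] (A @ L)" "vl_diagram (P @ shift p u @ Q)"
  shows "flat_equiv (P @ shift p u @ Q) (P @ shift p u' @ Q)"
  using assms unfolding flat_local_def flat_at_def by blast

text \<open>The valuation is opened at the crossing inside the tangle and rebuilt on the other side
  from the turned end values. The smoothed diagrams then share their painted outer parts, and
  \<open>inner_flat\<close> compares what lies between.\<close>

lemma similar_inner:
  assumes inn: "inner t a t' a' \<rho>" and ta: "t ! a = (pa, Cross (Classical b))"
    and D: "D = P @ shift p t @ Q" "D' = P @ shift p t' @ Q" "vl_diagram D" "vl_diagram D'"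
    and A: "length A = p" "runs P [] (A @ L)" "runs t L M" "runs t' L M"
    and n: "ncomp D' = ncomp D"
  shows "similar D (length P + a) D' (length P + a') \<rho>"
proof -
  let ?T = "shift p t" and ?T' = "shift p t'"
  note len = inner_crossings(1,2)[OF inn]
  obtain pa' b' where ta': "t' ! a' = (pa', Cross (Classical b'))" "Classical b' = turn_mark \<rho> (Classical b)"
  proof -
    obtain q where "t' ! a' = (q, Cross (turn_mark \<rho> (Classical b)))"
      using inner_crossings(3)[OF inn] ta by auto
    moreover obtain b' where "turn_mark \<rho> (Classical b) = Classical b'" by (cases \<rho>) auto
    ultimately show thesis using that by simp
  qed
  have T: "?T ! a = (p + pa, Cross (Classical b))" "?T' ! a' = (p + pa', Cross (Classical b'))" "a < length ?T" "a' < length ?T'"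
    using len ta ta' by (simp_all add: shift_def)
  have X: "diagram_crossing D (length P + a) (p + pa) b" "diagram_crossing D' (length P + a') (p + pa') b'"
    using D T by (auto simp: diagram_crossing_def nth_append)
  have r: "runs P [] (A @ L)" "runs ?T (A @ L) (A @ M)" "runs ?T' (A @ L) (A @ M)"
    using A by (auto simp: runs_shift)
  note lev = level_replace[OF r, folded D(1,2)]
  have lev': "level D' (length P) = A @ L" "level D' (length P + length ?T') = A @ M"
    using lev(1)[of "length P" Q] lev(2)[of Q 0] lev(3,4)[of Q] D by simp_all
  have cut: "cut_rel \<tau> t a N (ends D (length P + a) g) N' \<and> length B = p"
    if g: "valuation \<tau> {length P + a} D g" "g (length P) = B @ N" "length B = p" "g (length P + length t) = B @ N'"
    for \<tau> and g :: "nat \<Rightarrow> 'z list" and N N' B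
  proof -
    have "valuation \<tau> {k. length P + k \<in> {length P + a}} ?T (\<lambda>k. g (length P + k))"
      using g(1) unfolding D valuation_append by blast
    then have "valuation \<tau> {a} ?T (\<lambda>k. g (length P + k))" by simp
    from cut_split[OF T(3,1) this] have "cut_rel \<tau> (shift (length B) t) a (B @ N) (ends D (length P + a) g) (B @ N')"
      using g T(3) by (simp add: ends_append_eq D)
    then show ?thesis
      unfolding cut_rel_shift[OF len(1)] using g(3) by simp
  qed
  have cut': "cut_rel opp t' a' L (ends D' (length P + a') (level D')) M"
  proof -
    have v: "valuation opp {length P + a'} D' (level D')"
      using valuation_level(1)[OF vl_runs[OF D(4)]] by (rule valuation_mono) simp
    have "valuation opp {k. length P + k \<in> {length P + a'}} ?T' (\<lambda>k. level D' (length P + k))"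
      using v unfolding D(2) valuation_append by blast
    then have "valuation opp {a'} ?T' (\<lambda>k. level D' (length P + k))" by simp
    from cut_split[OF T(4,2) this] have "cut_rel opp (shift (length A) t') a' (A @ L) (ends D' (length P + a') (level D')) (A @ M)"
      using lev' T(4) A(1) by (simp add: ends_append_eq D)
    then show ?thesis
      unfolding cut_rel_shift[OF len(2)] by simp
  qed
  have endform: "\<exists>x y. ends E c (level E) = (x, y, y, x)" if "diagram_crossing E c q b''" for E c q b''
  proof -
    interpret diagram_crossing E c q b'' by (rule that)
    have "val (level E) = colour_at E" by (auto simp: val_def colour_at_def)
    then show ?thesis by (simp add: ends_def end_colours)
  qed
  have colours: "ends D' (length P + a') (level D') = turn_ends opp \<rho> (ends D (length P + a) (level D))"
  proof -
    have v: "valuation opp {length P + a} D (level D)"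
      using valuation_level(1)[OF vl_runs[OF D(3)]] by (rule valuation_mono) simp
    have "cut_rel opp t a L (ends D (length P + a) (level D)) M"
      using cut[OF v, of A L M] lev(3,4)[of Q] A(1) D by simp
    with cut' show ?thesis
      using endform[OF X(1)] endform[OF X(2)] inner_colours[OF inn] by metis
  qed
  have "\<exists>s'. valuation id {length P + a'} D' s' \<and> s' 0 = [] \<and>
        ends D' (length P + a') s' = turn_ends id \<rho> (ends D (length P + a) s) \<and>
        (\<forall>F T. (\<forall>a b. F (opp a, b) = opp (F (a, b))) \<longrightarrow> joined opp D (length P + a) T (decorate D F s) \<longrightarrow>
           joined opp D' (length P + a') (T \<noteq> quarter \<rho>) (decorate D' F s') \<longrightarrow>
           vl_diagram (smoothing D (length P + a) T (decorate D F s)) \<longrightarrow>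
           flat_equiv (smoothing D (length P + a) T (decorate D F s)) (smoothing D' (length P + a') (T \<noteq> quarter \<rho>) (decorate D' F s')))"
    if s: "valuation id {length P + a} D s" "s 0 = []" for s :: "nat \<Rightarrow> bool list"
  proof -
    have sl: "length (s k) = length (level D k)" if "k \<le> length D" for k
      using valuation_shape[OF vl_runs[OF D(3)] s that] .
    obtain B N where BN: "s (length P) = B @ N" "length B = p"
      using sl[of "length P"] lev(3)[of Q] A(1) D
      by (metis append_take_drop_id length_take min_absorb2 le_add1 length_append)
    have sT: "valuation id {a} ?T (\<lambda>k. s (length P + k))"
    proof -
      have "valuation id {k. length P + k \<in> {length P + a}} ?T (\<lambda>k. s (length P + k))"
        using s(1) unfolding D valuation_append by blast
      then show ?thesis by simp
    qed
    have "cut_rel id ?T a (s (length P)) (ends D (length P + a) s) (s (length P + length t))"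
      using cut_split[OF T(3,1) sT] T(3) by (simp add: ends_append_eq D)
    then obtain N' where N': "s (length P + length t) = B @ N'" "cut_rel id t a N (ends D (length P + a) s) N'"
      using cut_rel_shift[OF len(1), of id B N] BN by auto
    from inner_transfer[OF inn N'(2)] have "cut_rel id ?T' a' (s (length P)) (turn_ends id \<rho> (ends D (length P + a) s)) (s (length P + length t))"
      using cut_rel_shift[OF len(2), of id B N] BN N'(1) by auto
    from cut_join[OF T(4,2) this] obtain w where
      w: "valuation id {a'} ?T' w" "w 0 = s (length P)" "w (length ?T') = s (length P + length t)"
        "ends ?T' a' w = turn_ends id \<rho> (ends D (length P + a) s)" by auto
    \<comment> \<open>Outside the tangle the values are kept; inside, \<open>w\<close> is the
      valuation whose values at the ends of \<open>a'\<close> are the turned ones of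
      \<open>a\<close>.\<close>
    define s' where "s' = glue (length P) (length ?T') s w (\<lambda>k. s (length P + length ?T + k))"
    have ss: "k \<le> length P \<Longrightarrow> s' k = s k" "k \<le> length ?T' \<Longrightarrow> s' (length P + k) = w k"
      "s' (length P + (length ?T' + k)) = s (length P + length ?T + k)" for k
      unfolding s'_def using w by (simp_all add: glue_simps)
    have split: "valuation id {length P + a} P s" "valuation id {k. length P + (length ?T + k) \<in> {length P + a}} Q (\<lambda>k. s (length P + (length ?T + k)))"
      using s(1) unfolding D valuation_append by auto
    have "valuation id {length P + a'} (P @ ?T' @ Q) s'"
      unfolding s'_def
    proof (rule valuation_glue)
      show "valuation id {length P + a'} P s"
        by (rule valuation_cong[THEN iffD1, rotated 2, OF split(1)]) auto
      show "valuation id {k. length P + k \<in> {length P + a'}} ?T' w"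
        using w(1) by simp
      show "valuation id {k. length P + length ?T' + k \<in> {length P + a'}} Q (\<lambda>k. s (length P + length ?T + k))"
        by (rule valuation_cong[THEN iffD1, rotated 2, OF split(2)]) (use len in \<open>auto simp: add.assoc\<close>)
    qed (use w in simp_all)
    then have s': "valuation id {length P + a'} D' s'" by (simp add: D)
    have e': "ends D' (length P + a') s' = turn_ends id \<rho> (ends D (length P + a) s)"
    proof -
      have "ends D' (length P + a') s' = ends ?T' a' (\<lambda>k. s' (length P + k))"
        using T(4) by (simp add: D ends_append_eq)
      also have "\<dots> = ends ?T' a' w"
        using T(4) ss(2)[of a'] ss(2)[of "Suc a'"] by (simp add: ends_def val_def BL_def BR_def TL_def TR_def)
      finally show ?thesis using w(4) by simp
    qed
    have "flat_equiv (smoothing D (length P + a) S (decorate D F s)) (smoothing D' (length P + a') (S \<noteq> quarter \<rho>) (decorate D' F s'))"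
      if F: "\<forall>a b. F (opp a, b) = opp (F (a, b))" and j: "joined opp D (length P + a) S (decorate D F s)"
        "joined opp D' (length P + a') (S \<noteq> quarter \<rho>) (decorate D' F s')"
        and vl: "vl_diagram (smoothing D (length P + a) S (decorate D F s))" for F S
    proof -
      define v v' where "v = decorate D F s" and "v' = decorate D' F s'"
      have val: "valuation opp {length P + a} D v" "valuation opp {length P + a'} D' v'"
        unfolding v_def v'_def using F s s' ss(1)[of 0]
        by (auto intro!: diagram_crossing.valuation_decorate[OF X(1)] diagram_crossing.valuation_decorate[OF X(2)])
      have v0: "v 0 = []" by (simp add: v_def decorate_def)
      have vv: "k \<le> length P \<Longrightarrow> v' k = v k" "v' (length P + length ?T' + k) = v (length P + length ?T + k)" for k
        using ss(1)[of k] ss(3)[of k] lev(1)[of k Q] lev(2)[of Q k] D by (simp_all add: v_def v'_def decorate_def add.assoc)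
      have wT: "valuation opp {a} ?T (\<lambda>k. v (length P + k))" "valuation opp {a'} ?T' (\<lambda>k. v' (length P + k))"
      proof -
        have "valuation opp {k. length P + k \<in> {length P + a}} ?T (\<lambda>k. v (length P + k))"
          "valuation opp {k. length P + k \<in> {length P + a'}} ?T' (\<lambda>k. v' (length P + k))"
          using val unfolding D valuation_append by blast+
        then show "valuation opp {a} ?T (\<lambda>k. v (length P + k))" "valuation opp {a'} ?T' (\<lambda>k. v' (length P + k))"
          by simp_all
      qed
      define u u' where "u = smoothing ?T a S (\<lambda>k. v (length P + k))" and "u' = smoothing ?T' a' (S \<noteq> quarter \<rho>) (\<lambda>k. v' (length P + k))"
      have ru: "runs u (v (length P)) (v (length P + length t))"
        using runs_smoothing[OF wT(1) T(3,1)] j(1) T(3) unfolding u_def v_def D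
        by (simp add: joined_append)
      have "runs u' (v' (length P)) (v' (length P + length t'))"
        using runs_smoothing[OF wT(2) T(4,2)] j(2) T(4) unfolding u'_def v'_def D
        by (simp add: joined_append)
      then have ru': "runs u' (v (length P)) (v (length P + length t))"
        using vv(1)[of "length P"] vv(2)[of 0] by simp
      \<comment> \<open>Shifting back by \<open>p\<close> removes the strands to the left of the
        tangle, for which the local comparison makes no assumption.\<close>
      have "skeleton u = shift p (skeleton (smoothed t a S))" "skeleton u' = shift p (skeleton (smoothed t' a' (S \<noteq> quarter \<rho>)))"
        using T(3,4) len by (simp_all add: u_def u'_def skeleton_smoothing skeleton_shift_smoothed)
      then obtain u0 u0' where u0: "u = shift p u0" "skeleton u0 = skeleton (smoothed t a S)"
        "u' = shift p u0'" "skeleton u0' = skeleton (smoothed t' a' (S \<noteq> quarter \<rho>))"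
        using skeleton_unshift by metis
      have "length (v (length P)) = length (level D (length P))"
        using valuation_shape[OF vl_runs[OF D(3)] val(1) v0, of "length P"] D by simp
      then obtain C K where CK: "v (length P) = C @ K" "length C = p"
        using lev(3)[of Q] A(1) D
        by (metis append_take_drop_id length_take min_absorb2 le_add1 length_append)
      obtain K' where K': "v (length P + length t) = C @ K'" "runs u0 K K'"
        using ru CK u0(1) runs_shift[of C u0 K] by auto
      have "runs u0' K K'"
        using ru' CK u0(3) K'(1) runs_shift[of C u0' K] by auto
      from inner_flat[OF inn ta u0(2,4) K'(2) this] have fl: "flat_local K u0 u0'" .
      have "valuation opp {length P + a} P v"
        using val(1) unfolding D valuation_append by blast
      then have "valuation opp {} P v"
        by (rule valuation_cong[THEN iffD1, rotated 2]) auto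
      from runs_paint[OF this] have rP: "runs (paint v P) [] (C @ K)"
        using CK v0 by simp
      have "smoothing D (length P + a) S v = paint v P @ shift p u0 @ paint (\<lambda>k. v (length P + length ?T + k)) Q"
        using smoothing_append[OF T(3), of P Q S v] u0(1) by (simp add: D u_def)
      moreover have "smoothing D' (length P + a') (S \<noteq> quarter \<rho>) v' = paint v P @ shift p u0' @ paint (\<lambda>k. v (length P + length ?T + k)) Q"
        using smoothing_append[OF T(4), of P Q "S \<noteq> quarter \<rho>" v'] u0(3) paint_agree[of P v' v] vv
        by (simp add: D u'_def)
      ultimately show ?thesis
        using flat_localD[OF fl CK(2) rP] vl unfolding v_def[symmetric] v'_def[symmetric] by simp
    qed
    then show ?thesis
      using s' e' ss(1)[of 0] s(2) by (intro exI[of _ s']) simp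
  qed
  then show ?thesis
    unfolding similar_def using X ta'(2) colours n by blast
qed

lemma smoothing_cong:
  assumes "\<And>k. k \<le> length X \<Longrightarrow> v k = w k" "a < length X"
  shows "smoothing X a S v = smoothing X a S w"
proof -
  have "paint v (take a X) = paint w (take a X)"
    by (rule paint_cong) (use assms in auto)
  moreover have "paint (\<lambda>k. v (Suc a + k)) (drop (Suc a) X) = paint (\<lambda>k. w (Suc a + k)) (drop (Suc a) X)"
    by (rule paint_cong) (use assms in auto)
  moreover have "val v (TL X a) = val w (TL X a)"
    using assms(1)[of "Suc a"] assms(2) by (simp add: val_def TL_def)
  ultimately show ?thesis
    by (simp add: smoothing_def)
qed

text \<open>The smoothing takes place away from the tangle and merely recolours it, so the same kind
  of move connects the smoothed diagrams.\<close>

lemma similar_outer: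
  assumes el: "elementary kd t t' J"
    and D: "D = P @ shift p t @ Q" "D' = P @ shift p t' @ Q" "vl_diagram D" "vl_diagram D'"
    and pos: "c < length P \<and> c' = c \<or> (\<exists>j<length Q. c = length P + length t + j \<and> c' = length P + length t' + j)"
    and Dc: "D ! c = (pc, Cross (Classical b))"
  shows "similar D c D' c' Straight"
proof -
  let ?T = "shift p t" and ?T' = "shift p t'"
  obtain A L M where A: "length A = p" "runs P [] (A @ L)" "runs t L M" "runs t' L M"
    using elementary_replace(1)[OF el] D by blast
  have n: "ncomp D' = ncomp D"
    using elementary_replace(2)[OF el] D by blast
  have Dc': "D' ! c' = (pc, Cross (Classical b))" and cl: "c < length D" "c' < length D'"
    using pos Dc D by (auto simp: nth_append)
  have X: "diagram_crossing D c pc b" "diagram_crossing D' c' pc b"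
    using D Dc Dc' cl by (auto simp: diagram_crossing_def)
  have r: "runs P [] (A @ L)" "runs ?T (A @ L) (A @ M)" "runs ?T' (A @ L) (A @ M)"
    using A by (auto simp: runs_shift)
  note lev = level_replace[OF r, folded D(1,2)]
  have ends_agree: "ends D' c' g' = ends D c g"
    if "\<And>k. k \<le> length P \<Longrightarrow> g' k = g k" "\<And>k. k \<le> length Q \<Longrightarrow> g' (length P + length ?T' + k) = g (length P + length ?T + k)"
    for g g' :: "nat \<Rightarrow> 'z list"
  proof -
    have "g' c' = g c \<and> g' (Suc c') = g (Suc c)"
      using pos
    proof
      assume "c < length P \<and> c' = c"
      then show ?thesis using that(1)[of c] that(1)[of "Suc c"] by simp
    next
      assume "\<exists>j<length Q. c = length P + length t + j \<and> c' = length P + length t' + j"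
      then obtain j where "j < length Q" "c = length P + length t + j" "c' = length P + length t' + j" by blast
      then show ?thesis using that(2)[of j] that(2)[of "Suc j"] by simp
    qed
    then show ?thesis
      by (simp add: ends_def val_def BL_def BR_def TL_def TR_def Dc Dc')
  qed
  have levQ: "level D' (length P + length ?T' + k) = level D (length P + length ?T + k)" for k
    using lev(2)[of Q k] D by simp
  have colours: "ends D' c' (level D') = turn_ends opp Straight (ends D c (level D))"
    using ends_agree[of "level D'" "level D"] lev(1)[of _ Q] levQ D by (simp add: ends_def)
  have uncutT: "valuation \<tau> {} ?T (\<lambda>k. g (length P + k))" if "valuation \<tau> {c} D g" for \<tau> and g :: "nat \<Rightarrow> 'z list"
  proof -
    have "valuation \<tau> {k. length P + k \<in> {c}} ?T (\<lambda>k. g (length P + k))"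
      using that unfolding D valuation_append by blast
    then show ?thesis
      by (rule valuation_cong[THEN iffD1, rotated 2]) (use pos in auto)
  qed
  have uncutT': "valuation \<tau> {} ?T' (\<lambda>k. g (length P + k))" if "valuation \<tau> {c'} D' g" for \<tau> and g :: "nat \<Rightarrow> 'z list"
  proof -
    have "valuation \<tau> {k. length P + k \<in> {c'}} ?T' (\<lambda>k. g (length P + k))"
      using that unfolding D valuation_append by blast
    then show ?thesis
      by (rule valuation_cong[THEN iffD1, rotated 2]) (use pos in auto)
  qed
  have "\<exists>s'. valuation id {c'} D' s' \<and> s' 0 = [] \<and>
        ends D' c' s' = turn_ends id Straight (ends D c s) \<and>
        (\<forall>F T. (\<forall>a b. F (opp a, b) = opp (F (a, b))) \<longrightarrow> joined opp D c T (decorate D F s) \<longrightarrow>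
           joined opp D' c' (T \<noteq> quarter Straight) (decorate D' F s') \<longrightarrow>
           vl_diagram (smoothing D c T (decorate D F s)) \<longrightarrow>
           flat_equiv (smoothing D c T (decorate D F s)) (smoothing D' c' (T \<noteq> quarter Straight) (decorate D' F s')))"
    if s: "valuation id {c} D s" "s 0 = []" for s :: "nat \<Rightarrow> bool list"
  proof -
    have sl: "length (s k) = length (level D k)" if "k \<le> length D" for k
      using valuation_shape[OF vl_runs[OF D(3)] s that] .
    obtain B N where BN: "s (length P) = B @ N" "length B = p"
      using sl[of "length P"] lev(3)[of Q] A(1) D
      by (metis append_take_drop_id length_take min_absorb2 le_add1 length_append)
    have "tangle_rel id ?T (s (length P)) (s (length P + length t))"
      using tangle_relI[OF uncutT[OF s(1)]] by simp
    then obtain N' where N': "s (length P + length t) = B @ N'" "tangle_rel id t N N'"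
      using tangle_rel_shift[of id B t N] BN by auto
    have "tangle_rel id ?T' (s (length P)) (s (length P + length t))"
      using tangle_rel_shift[of id B t' N] BN N' elementary_transfer[OF el N'(2)] by auto
    then obtain w where w: "valuation id {} ?T' w" "w 0 = s (length P)" "w (length ?T') = s (length P + length t)"
      using tangle_relE by blast
    define s' where "s' = glue (length P) (length ?T') s w (\<lambda>k. s (length P + length ?T + k))"
    have ss: "k \<le> length P \<Longrightarrow> s' k = s k" "k \<le> length ?T' \<Longrightarrow> s' (length P + k) = w k"
      "s' (length P + (length ?T' + k)) = s (length P + length ?T + k)" for k
      unfolding s'_def using w by (simp_all add: glue_simps)
    have split: "valuation id {c} P s" "valuation id {k. length P + (length ?T + k) \<in> {c}} Q (\<lambda>k. s (length P + (length ?T + k)))"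
      using s(1) unfolding D valuation_append by auto
    have "valuation id {c'} (P @ ?T' @ Q) s'"
      unfolding s'_def
    proof (rule valuation_glue)
      show "valuation id {c'} P s"
        by (rule valuation_cong[THEN iffD1, rotated 2, OF split(1)]) (use pos in auto)
      show "valuation id {k. length P + k \<in> {c'}} ?T' w"
        using w(1) by (rule valuation_mono) simp
      show "valuation id {k. length P + length ?T' + k \<in> {c'}} Q (\<lambda>k. s (length P + length ?T + k))"
        by (rule valuation_cong[THEN iffD1, rotated 2, OF split(2)]) (use pos in \<open>auto simp: add.assoc\<close>)
    qed (use w in simp_all)
    then have s': "valuation id {c'} D' s'" by (simp add: D)
    have e': "ends D' c' s' = turn_ends id Straight (ends D c s)"
      using ends_agree[of s' s] ss by (simp add: ends_def add.assoc)
    have "flat_equiv (smoothing D c S (decorate D F s)) (smoothing D' c' S (decorate D' F s'))"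
      if F: "\<forall>a b. F (opp a, b) = opp (F (a, b))" and j: "joined opp D c S (decorate D F s)"
        and vl: "vl_diagram (smoothing D c S (decorate D F s))" for F S
    proof -
      define v v' where "v = decorate D F s" and "v' = decorate D' F s'"
      have val: "valuation opp {c} D v" "valuation opp {c'} D' v'"
        unfolding v_def v'_def using F s s' ss(1)[of 0]
        by (auto intro!: diagram_crossing.valuation_decorate[OF X(1)] diagram_crossing.valuation_decorate[OF X(2)])
      have v0: "v 0 = []" by (simp add: v_def decorate_def)
      have vv: "k \<le> length P \<Longrightarrow> v' k = v k" "v' (length P + length ?T' + k) = v (length P + length ?T + k)" for k
        using ss(1)[of k] ss(3)[of k] lev(1)[of k Q] lev(2)[of Q k] D by (simp_all add: v_def v'_def decorate_def add.assoc)
      define u u' where "u = paint (\<lambda>k. v (length P + k)) ?T" and "u' = paint (\<lambda>k. v' (length P + k)) ?T'"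
      have ru: "runs u (v (length P)) (v (length P + length t))"
        using runs_paint[OF uncutT[OF val(1)]] by (simp add: u_def)
      have ru': "runs u' (v (length P)) (v (length P + length t))"
        using runs_paint[OF uncutT'[OF val(2)]] vv(1)[of "length P"] vv(2)[of 0] by (simp add: u'_def)
      obtain u0 u0' where u0: "u = shift p u0" "skeleton u0 = skeleton t" "u' = shift p u0'" "skeleton u0' = skeleton t'"
        using skeleton_unshift[of u p t] skeleton_unshift[of u' p t'] by (auto simp: u_def u'_def skeleton_shift)
      have "length (v (length P)) = length (level D (length P))"
        using valuation_shape[OF vl_runs[OF D(3)] val(1) v0, of "length P"] D by simp
      then obtain C K where CK: "v (length P) = C @ K" "length C = p"
        using lev(3)[of Q] A(1) D
        by (metis append_take_drop_id length_take min_absorb2 le_add1 length_append)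
      obtain K' where K': "v (length P + length t) = C @ K'" "runs u0 K K'"
        using ru CK u0(1) runs_shift[of C u0 K] by auto
      have K'': "runs u0' K K'"
        using ru' CK u0(3) K'(1) runs_shift[of C u0' K] by auto
      \<comment> \<open>The recoloured tangles have the skeletons of \<open>t\<close> and
        \<open>t'\<close> and equal boundary colours, so they are again the two sides of a
        move.\<close>
      have fl: "flat_local K u0 u0'"
        using flat_local_elementary[OF elementary_skeleton[OF el u0(2,4) K'(2) K''] K'(2) K''] .
      have Pc: "valuation opp {c} P v"
        using val(1) unfolding D valuation_append by blast
      show ?thesis
        using pos
      proof
        assume c: "c < length P \<and> c' = c"
        have sm: "smoothing D c S v = smoothing P c S v @ u @ paint (\<lambda>k. v (length P + length ?T + k)) Q"
          using smoothing_append[of c P "[]" "?T @ Q" S v] c by (simp add: D u_def paint_append paint_def[of _ "[]"] add.assoc)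
        have "smoothing D' c' S v' = smoothing P c S v' @ u' @ paint (\<lambda>k. v' (length P + length ?T' + k)) Q"
          using smoothing_append[of c P "[]" "?T' @ Q" S v'] c by (simp add: D u'_def paint_append paint_def[of _ "[]"] add.assoc)
        also have "smoothing P c S v' = smoothing P c S v"
          by (rule smoothing_cong) (use vv(1) c in auto)
        finally have sm': "smoothing D' c' S v' = smoothing P c S v @ u' @ paint (\<lambda>k. v (length P + length ?T + k)) Q"
          using vv(2) by simp
        have "P ! c = (pc, Cross (Classical b))"
          using Dc D c by (simp add: nth_append)
        moreover have "joined opp P c S v"
          using j c joined_append[of c P opp "[]" "?T @ Q" S v] by (simp add: D v_def)
        ultimately have "runs (smoothing P c S v) [] (C @ K)"
          using runs_smoothing[OF Pc] c v0 CK(1) by simp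
        then show ?thesis
          using flat_localD[OF fl CK(2)] vl unfolding v_def[symmetric] v'_def[symmetric] sm sm' u0 by blast
      next
        assume "\<exists>j<length Q. c = length P + length t + j \<and> c' = length P + length t' + j"
        then obtain i where i: "i < length Q" "c = length P + length t + i" "c' = length P + length t' + i" by blast
        have sm: "smoothing D c S v = paint v P @ u @ smoothing Q i S (\<lambda>k. v (length P + length ?T + k))"
          using smoothing_append[of i Q "P @ ?T" "[]" S v] i by (simp add: D u_def paint_append paint_def[of _ "[]"] add.assoc)
        have "smoothing D' c' S v' = paint v' P @ u' @ smoothing Q i S (\<lambda>k. v' (length P + length ?T' + k))"
          using smoothing_append[of i Q "P @ ?T'" "[]" S v'] i by (simp add: D u'_def paint_append paint_def[of _ "[]"] add.assoc)
        also have "paint v' P = paint v P"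
          by (rule paint_agree) (use vv(1) in auto)
        finally have sm': "smoothing D' c' S v' = paint v P @ u' @ smoothing Q i S (\<lambda>k. v (length P + length ?T + k))"
          using vv(2) by simp
        have "valuation opp {} P v"
          by (rule valuation_cong[THEN iffD1, rotated 2, OF Pc]) (use i in auto)
        from runs_paint[OF this] have "runs (paint v P) [] (C @ K)"
          using CK v0 by simp
        then show ?thesis
          using flat_localD[OF fl CK(2)] vl unfolding v_def[symmetric] v'_def[symmetric] sm sm' u0 by blast
      qed
    qed
    then show ?thesis
      using s' e' ss(1)[of 0] s(2) by (intro exI[of _ s']) (simp add: quarter_def)
  qed
  then show ?thesis
    unfolding similar_def using X colours n by (metis turn_mark.simps(1))
qed

section \<open>The weight conditions\<close>

lemma move_similar:
  assumes "move k q U I D D'" "(c, c') \<in> U \<union> I" "c \<in> crossings D"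
  shows "\<exists>\<rho>. similar D c D' c' \<rho>"
proof -
  obtain t t' J pre p post where el: "elementary k t t' J" and q: "q = length pre"
    and D: "D = pre @ shift p t @ post" "D' = pre @ shift p t' @ post" "vl_diagram D" "vl_diagram D'"
    and U: "U = {(c, c) | c. c < q} \<union> {(q + length t + r, q + length t' + r) | r. r < length post}"
    and I: "I = {(q + a, q + b) | a b. (a, b) \<in> J}"
    using assms(1) unfolding move_def by blast
  obtain pc b where c: "c < length D" "D ! c = (pc, Cross (Classical b))"
    using assms(3) by (auto simp: crossings_def)
  show ?thesis
  proof (cases "(c, c') \<in> U")
    case True
    then show ?thesis
      using similar_outer[OF el D _ c(2), of c'] unfolding U q by auto
  next
    case False
    then obtain a a' where a: "c = length pre + a" "c' = length pre + a'" "(a, a') \<in> J"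
      using assms(2) unfolding I q by auto
    have "a < length t" using el a(3) by cases auto
    then have ta: "t ! a = (pc - p, Cross (Classical b))"
      using c(2) a(1) D(1) by (auto simp: nth_append shift_def case_prod_unfold prod_eq_iff)
    then obtain \<rho> where inn: "inner t a t' a' \<rho>"
      using inner_elementary[OF el a(3)] by blast
    obtain A L M where A: "length A = p" "runs pre [] (A @ L)" "runs t L M" "runs t' L M"
      using elementary_replace(1)[OF el] D by blast
    show ?thesis
      using similar_inner[OF inn ta D A] elementary_replace(2)[OF el] D a by blast
  qed
qed

text \<open>Evenness compares two crossings of one diagram. Hence both diagrams in
  \<open>similar_inner\<close> are \<open>D\<close>, and the two crossings of the bigon correspond
  to each other.\<close>

lemma bigon_similar:
  assumes "move RII q U I D D'"
  shows "similar D q D (q + 1) Mirrored"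
proof -
  obtain t t' J pre p post where el: "elementary RII t t' J" and q: "q = length pre"
    and D: "D = pre @ shift p t @ post" "D' = pre @ shift p t' @ post" "vl_diagram D" "vl_diagram D'"
    using assms(1) unfolding move_def by blast
  obtain b where t: "t = [(0, Cross (Classical b)), (0, Cross (Classical (\<not> b)))]"
    using el by cases auto
  then have inn: "inner t 0 t 1 Mirrored"
    using inner.bigon[of "Classical b"] by simp
  obtain A L M where A: "length A = p" "runs pre [] (A @ L)" "runs t L M"
    using elementary_replace(1)[OF el] D by blast
  show ?thesis
    using similar_inner[OF inn _ D(1) D(1) D(3) D(3) A A(3)] t q by simp
qed

lemma self_mixed_iff: "c \<in> crossings D \<Longrightarrow> c \<in> mixed_crossings D \<longleftrightarrow> c \<notin> self_crossings D"
  by (auto simp: mixed_crossings_def self_crossings_def)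

lemma similar_self:
  assumes "similar D c D' c' \<rho>"
  shows "c' \<in> self_crossings D' \<longleftrightarrow> c \<in> self_crossings D" "c' \<in> mixed_crossings D' \<longleftrightarrow> c \<in> mixed_crossings D"
  using similar_weights(1-3)[OF assms] by (auto simp: self_crossings_def mixed_crossings_def)

lemma weight_conditions:
  assumes "\<And>D c D' c' \<rho>. similar D c D' c' \<rho> \<Longrightarrow> (D, c) \<in> A \<Longrightarrow> (D', c') \<in> A \<Longrightarrow> w D c = w D' c'"
    and "\<And>D c. (D, c) \<in> A \<Longrightarrow> c \<in> crossings D"
  shows "condition_C1 \<D> A w" "condition_C2 \<D> A w" "condition_C3 \<D> A w" "condition_even \<D> A w"
proof -
  have "w D c = w D' c'" if "move k q U I D D'" "(c, c') \<in> U \<union> I" "(D, c) \<in> A" "(D', c') \<in> A" for k q U I D D' c c'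
    using move_similar[OF that(1,2)] assms that(3,4) by blast
  then show "condition_C1 \<D> A w" "condition_C2 \<D> A w" "condition_C3 \<D> A w"
    unfolding condition_C1_def condition_C2_def condition_C3_def by blast+
  show "condition_even \<D> A w"
    unfolding condition_even_def using assms(1)[OF bigon_similar] by blast
qed

text \<open>Membership in \<open>A\<close> is invariant under \<open>similar\<close>, so its
  characteristic function is an even weight function, which is consistency; for the same reason the
  extension by zero stays invariant.\<close>

lemma weights:
  fixes w :: "diagram \<Rightarrow> nat \<Rightarrow> 'g::ab_group_add"
  assumes A: "\<And>D c. (D, c) \<in> A \<longleftrightarrow> D \<in> \<D> \<and> c \<in> C D" "\<And>D. C D \<subseteq> crossings D"
    and inv: "\<And>D c D' c' \<rho>. similar D c D' c' \<rho> \<Longrightarrow> c' \<in> C D' \<longleftrightarrow> c \<in> C D"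
    and w: "\<And>D c D' c' \<rho>. similar D c D' c' \<rho> \<Longrightarrow> c \<in> C D \<Longrightarrow> w D' c' = w D c"
  shows "even_weight_function_on \<D> A w" "even_weight_function \<D> (extend_zero A w)"
proof -
  have mem: "(D, c) \<in> A \<longleftrightarrow> (D', c') \<in> A"
    if "similar D c D' c' \<rho>" "(D, c) \<in> all_crossings \<D>" "(D', c') \<in> all_crossings \<D>" for D c D' c' \<rho>
    using inv[OF that(1)] that(2,3) A(1) by (auto simp: all_crossings_def)
  have cr: "c \<in> crossings D" if "(D, c) \<in> A" for D c
    using that A by blast
  have "even_weight_function \<D> (\<lambda>D c. if (D, c) \<in> A then 1 else (0::int))"
    unfolding even_weight_function_def
    by (intro conjI weight_conditions) (use mem in \<open>auto simp: all_crossings_def\<close>)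
  moreover have "A \<subseteq> all_crossings \<D>"
    using A by (auto simp: all_crossings_def)
  moreover have "w D c = w D' c'" if "similar D c D' c' \<rho>" "(D, c) \<in> A" for D c D' c' \<rho>
    using w[OF that(1)] that(2) A(1) by simp
  ultimately show "even_weight_function_on \<D> A w"
    unfolding even_weight_function_on_def consistent_def
    using cr by (intro conjI weight_conditions) blast+
  have "extend_zero A w D c = extend_zero A w D' c'"
    if "similar D c D' c' \<rho>" "(D, c) \<in> all_crossings \<D>" "(D', c') \<in> all_crossings \<D>" for D c D' c' \<rho>
    using mem[OF that] w[OF that(1)] A(1) by (auto simp: extend_zero_def)
  then show "even_weight_function \<D> (extend_zero A w)"
    unfolding even_weight_function_def
    by (intro conjI weight_conditions) (auto simp: all_crossings_def)
qed

section \<open>Crossings reducible by RI\<close>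

text \<open>A recolouring that reads nothing but the old colour acts on each layer by itself and
  therefore commutes with splitting and shifting words.\<close>

fun tint1 :: "(colour \<Rightarrow> colour) \<Rightarrow> layer \<Rightarrow> layer" where
  "tint1 h (p, Cup l d) = (p, Cup (fst (h (l, d))) (snd (h (l, d))))"
| "tint1 h (p, Cap) = (p, Cap)"
| "tint1 h (p, Cross m) = (p, Cross m)"

definition tint :: "(colour \<Rightarrow> colour) \<Rightarrow> diagram \<Rightarrow> diagram" where
  "tint h T = map (tint1 h) T"

lemma tint_simps [simp]: "tint h [] = []" "tint h (x # T) = tint1 h x # tint h T" "tint h (S @ T) = tint h S @ tint h T"
  "length (tint h T) = length T"
  by (simp_all add: tint_def)

lemma tint_id [simp]: "tint id T = T"
proof -
  have "tint1 id x = x" for x by (cases x; cases "snd x") auto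
  then show ?thesis by (simp add: tint_def map_idI)
qed

lemma tint_shift: "tint h (shift p T) = shift p (tint h T)"
proof (induction T)
  case (Cons x T)
  then show ?case by (cases x; cases "snd x") auto
qed simp

lemma skeleton_tint [simp]: "skeleton (tint h T) = skeleton T"
proof (induction T)
  case (Cons x T)
  then show ?case by (cases x; cases "snd x") auto
qed simp

lemma recolour_tint: "recolour (\<lambda>_. h) D = tint h D"
proof (rule nth_equalityI)
  fix j assume "j < length (recolour (\<lambda>_. h) D)"
  then show "recolour (\<lambda>_. h) D ! j = tint h D ! j"
    by (cases "D ! j"; cases "snd (D ! j)") (auto simp: recolour_def tint_def split: prod.split)
qed (simp add: recolour_def)

lemma runs_tint:
  assumes "runs T L M" "\<And>a. h (opp a) = opp (h a)"
  shows "runs (tint h T) (map h L) (map h M)"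
  using assms(1)
proof (induction T arbitrary: L)
  case (Cons x T)
  obtain K where K: "layer_rel opp False x L K" "paint1 x K = x" "runs T K M"
    using Cons.prems by (auto simp: runs.simps(2) simp del: runs_act)
  obtain p g where x: "x = (p, g)" by force
  have "layer_rel opp False (tint1 h x) (map h L) (map h K)"
    using layer_rel_map[OF K(1), of h opp] assms(2) layer_rel_paint1[of opp False "tint1 h x" "[]"]
    by (cases g) (auto simp: x layer_rel_def)
  moreover have "paint1 (tint1 h x) (map h K) = tint1 h x"
  proof (cases g)
    case (Cup l d)
    have "p < length K"
      using layer_rel_length(3)[OF K(1)] by (simp add: x Cup)
    moreover have "K ! p = (l, d)"
      using K(2) by (simp add: x Cup prod_eq_iff)
    ultimately show ?thesis by (simp add: x Cup)
  qed (auto simp: x)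
  ultimately show ?case
    using Cons.IH[OF K(3)] by (auto simp: runs.simps(2) simp del: runs_act)
qed simp

lemma paint_tint:
  assumes "valuation opp X T w" "paint w T = T"
  shows "paint (\<lambda>k. map h (w k)) T = tint h T"
proof (rule nth_equalityI)
  fix j assume "j < length (paint (\<lambda>k. map h (w k)) T)"
  then have j: "j < length T" by simp
  obtain p g where g: "T ! j = (p, g)" by force
  have "layer_rel opp (j \<in> X) (p, g) (w j) (w (Suc j))"
    using assms(1) j g by (auto simp: valuation_def)
  from layer_rel_length(3)[OF this] have p: "p + outs g \<le> length (w (Suc j))" by simp
  have "paint1 (p, g) (w (Suc j)) = (p, g)"
    using assms(2) j g by (metis nth_paint)
  then show "paint (\<lambda>k. map h (w k)) T ! j = tint h T ! j"
    using j p by (cases g) (auto simp: g tint_def)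
qed simp

section \<open>Moving and reversing a small circle\<close>

lemma flat_circle_slide: "flat_local (x # R) [(1, Cup l d), (1, Cap)] [(0, Cup l d), (0, Cap)]"
proof -
  let ?V = "Cross Virtual"
  have "flat_local (x # R) [(1, Cup l d), (1, Cap)] [(1, Cup l d), (0, ?V), (0, ?V), (1, Cap)]"
    using flat_local_context[OF flat_local_sym[OF flat_RII[of Virtual Virtual x "(l, d)" "(l, \<not> d) # R"]], of "[(1, Cup l d)]" "x # R" "[(1, Cap)]"]
    by simp
  also have "flat_local (x # R) \<dots> [(0, Cup l d), (1, ?V), (0, ?V), (1, Cap)]"
    using flat_local_context[OF flat_local_sym[OF flat_swing_cup[of x R l d Virtual]], of "[]" "x # R" "[(0, ?V), (1, Cap)]"]
    by simp
  also have "flat_local (x # R) \<dots> [(0, Cup l d), (1, ?V), (1, ?V), (0, Cap)]"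
    using flat_local_context[OF flat_local_sym[OF flat_swing_cap[of "(l, d)" x R Virtual]], of "[(0, Cup l d), (1, ?V)]" "x # R" "[]"]
    by simp
  also have "flat_local (x # R) \<dots> [(0, Cup l d), (0, Cap)]"
    using flat_local_context[OF flat_RII_offset[of Virtual Virtual "(l, d)" "(l, \<not> d)" x R], of "[(0, Cup l d)]" "x # R" "[(0, Cap)]"]
    by simp
  finally show ?thesis .
qed

text \<open>One strand is passed at a time: VRII lays it over the circle, the two virtual crossings
  are swung around the minimum and the maximum, and VRII takes them away on the other side.\<close>

lemma flat_circle_left: "p \<le> length L \<Longrightarrow> flat_local L [(p, Cup l d), (p, Cap)] [(0, Cup l d), (0, Cap)]"
proof (induction p arbitrary: L)
  case 0
  then show ?case by (simp add: flat_local_refl)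
next
  case (Suc p)
  then obtain x R where L: "L = x # R" by (cases L) auto
  then have "flat_local R [(p, Cup l d), (p, Cap)] [(0, Cup l d), (0, Cap)]"
    using Suc by simp
  from flat_local_offset[OF this, of x] have "flat_local L [(Suc p, Cup l d), (Suc p, Cap)] [(1, Cup l d), (1, Cap)]"
    by (simp add: L)
  also have "flat_local L \<dots> [(0, Cup l d), (0, Cap)]"
    unfolding L by (rule flat_circle_slide)
  finally show ?case .
qed

text \<open>A curl is created at the maximum by RI and absorbed at the minimum by its mirror image,
  which reverses the cup. Hence an added unknot may be given either orientation.\<close>

lemma flat_circle_reverse: "flat_local L [(0, Cup l d), (0, Cap)] [(0, Cup l d'), (0, Cap)]"
proof (cases "d' = d")
  case False
  have "flat_local L [(0, Cup l d), (0, Cap)] [(0, Cup l d), (0, Cross (Classical True)), (0, Cap)]"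
    using flat_local_context[OF flat_local_sym[OF flat_RI[of "(l, d)" L True]], of "[(0, Cup l d)]" L "[]"] by simp
  also have "flat_local L \<dots> [(0, Cup l (\<not> d)), (0, Cap)]"
    using flat_local_context[OF flat_RI_cup[of L l d True], of "[]" L "[(0, Cap)]"] by simp
  finally show ?thesis using False by (cases d; cases d') simp_all
qed (simp add: flat_local_refl)

text \<open>Each layer passes the circle by one interchange with its maximum and one with its
  minimum.\<close>

lemma flat_circle_up:
  assumes "runs T L M"
  shows "flat_local L ([(0, Cup l d), (0, Cap)] @ T) (T @ [(0, Cup l d), (0, Cap)])"
  using assms
proof (induction T arbitrary: L)
  case Nil
  then show ?case by (simp add: flat_local_refl)
next
  case (Cons x T)
  obtain r h where x: "x = (r, h)" by force
  obtain K where K: "runs [x] L K" "runs T K M"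
    using Cons.prems by (auto simp: runs.simps(2) simp del: runs_act)
  have 1: "runs [(0, Cap), (0 + outs Cap + r, h)] ((l, d) # (l, \<not> d) # L) K"
    using K(1) x by simp
  then have r1: "runs [(0 + ins Cap + r, h), (0, Cap)] ((l, d) # (l, \<not> d) # L) K"
    by (rule runs_interchange[THEN iffD1])
  have 2: "runs [(0 + ins (Cup l d) + r, h), (0, Cup l d)] L ((l, d) # (l, \<not> d) # K)"
    using K(1) x by simp
  then have r2: "runs [(0, Cup l d), (0 + outs (Cup l d) + r, h)] L ((l, d) # (l, \<not> d) # K)"
    by (rule runs_interchange[THEN iffD2])
  have "flat_local L [(0, Cup l d), (0, Cap), (r, h)] [(0, Cup l d), (2 + r, h), (0, Cap)]"
    using flat_local_context[OF flat_interchange[OF 1 r1], of "[(0, Cup l d)]" L "[]"] by simp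
  also have "flat_local L \<dots> [(r, h), (0, Cup l d), (0, Cap)]"
    using flat_local_context[OF flat_interchange[OF r2 2], of "[]" L "[(0, Cap)]"] by simp
  finally have "flat_local L ([(0, Cup l d), (0, Cap)] @ x # T) ([x] @ [(0, Cup l d), (0, Cap)] @ T)"
    using flat_local_context[of L "[(0, Cup l d), (0, Cap), (r, h)]" "[(r, h), (0, Cup l d), (0, Cap)]" "[]" L T] by (simp add: x)
  also have "flat_local L \<dots> ((x # T) @ [(0, Cup l d), (0, Cap)])"
    using flat_local_context[OF Cons.IH[OF K(2)] K(1), of "[]"] by simp
  finally show ?case .
qed

text \<open>\<open>C\<close> makes room for an added unknot. Validity is assumed of the combined
  word because \<open>tint h D\<close> alone may be invalid: recolouring for a kept loop vacates a
  label, which the circle in \<open>C\<close> restores.\<close>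

lemma flat_tint:
  assumes "move k q U I D D'" "\<And>a. h (opp a) = opp (h a)"
    "vl_diagram (tint h D @ C) \<or> vl_diagram (tint h D' @ C)"
  shows "flat_equiv (tint h D @ C) (tint h D' @ C)"
proof -
  obtain t t' J P p Q where el: "elementary k t t' J"
    and D: "D = P @ shift p t @ Q" "D' = P @ shift p t' @ Q" "vl_diagram D" "vl_diagram D'"
    using assms(1) unfolding move_def by blast
  obtain A L M where A: "length A = p" "runs P [] (A @ L)" "runs t L M" "runs t' L M"
    using elementary_replace(1)[OF el] D by blast
  note r = runs_tint[OF A(3), of h, OF assms(2)] runs_tint[OF A(4), of h, OF assms(2)]
  have "flat_local (map h L) (tint h t) (tint h t')"
    by (rule flat_local_elementary[OF elementary_skeleton[OF el _ _ r] r]) simp_all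
  moreover have "runs (tint h P) [] (map h A @ map h L)"
    using runs_tint[OF A(2), of h, OF assms(2)] by simp
  moreover have "tint h D @ C = tint h P @ shift (length (map h A)) (tint h t) @ (tint h Q @ C)"
    "tint h D' @ C = tint h P @ shift (length (map h A)) (tint h t') @ (tint h Q @ C)"
    using A(1) by (simp_all add: D tint_shift)
  ultimately show ?thesis
    using assms(3) unfolding flat_local_def flat_at_def by metis
qed

section \<open>Invariance along chains of isotopies\<close>

lemma move_ncomp: "move k q U I D D' \<Longrightarrow> ncomp D' = ncomp D"
  unfolding move_def using elementary_replace(2) by blast

lemma elementary_crossing:
  assumes "elementary k t t' J" "(a, a') \<in> J" "t' ! a' = (p, Cross (Classical b))"
  shows "\<exists>i b. t ! a = (i, Cross (Classical b))"
  using assms(1) by cases (use assms(2,3) in \<open>auto elim: swap_slope.elims\<close>)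

text \<open>A chain of isotopies may traverse moves backwards; then it is the crossing before the
  move that has to be recognized as classical.\<close>

lemma move_crossing:
  assumes "move k q U I D D'" "(c, c') \<in> U \<union> I" "c' \<in> crossings D'"
  shows "c \<in> crossings D"
proof -
  obtain t t' J pre p post where el: "elementary k t t' J" and q: "q = length pre"
    and D: "D = pre @ shift p t @ post" "D' = pre @ shift p t' @ post"
    and U: "U = {(c, c) | c. c < q} \<union> {(q + length t + r, q + length t' + r) | r. r < length post}"
    and I: "I = {(q + a, q + b) | a b. (a, b) \<in> J}"
    using assms(1) unfolding move_def by blast
  obtain pc b where c': "c' < length D'" "D' ! c' = (pc, Cross (Classical b))"
    using assms(3) by (auto simp: crossings_def)
  show ?thesis
  proof (cases "(c, c') \<in> U")
    case True
    then show ?thesis using c' by (auto simp: crossings_def U D q nth_append)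
  next
    case False
    then obtain a a' where a: "c = length pre + a" "c' = length pre + a'" "(a, a') \<in> J"
      using assms(2) unfolding I q by auto
    have len: "a < length t \<and> a' < length t'" using el a(3) by cases auto
    then have "t' ! a' = (pc - p, Cross (Classical b))"
      using c'(2) a(2) D(2) by (auto simp: nth_append shift_def case_prod_unfold prod_eq_iff)
    from elementary_crossing[OF el a(3) this] show ?thesis
      using len by (auto simp: crossings_def D a(1) nth_append shift_def)
  qed
qed

text \<open>Collects what the statements on RI need about a diagram. The last clause covers the
  diagram itself, its reversal in one component and its union with an unknot, for suitable
  \<open>h\<close> and \<open>C\<close>.\<close>

definition same_weights :: "diagram \<times> nat \<Rightarrow> diagram \<times> nat \<Rightarrow> bool" where
  "same_weights X Y \<longleftrightarrow> snd Y \<in> crossings (fst Y) \<and>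
     (\<forall>ov. strand_label (fst Y) (snd Y) ov = strand_label (fst X) (snd X) ov) \<and>
     (snd X \<in> self_crossings (fst X) \<longrightarrow> (\<forall>\<kappa>. S1 \<kappa> (fst Y) (snd Y) = S1 \<kappa> (fst X) (snd X) \<and>
        S2 \<kappa> (fst Y) (snd Y) = S2 \<kappa> (fst X) (snd X))) \<and>
     ncomp (fst Y) = ncomp (fst X) \<and>
     (\<forall>h C. (\<forall>a. h (opp a) = opp (h a)) \<longrightarrow> vl_diagram (tint h (fst Y) @ C) \<longrightarrow> flat_equiv (tint h (fst X) @ C) (tint h (fst Y) @ C))"

lemma same_weights_trans:
  assumes "same_weights X Y" "same_weights Y Z"
  shows "same_weights X Z"
proof -
  have "snd Y \<in> self_crossings (fst Y)" if "snd X \<in> self_crossings (fst X)"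
    using that assms(1) by (auto simp: same_weights_def self_crossings_def)
  moreover have "flat_equiv (tint h (fst X) @ C) (tint h (fst Z) @ C)"
    if "\<forall>a. h (opp a) = opp (h a)" "vl_diagram (tint h (fst Z) @ C)" for h C
  proof -
    have "flat_equiv (tint h (fst Y) @ C) (tint h (fst Z) @ C)"
      using assms(2) that unfolding same_weights_def by blast
    moreover from this have "vl_diagram (tint h (fst Y) @ C)"
      by (simp add: flat_equiv_def)
    ultimately show ?thesis
      using assms(1) that(1) flat_equiv_trans unfolding same_weights_def by blast
  qed
  ultimately show ?thesis
    using assms unfolding same_weights_def by simp
qed

lemma same_weights_step:
  assumes "isotopy_step X Y \<or> isotopy_step Y X" "snd X \<in> crossings (fst X)"
  shows "same_weights X Y"
  using assms(1)
proof
  assume "isotopy_step X Y"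
  then obtain q U I where m: "move Isotopy q U I (fst X) (fst Y)" "(snd X, snd Y) \<in> U \<union> I"
    by (auto simp: isotopy_step_def)
  obtain \<rho> where s: "similar (fst X) (snd X) (fst Y) (snd Y) \<rho>"
    using move_similar[OF m assms(2)] by blast
  show ?thesis
    unfolding same_weights_def
    using similar_weights[OF s] move_ncomp[OF m(1)] flat_tint[OF m(1)] by blast
next
  assume "isotopy_step Y X"
  then obtain q U I where m: "move Isotopy q U I (fst Y) (fst X)" "(snd Y, snd X) \<in> U \<union> I"
    by (auto simp: isotopy_step_def)
  have c: "snd Y \<in> crossings (fst Y)"
    using move_crossing[OF m assms(2)] .
  obtain \<rho> where s: "similar (fst Y) (snd Y) (fst X) (snd X) \<rho>"
    using move_similar[OF m c] by blast
  show ?thesis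
    unfolding same_weights_def
    using c similar_weights[OF s] similar_self[OF s] move_ncomp[OF m(1)] flat_tint[OF m(1)] flat_equiv_sym by metis
qed

lemma same_weights_isotopic:
  assumes "equivclp isotopy_step X Y" "snd X \<in> crossings (fst X)"
  shows "same_weights X Y"
  using assms(1)
proof (induction rule: equivclp_induct)
  case base
  then show ?case
    using assms(2) by (auto simp: same_weights_def flat_equiv_refl)
next
  case (step Y Z)
  have "snd Y \<in> crossings (fst Y)"
    using step.IH by (simp add: same_weights_def)
  then show ?case
    using same_weights_trans[OF step.IH] same_weights_step[of Y Z] step.hyps(2) by blast
qed

lemma decorate_const: "s k = map (\<lambda>_. \<beta>) (level D k) \<Longrightarrow> decorate D F s k = map (\<lambda>a. F (a, \<beta>)) (level D k)"
  by (simp add: decorate_def zip_map2 zip_same_conv_map)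

lemma flat_circle_away:
  assumes "runs T L M" "p \<le> length L"
  shows "flat_local L ([(p, Cup l d), (p, Cap)] @ T) (T @ [(0, Cup l d'), (0, Cap)])"
proof -
  have "flat_local L [(p, Cup l d), (p, Cap)] [(0, Cup l d'), (0, Cap)]"
    using flat_local_trans[OF flat_circle_left[OF assms(2)] flat_circle_reverse] .
  from flat_local_context[OF this, of "[]" L T] have "flat_local L ([(p, Cup l d), (p, Cap)] @ T) ([(0, Cup l d'), (0, Cap)] @ T)"
    by simp
  also have "flat_local L \<dots> (T @ [(0, Cup l d'), (0, Cap)])"
    by (rule flat_circle_up[OF assms(1)])
  finally show ?thesis .
qed

text \<open>The effect of type 2 away from the contracted loop: if the loop keeps its orientation,
  the rest of component \<open>i\<close> is reversed and becomes component \<open>n\<close>.\<close>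

definition rest_colour :: "bool \<Rightarrow> nat \<Rightarrow> nat \<Rightarrow> colour \<Rightarrow> colour" where
  "rest_colour kept n i = (if kept then (\<lambda>(l, e). if l = i then (n, \<not> e) else (l, e)) else id)"

lemma with_unknot_tint: "with_unknot kept D i d =
    tint (rest_colour kept (ncomp D + 1) i) D @ [(0, Cup (if kept then i else ncomp D + 1) d), (0, Cap)]"
  by (cases kept) (simp_all only: with_unknot_def add_unknot_def rest_colour_def recolour_tint if_True if_False tint_id)

text \<open>Below a maximum the strands of the crossing are antiparallel. So type 1 just deletes the
  crossing and gives \<open>D'\<close> up to a recolouring, while type 2 inserts a cap and a cup and
  cuts the loop off as a circle.\<close>

lemma RI_smoothing:
  assumes m: "move RI q U I D D'" and loop: "out_end D q over \<in> {TL D q, TR D q}"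
  defines "i \<equiv> strand_label D q over"
  shows "q \<in> self_crossings D"
    and "smooth1 \<kappa> D q = (if over = \<kappa> then reverse_component i D' else D')"
    and "flat_equiv (smooth2 \<kappa> D q) (with_unknot (over = \<kappa>) D' i d)"
proof -
  obtain t t' J P p Q where el: "elementary RI t t' J" and q: "q = length P"
    and D0: "D = P @ shift p t @ Q" "D' = P @ shift p t' @ Q" "vl_diagram D" "vl_diagram D'"
    using m unfolding move_def by blast
  obtain b where "t = [(0, Cross (Classical b)), (0, Cap)]" "t' = [(0, Cap)]"
    using el by cases auto
  then have D: "D = P @ [(p, Cross (Classical b)), (p, Cap)] @ Q" "D' = P @ [(p, Cap)] @ Q"
    using D0 by simp_all
  have n: "ncomp D' = ncomp D" using move_ncomp[OF m] .
  interpret X: diagram_crossing D q p b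
    using D0(3) by unfold_locales (auto simp: D q)
  define x y where "x = colour_at D (BL D q)" and "y = colour_at D (BR D q)"
  have vcol: "val (level D) = colour_at D" by (auto simp: val_def colour_at_def)
  have vl: "valuation opp {q} D (level D)"
    using valuation_level(1)[OF X.D_runs] by (rule valuation_mono) simp
  obtain A B where AB: "length A = p" "level D q = A @ [x, y] @ B" "level D (Suc q) = A @ [y, x] @ B"
    using valuation_cross[OF vl X.c X.Dc] by (auto simp: vcol x_def y_def X.end_colours)
  have "layer_rel opp False (p, Cap) (level D (Suc q)) (level D (Suc (Suc q)))"
    using valuation_level(1)[OF X.D_runs] unfolding D q valuation_append
    by (simp add: valuation_Cons)
  then obtain A' z B' where A': "length A' = p" "level D (Suc q) = A' @ [z, opp z] @ B'" "level D (Suc (Suc q)) = A' @ B'"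
    by (rule layer_relE) auto
  then have xy: "x = opp y" and lev2: "level D (Suc (Suc q)) = A @ B"
    using AB by auto
  have lab: "strand_label D q ov = fst y" for ov
    using X.strand_label_eq[of ov] xy by (auto simp: x_def y_def)
  then have i: "i = fst y" by (simp add: i_def)
  have self: "strand_label D q True = strand_label D q False" using lab by simp
  then show "q \<in> self_crossings D"
    using X.c X.Dc by (auto simp: self_crossings_def crossings_def)
  have par: "\<not> parallel D q"
    using xy by (simp add: parallel_def flip: x_def y_def)
  let ?F = "map (\<lambda>_. False)"
  have l1: "layer_rel id True (p, Cross (Classical b)) (?F A @ [False, False] @ ?F B) (?F A @ [True, True] @ ?F B)"
    and l2: "layer_rel id False (p, Cap) (?F A @ [True, True] @ ?F B) (?F A @ [] @ ?F B)"
    by (rule layer_relI; use AB in auto)+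
  \<comment> \<open>\<open>s\<close> is true on the loop only, that is, at the two points between
    the crossing and the maximum.\<close>
  define s where "s = glue q 2 (\<lambda>k. ?F (level D k)) (\<lambda>k. [?F (level D q), ?F A @ [True, True] @ ?F B, ?F (A @ B)] ! k)
    (\<lambda>k. ?F (level D (q + 2 + k)))"
  have "valuation id {q} (P @ [(p, Cross (Classical b)), (p, Cap)] @ Q)
    (glue (length P) (length [(p, Cross (Classical b)), (p, Cap)]) (\<lambda>k. ?F (level D k))
      (\<lambda>k. [?F (level D q), ?F A @ [True, True] @ ?F B, ?F (A @ B)] ! k) (\<lambda>k. ?F (level D (q + 2 + k))))"
  proof (rule valuation_glue)
    have *: "valuation id {q} D (\<lambda>k. ?F (level D k))"
      using valuation_const[OF vl] .
    show "valuation id {q} P (\<lambda>k. ?F (level D k))"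
      using * unfolding D valuation_append by blast
    have "valuation id {k. length P + (length [(p, Cross (Classical b)), (p, Cap)] + k) \<in> {q}} Q
        (\<lambda>k. ?F (level D (length P + (length [(p, Cross (Classical b)), (p, Cap)] + k))))"
      using * unfolding D(1) valuation_append by auto
    then show "valuation id {k. length P + length [(p, Cross (Classical b)), (p, Cap)] + k \<in> {q}} Q (\<lambda>k. ?F (level D (q + 2 + k)))"
      by (simp add: q)
    show "valuation id {k. length P + k \<in> {q}} [(p, Cross (Classical b)), (p, Cap)]
      (\<lambda>k. [?F (level D q), ?F A @ [True, True] @ ?F B, ?F (A @ B)] ! k)"
      using l1 l2 AB q by (simp add: valuation_Cons)
  qed (use q lev2 in simp_all)
  then have s: "valuation id {q} D s"
    by (simp add: s_def D q numeral_2_eq_2)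
  have s0: "s 0 = []"
    by (auto simp: s_def glue_def q AB)
  have outer: "k \<le> q \<Longrightarrow> s k = ?F (level D k)" "s (Suc (Suc (q + k))) = ?F (level D (Suc (Suc (q + k))))" for k
    by (auto simp: s_def glue_def)
  have sq: "s (Suc q) = ?F A @ [True, True] @ ?F B"
    by (simp add: s_def glue_def)
  have s_ends: "\<not> val s (BL D q)" "\<not> val s (BR D q)" "val s (TL D q)" "val s (TR D q)"
    using outer(1)[of q] sq AB by (simp_all add: val_def BL_def BR_def TL_def TR_def X.Dc nth_append)
  \<comment> \<open>A separating valuation has to be true on the arc leaving along
    \<open>\<kappa>\<close>. If the loop is the other arc, \<open>s\<close> is negated;
    \<open>\<beta>\<close> is the resulting value away from the loop.\<close>
  define \<beta> where "\<beta> = (over \<noteq> \<kappa>)"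
  define s' where "s' = (\<lambda>k. map (\<lambda>a. a \<noteq> \<beta>) (s k))"
  have s': "valuation id {q} D s'" "s' 0 = []"
    unfolding s'_def using valuation_map[OF s, of "\<lambda>a. a \<noteq> \<beta>" id] s0 by simp_all
  have val_s': "val s' e = (val s e \<noteq> \<beta>)" if "e \<in> points D" for e
    using that valuation_shape[OF X.D_runs s s0] by (auto simp: val_def s'_def points_def)
  have sxy: "snd (colour_at D (BL D q)) \<noteq> snd (colour_at D (BR D q))"
    using xy by (simp flip: x_def y_def)
  have "out_end D q over = (if b = over then TR D q else TL D q)" "out_end D q (\<not> over) = (if b = over then BR D q else BL D q)"
    using loop sxy by (auto simp: out_end_def X.rising BL_def BR_def TL_def TR_def split: if_splits)
  then have s_out: "val s (out_end D q over)" "\<not> val s (out_end D q (\<not> over))"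
    using s_ends by simp_all
  have sep: "X.separates \<kappa> s'"
    using s' s_out by (cases "over = \<kappa>") (auto simp: X.separates_def val_s' X.ends_points \<beta>_def)
  have outer': "k \<le> q \<Longrightarrow> s' k = map (\<lambda>_. \<beta>) (level D k)" "s' (Suc (Suc (q + k))) = map (\<lambda>_. \<beta>) (level D (Suc (Suc (q + k))))" for k
    using outer[of k] by (simp_all add: s'_def)
  have split: "valuation opp {q} P (level D)" "paint (level D) P = P"
    "valuation opp {k. Suc (Suc (q + k)) = q} Q (\<lambda>k. level D (Suc (Suc (q + k))))"
    "paint (\<lambda>k. level D (Suc (Suc (q + k)))) Q = Q"
  proof -
    show "valuation opp {q} P (level D)"
      using vl unfolding D valuation_append by blast
    show "valuation opp {k. Suc (Suc (q + k)) = q} Q (\<lambda>k. level D (Suc (Suc (q + k))))"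
      using vl unfolding D(1) valuation_append by (simp add: q)
    have "paint (level D) (P @ [(p, Cross (Classical b)), (p, Cap)] @ Q) = P @ [(p, Cross (Classical b)), (p, Cap)] @ Q"
      using valuation_level(2)[OF X.D_runs] D(1) by simp
    then show "paint (level D) P = P" "paint (\<lambda>k. level D (Suc (Suc (q + k)))) Q = Q"
      unfolding paint_append by (simp_all add: q paint_def[of _ "[_, _]"] upt_rec)
  qed
  \<comment> \<open>Away from the loop the valuation is constantly \<open>\<beta>\<close>, so the
    recolouring is a \<open>tint\<close>. The inserted cup begins at the top left end of the
    crossing, which has colour \<open>y\<close> and the value \<open>\<not> \<beta>\<close>.\<close>
  have shape: "smoothing D q T (decorate D F s') =
      tint (\<lambda>a. F (a, \<beta>)) P @ (if T then [(p, Cap), (p, Cup (fst (F (y, \<not> \<beta>))) (snd (F (y, \<not> \<beta>))))] else []) @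
      [(p, Cap)] @ tint (\<lambda>a. F (a, \<beta>)) Q" for T F
  proof -
    let ?v = "decorate D F s'"
    have "paint ?v P = paint (\<lambda>k. map (\<lambda>a. F (a, \<beta>)) (level D k)) P"
      by (rule paint_cong) (use outer'(1) in \<open>auto simp: q intro!: decorate_const\<close>)
    then have 1: "paint ?v P = tint (\<lambda>a. F (a, \<beta>)) P"
      using paint_tint[OF split(1,2)] by simp
    have "paint (\<lambda>k. ?v (Suc (Suc (q + k)))) Q = paint (\<lambda>k. map (\<lambda>a. F (a, \<beta>)) (level D (Suc (Suc (q + k))))) Q"
      by (rule paint_cong) (rule decorate_const, rule outer'(2))
    then have 2: "paint (\<lambda>k. ?v (Suc (Suc (q + k)))) Q = tint (\<lambda>a. F (a, \<beta>)) Q"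
      using paint_tint[OF split(3,4)] by simp
    have 3: "paint (\<lambda>k. ?v (Suc q + k)) ((p, Cap) # Q) = (p, Cap) # paint (\<lambda>k. ?v (Suc (Suc (q + k)))) Q"
      using paint_append[of "\<lambda>k. ?v (Suc q + k)" "[(p, Cap)]" Q] by (simp add: paint_def[of _ "[_]"])
    have "?v (Suc q) ! p = F (y, \<not> \<beta>)"
      using AB sq by (simp add: decorate_def s'_def nth_append)
    then have 4: "val ?v (TL D q) = F (y, \<not> \<beta>)"
      by (simp add: val_def TL_def X.Dc)
    have "take q D = P" "drop (Suc q) D = (p, Cap) # Q"
      by (simp_all add: D q)
    then show ?thesis
      unfolding smoothing_def Let_def 4 by (simp add: 1 2 3[simplified] X.Dc split: prod.split)
  qed
  show "smooth1 \<kappa> D q = (if over = \<kappa> then reverse_component i D' else D')"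
  proof -
    have "smooth1 \<kappa> D q = tint (\<lambda>a. colour1 i (a, \<beta>)) D'"
      using X.smooth1_eq[OF sep self] par shape[of False "colour1 i"] lab i by (simp add: D)
    moreover have "(\<lambda>a. colour1 i (a, \<beta>)) = (if over = \<kappa> then (\<lambda>(l, d). (l, if l = i then \<not> d else d)) else id)"
      by (auto simp: \<beta>_def fun_eq_iff)
    ultimately show ?thesis
      by (simp add: reverse_component_def recolour_tint)
  qed
  show "flat_equiv (smooth2 \<kappa> D q) (with_unknot (over = \<kappa>) D' i d)"
  proof -
    define F where "F = colour2 (ncomp D + 1) i"
    define h where "h = rest_colour (over = \<kappa>) (ncomp D + 1) i"
    have h: "(\<lambda>a. F (a, \<beta>)) = h"
      by (auto simp: F_def h_def rest_colour_def \<beta>_def fun_eq_iff)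
    have h_opp: "h (opp a) = opp (h a)" for a
      by (cases a) (simp add: h_def rest_colour_def)
    have Fy: "fst (F (y, \<not> \<beta>)) = (if over = \<kappa> then i else ncomp D + 1)"
      by (cases y) (simp add: F_def \<beta>_def i)
    \<comment> \<open>\<open>?d\<close> is the direction which the cut-off circle happens to have;
      the prescribed direction \<open>d\<close> is reached by reversing the circle.\<close>
    let ?d = "snd (F (y, \<not> \<beta>))" and ?l = "if over = \<kappa> then i else ncomp D + 1"
    have sm: "smooth2 \<kappa> D q = (tint h P @ [(p, Cap)]) @ ([(p, Cup ?l ?d), (p, Cap)] @ tint h Q) @ []"
    proof -
      have "smooth2 \<kappa> D q = smoothing D q (\<not> parallel D q) (decorate D F s')"
        using X.smooth2_eq[OF sep self] lab i by (simp add: F_def)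
      then show ?thesis
        using par shape[of True F] by (simp add: h Fy)
    qed
    obtain N K where K: "runs P [] N" "runs [(p, Cap)] N K" "runs Q K []"
      using vl_runs[OF D0(4)] unfolding D(2) runs_append by blast
    have "p \<le> length K"
      using layer_rel_length(3)[of opp False "(p, Cap)" N K] runs_tangle_rel[OF K(2)] by simp
    then have "flat_local (map h K) ([(p, Cup ?l ?d), (p, Cap)] @ tint h Q) (tint h Q @ [(0, Cup ?l d), (0, Cap)])"
      using flat_circle_away[OF runs_tint[OF K(3), of h, OF h_opp], of p] by simp
    moreover have "runs (tint h P @ [(p, Cap)]) [] (map h K)"
      using runs_tint[OF K(1), of h, OF h_opp] runs_tint[OF K(2), of h, OF h_opp] unfolding runs_append by auto
    moreover have "vl_diagram (smooth2 \<kappa> D q)"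
      using X.vl_smooth2(1)[OF sep self] .
    ultimately have "flat_equiv (smooth2 \<kappa> D q) ((tint h P @ [(p, Cap)]) @ (tint h Q @ [(0, Cup ?l d), (0, Cap)]) @ [])"
      using flat_localD[of "map h K" _ _ "[]" 0 "tint h P @ [(p, Cap)]" "[]"] unfolding sm by simp
    also have "(tint h P @ [(p, Cap)]) @ (tint h Q @ [(0, Cup ?l d), (0, Cap)]) @ [] = with_unknot (over = \<kappa>) D' i d"
    proof -
      have "with_unknot (over = \<kappa>) D' i d = tint h D' @ [(0, Cup ?l d), (0, Cap)]"
        by (simp only: with_unknot_tint n h_def)
      then show ?thesis by (simp add: D(2))
    qed
    finally show ?thesis .
  qed
qed

lemma vl_smoothings:
  assumes "vl_diagram D"
  shows "c \<in> self_crossings D \<Longrightarrow> vl_diagram (smooth1 \<kappa> D c)"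
    "c \<in> self_crossings D \<Longrightarrow> vl_diagram (smooth2 \<kappa> D c)"
    "c \<in> mixed_crossings D \<Longrightarrow> vl_diagram (smooth3 \<kappa> D c)"
proof -
  have X: "\<exists>p b. diagram_crossing D c p b" if "c \<in> self_crossings D \<or> c \<in> mixed_crossings D"
    using crossings_locale[OF assms] that by (auto simp: self_crossings_def mixed_crossings_def)
  show "vl_diagram (smooth1 \<kappa> D c)" "vl_diagram (smooth2 \<kappa> D c)" if self: "c \<in> self_crossings D"
  proof -
    obtain p b where "diagram_crossing D c p b" using X self by blast
    then interpret diagram_crossing D c p b .
    have eq: "strand_label D c True = strand_label D c False"
      using self by (simp add: self_crossings_def)
    obtain s where "separates \<kappa> s" using separates_exists[OF eq] by blast
    from vl_smooth1(1)[OF this eq] vl_smooth2(1)[OF this eq]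
    show "vl_diagram (smooth1 \<kappa> D c)" "vl_diagram (smooth2 \<kappa> D c)" .
  qed
  show "vl_diagram (smooth3 \<kappa> D c)" if mixed: "c \<in> mixed_crossings D"
  proof -
    obtain p b where "diagram_crossing D c p b" using X mixed by blast
    then interpret diagram_crossing D c p b .
    show ?thesis
      using vl_smooth3(1)[OF all_False] mixed by (simp add: mixed_crossings_def)
  qed
qed

text \<open>Isotopies lead to \<open>D1\<close>, where the loop is contractible by an elementary RI,
  and the move leads to \<open>D2\<close>. The smoothing is computed from \<open>D2\<close>, and the
  same chain, recoloured, leads back to \<open>D\<close>.\<close>

lemma RI_reducible:
  assumes vl: "vl_diagram D" and c: "c \<in> crossings D" and ri: "ri_reducible D c over"
  shows "c \<in> self_crossings D"
    and "S1 \<kappa> D c = flat_class D \<or> S1 \<kappa> D c = flat_class (reverse_component (strand_label D c over) D)"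
    and "S2 \<kappa> D c = flat_class (with_unknot (over = \<kappa>) D (strand_label D c over) d)"
proof -
  obtain D1 q U I D2 where iso: "equivclp isotopy_step (D, c) (D1, q)" and m: "move RI q U I D1 D2"
    and loop: "out_end D1 q over \<in> {TL D1 q, TR D1 q}"
    using ri unfolding ri_reducible_def by blast
  have sw: "same_weights (D, c) (D1, q)"
    using same_weights_isotopic[OF iso] c by simp
  define i where "i = strand_label D1 q over"
  have i: "strand_label D c over = i"
    using sw by (simp add: same_weights_def i_def)
  note R = RI_smoothing[OF m loop, folded i_def]
  show self: "c \<in> self_crossings D"
    using R(1) sw c by (auto simp: same_weights_def self_crossings_def)
  have S: "S1 \<kappa> D c = flat_class (smooth1 \<kappa> D1 q)" "S2 \<kappa> D c = flat_class (smooth2 \<kappa> D1 q)"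
    using sw self by (simp_all add: same_weights_def S1_def S2_def)
  have vl12: "vl_diagram D1" "vl_diagram D2"
    using m by (auto simp: move_def)
  have vls: "vl_diagram (smooth1 \<kappa> D1 q)"
    using vl_smoothings(1)[OF vl12(1) R(1)] .
  \<comment> \<open>Used with the reversal of component \<open>i\<close>, with the identity, and
    with \<open>rest_colour\<close> together with the added circle.\<close>
  have tint: "flat_equiv (tint h D @ C) (tint h D2 @ C)" if "\<And>a. h (opp a) = opp (h a)" "vl_diagram (tint h D2 @ C)" for h C
  proof -
    have 1: "flat_equiv (tint h D1 @ C) (tint h D2 @ C)"
      using flat_tint[OF m, of h C] that by blast
    then have "vl_diagram (tint h D1 @ C)" by (simp add: flat_equiv_def)
    then have "flat_equiv (tint h D @ C) (tint h D1 @ C)"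
      using sw that(1) unfolding same_weights_def fst_conv by blast
    with 1 show ?thesis by (rule flat_equiv_trans[rotated])
  qed
  show "S1 \<kappa> D c = flat_class D \<or> S1 \<kappa> D c = flat_class (reverse_component (strand_label D c over) D)"
  proof (cases "over = \<kappa>")
    case True
    let ?h = "\<lambda>(l, d). (l, if l = i then \<not> d else d)"
    have "vl_diagram (tint ?h D2)"
      using vls R(2)[of \<kappa>] True by (simp add: reverse_component_def recolour_tint)
    then have "flat_equiv (tint ?h D @ []) (tint ?h D2 @ [])"
      by (intro tint) auto
    then have "flat_class (reverse_component i D) = flat_class (reverse_component i D2)"
      by (intro flat_class_cong) (simp add: reverse_component_def recolour_tint)
    then show ?thesis
      using S(1) R(2)[of \<kappa>] True i by simp
  next
    case False
    have "flat_equiv (tint id D @ []) (tint id D2 @ [])"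
      by (intro tint) (simp_all add: vl12)
    then have "flat_class D = flat_class D2"
      by (intro flat_class_cong) simp
    then show ?thesis
      using S(1) R(2)[of \<kappa>] False by simp
  qed
  show "S2 \<kappa> D c = flat_class (with_unknot (over = \<kappa>) D (strand_label D c over) d)"
  proof -
    have n: "ncomp D2 = ncomp D"
      using move_ncomp[OF m] sw by (simp add: same_weights_def)
    have "vl_diagram (with_unknot (over = \<kappa>) D2 i d)"
      using R(3)[of \<kappa> d] by (simp add: flat_equiv_def)
    then have "flat_equiv (with_unknot (over = \<kappa>) D i d) (with_unknot (over = \<kappa>) D2 i d)"
      unfolding with_unknot_tint n by (intro tint) (auto simp: rest_colour_def)
    then have "flat_class (with_unknot (over = \<kappa>) D i d) = flat_class (smooth2 \<kappa> D1 q)"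
      using R(3)[of \<kappa> d] by (metis flat_class_cong)
    then show ?thesis
      using S(2) i by simp
  qed
qed

theorem theorem2:
  fixes \<D> :: "diagram set" and \<kappa>1 \<kappa>2 \<kappa>3 :: bool
  assumes "regular \<D>"
  shows
    "(\<forall>D\<in>\<D>.
        (\<forall>c\<in>self_crossings D. vl_diagram (smooth1 \<kappa>1 D c) \<and> vl_diagram (smooth2 \<kappa>2 D c)) \<and>
        (\<forall>c\<in>mixed_crossings D. vl_diagram (smooth3 \<kappa>3 D c))) \<and>
     even_weight_function_on \<D> (all_self_crossings \<D>) (S1 \<kappa>1) \<and>
     even_weight_function_on \<D> (all_self_crossings \<D>) (S2 \<kappa>2) \<and>
     even_weight_function_on \<D> (all_mixed_crossings \<D>) (S3 \<kappa>3) \<and>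
     even_weight_function \<D> (extend_zero (all_self_crossings \<D>) (S1 \<kappa>1)) \<and>
     even_weight_function \<D> (extend_zero (all_self_crossings \<D>) (S2 \<kappa>2)) \<and>
     even_weight_function \<D> (extend_zero (all_mixed_crossings \<D>) (S3 \<kappa>3)) \<and>
     (\<forall>D\<in>\<D>. \<forall>c\<in>crossings D. \<forall>over i.
        ri_reducible D c over \<and> i = strand_label D c over \<longrightarrow>
          (S1 \<kappa>1 D c = flat_class D \<or> S1 \<kappa>1 D c = flat_class (reverse_component i D)) \<and>
          (\<forall>d. S2 \<kappa>2 D c = flat_class (with_unknot (over = \<kappa>2) D i d)) \<and>
          c \<notin> mixed_crossings D)"
proof -
  have vl: "vl_diagram D" if "D \<in> \<D>" for D
    using assms that by (simp add: regular_def)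
  have A: "(D, c) \<in> all_self_crossings \<D> \<longleftrightarrow> D \<in> \<D> \<and> c \<in> self_crossings D"
    "(D, c) \<in> all_mixed_crossings \<D> \<longleftrightarrow> D \<in> \<D> \<and> c \<in> mixed_crossings D"
    "self_crossings D \<subseteq> crossings D" "mixed_crossings D \<subseteq> crossings D" for D c
    by (auto simp: all_self_crossings_def all_mixed_crossings_def self_crossings_def mixed_crossings_def)
  have W1: "even_weight_function_on \<D> (all_self_crossings \<D>) (S1 \<kappa>1)"
      "even_weight_function \<D> (extend_zero (all_self_crossings \<D>) (S1 \<kappa>1))"
    by (rule weights[OF A(1,3) similar_self(1) similar_weights(4)]; assumption)+
  have W2: "even_weight_function_on \<D> (all_self_crossings \<D>) (S2 \<kappa>2)"
      "even_weight_function \<D> (extend_zero (all_self_crossings \<D>) (S2 \<kappa>2))"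
    by (rule weights[OF A(1,3) similar_self(1) similar_weights(5)]; assumption)+
  have W3: "even_weight_function_on \<D> (all_mixed_crossings \<D>) (S3 \<kappa>3)"
      "even_weight_function \<D> (extend_zero (all_mixed_crossings \<D>) (S3 \<kappa>3))"
    by (rule weights[OF A(2,4) similar_self(2) similar_weights(6)]; assumption)+
  have V: "\<forall>D\<in>\<D>.
        (\<forall>c\<in>self_crossings D. vl_diagram (smooth1 \<kappa>1 D c) \<and> vl_diagram (smooth2 \<kappa>2 D c)) \<and>
        (\<forall>c\<in>mixed_crossings D. vl_diagram (smooth3 \<kappa>3 D c))"
    using vl_smoothings[OF vl] by simp
  have R: "\<forall>D\<in>\<D>. \<forall>c\<in>crossings D. \<forall>over i.
        ri_reducible D c over \<and> i = strand_label D c over \<longrightarrow>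
          (S1 \<kappa>1 D c = flat_class D \<or> S1 \<kappa>1 D c = flat_class (reverse_component i D)) \<and>
          (\<forall>d. S2 \<kappa>2 D c = flat_class (with_unknot (over = \<kappa>2) D i d)) \<and>
          c \<notin> mixed_crossings D"
  proof (intro ballI allI impI, elim conjE)
    fix D c over i
    assume D: "D \<in> \<D>" "c \<in> crossings D" "ri_reducible D c over" and i: "i = strand_label D c over"
    show "(S1 \<kappa>1 D c = flat_class D \<or> S1 \<kappa>1 D c = flat_class (reverse_component i D)) \<and>
          (\<forall>d. S2 \<kappa>2 D c = flat_class (with_unknot (over = \<kappa>2) D i d)) \<and>
          c \<notin> mixed_crossings D"
      unfolding i using RI_reducible[OF vl[OF D(1)] D(2,3)] self_mixed_iff[OF D(2)] by simp
  qed
  show ?thesis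
    by (intro conjI V W1 W2 W3 R)
qed

end
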